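(* Let $M^n$ be a smooth closed orientable $n$-manifold and let $f:M^n\to M^n$ be a Morse-Smale diffeomorphism. In the set of all Lyapunov functions for $f$, equipped with the $C^\infty$-topology, the subset of those which are Morse-Lyapunov functions for $f$ is residual.
   Context: A diffeomorphism $f:M^n\to M^n$ is Morse-Smale if its nonwandering set $\Omega(f)$ consists of finitely many hyperbolic periodic points ($\Omega(f)=Per(f)$) whose invariant manifolds intersect mutually transversally. For a periodic point $p$ of period $k_p$, $W^s(p)=\{x\in M^n\mid f^{mk_p}(x)\to p \text{ as } m\to+\infty\}$ and $W^u(p)=\{x\in M^n\mid f^{mk_p}(x)\to p\text{ as } m\to-\infty\}$. A Lyapunov function for $f$ is a Morse function $\varphi:M^n\to\mathbb{R}$ (a smooth function all of whose critical points are non-degenerate) such that $\varphi(f(x))<\varphi(x)$ when $x$ is not a periodic point and $\varphi(f(x))=\varphi(x)$ when $x$ is a periodic point. A Lyapunov function $\varphi$ for $f$ is a Morse-Lyapunov function if every periodic point $p$ is a non-degenerate maximum of the restriction of $\varphi$ to the unstable manifold $W^u(p)$ and a non-degenerate minimum of the restriction of $\varphi$ to the stable manifold $W^s(p)$. A subset of a topological space is residual if it is a countable intersection of dense open subsets. *)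

theory Defs
  imports "HOL-Analysis.Analysis"
begin

text \<open>\<open>dir_derivs [v1, ..., vk] g\<close> is the iterated directional derivative
  \<open>D_v1 ... D_vk g\<close>; the list \<open>[v, w]\<close> gives the second derivative, i.e. the
  Hessian bilinear form evaluated at \<open>v\<close> and \<open>w\<close>.\<close>

primrec dir_derivs ::
    "'b::euclidean_space list \<Rightarrow> ('b \<Rightarrow> 'c::real_normed_vector) \<Rightarrow> 'b \<Rightarrow> 'c" where
  "dir_derivs [] g = g"
| "dir_derivs (v # vs) g = (\<lambda>x. frechet_derivative (dir_derivs vs g) (at x) v)"

text \<open>For open \<open>S\<close> this is membership in \<open>C^\<infinity>(S)\<close>: differentiability of every iterated
  derivative also makes every iterated derivative continuous.\<close>

definition smooth_on :: "'b::euclidean_space set \<Rightarrow> ('b \<Rightarrow> 'c::real_normed_vector) \<Rightarrow> bool" where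
  "smooth_on S g \<longleftrightarrow> (\<forall>vs. \<forall>x\<in>S. dir_derivs vs g differentiable (at x))"

text \<open>The underlying space is a whole type \<open>'a\<close>, Hausdorff and second countable by its sort; the
  smooth structure is given by an atlas of charts \<open>(U, c)\<close> with values in \<open>real ^ 'n\<close>. The
  dimension is \<open>CARD('n)\<close>. The atlas need not be maximal. The inverse of a chart is
  \<open>inv_into U c\<close>, which is arbitrary outside \<open>c ` U\<close>; as \<open>c ` U\<close> is open, derivatives at its
  points do not see these values.\<close>

type_synonym ('a, 'n) chart = "'a set \<times> ('a \<Rightarrow> real ^ 'n)"

definition is_chart :: "('a::topological_space, 'n::finite) chart \<Rightarrow> bool" where
  "is_chart = (\<lambda>(U, c). open U \<and> open (c ` U) \<and> homeomorphism U (c ` U) c (inv_into U c))"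

definition smooth_atlas ::
    "('a::{t2_space,second_countable_topology}, 'n::finite) chart set \<Rightarrow> bool" where
  "smooth_atlas A \<longleftrightarrow>
     (\<forall>C\<in>A. is_chart C) \<and> (\<Union>(U, c)\<in>A. U) = UNIV \<and>
     (\<forall>(U, c)\<in>A. \<forall>(V, d)\<in>A. smooth_on (c ` (U \<inter> V)) (d \<circ> inv_into U c))"

definition closed_manifold ::
    "('a::{t2_space,second_countable_topology}, 'n::finite) chart set \<Rightarrow> bool" where
  "closed_manifold A \<longleftrightarrow> smooth_atlas A \<and> compact (UNIV :: 'a set)"

definition orientable ::
    "('a::{t2_space,second_countable_topology}, 'n::finite) chart set \<Rightarrow> bool" where
  "orientable A \<longleftrightarrow>
     (\<exists>B. smooth_atlas B \<and> smooth_atlas (A \<union> B) \<and>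
       (\<forall>(U, c)\<in>B. \<forall>(V, d)\<in>B. \<forall>x\<in>U \<inter> V.
          det (matrix (frechet_derivative (d \<circ> inv_into U c) (at (c x)))) > 0))"

definition smooth_fun ::
    "('a::topological_space, 'n::finite) chart set \<Rightarrow> ('a \<Rightarrow> real) \<Rightarrow> bool" where
  "smooth_fun A \<phi> \<longleftrightarrow> (\<forall>(U, c)\<in>A. smooth_on (c ` U) (\<phi> \<circ> inv_into U c))"

definition smooth_map ::
    "('a::topological_space, 'n::finite) chart set \<Rightarrow> ('a \<Rightarrow> 'a) \<Rightarrow> bool" where
  "smooth_map A f \<longleftrightarrow> continuous_on UNIV f \<and>
     (\<forall>(U, c)\<in>A. \<forall>(V, d)\<in>A. smooth_on (c ` (U \<inter> f -` V)) (d \<circ> f \<circ> inv_into U c))"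

definition diffeomorphism ::
    "('a::topological_space, 'n::finite) chart set \<Rightarrow> ('a \<Rightarrow> 'a) \<Rightarrow> bool" where
  "diffeomorphism A f \<longleftrightarrow> bij f \<and> smooth_map A f \<and> smooth_map A (inv f)"

text \<open>\<open>immersion_onto A E j W\<close>: the restriction of \<open>j\<close> to the linear subspace \<open>E\<close> is an injective
  immersion of \<open>E\<close> (a copy of \<open>R^k\<close>, \<open>k = dim E\<close>) into the manifold with image \<open>W\<close>. Letting \<open>j\<close> be
  smooth on the whole of \<open>real ^ 'n\<close> loses nothing, since a smooth map on \<open>E\<close> can be precomposed
  with the orthogonal projection to \<open>E\<close>.\<close>

definition immersion_onto ::
    "('a::topological_space, 'n::finite) chart set \<Rightarrow> (real ^ 'n) set \<Rightarrow> (real ^ 'n \<Rightarrow> 'a) \<Rightarrow> 'a set \<Rightarrow> bool"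
  where
  "immersion_onto A E j W \<longleftrightarrow>
     subspace E \<and> continuous_on UNIV j \<and>
     (\<forall>(U, c)\<in>A. smooth_on (j -` U) (c \<circ> j)) \<and>
     inj_on j E \<and> j ` E = W \<and>
     (\<forall>(U, c)\<in>A. \<forall>y\<in>E \<inter> j -` U. inj_on (frechet_derivative (c \<circ> j) (at y)) E)"

definition immersed_submanifold ::
    "('a::topological_space, 'n::finite) chart set \<Rightarrow> 'a set \<Rightarrow> bool" where
  "immersed_submanifold A W \<longleftrightarrow> (\<exists>E j. immersion_onto A E j W)"

text \<open>Transversality presupposes immersed submanifolds and is required for all of their
  parametrizations, among them the standard ones of invariant manifolds that the stable manifold
  theorem provides. The tangent space at \<open>j y\<close> of the image of \<open>E\<close> under \<open>j\<close>, read in a chart \<open>(U, c)\<close>, is the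
  image of \<open>E\<close> under the derivative of \<open>c \<circ> j\<close> at \<open>y\<close>.\<close>

definition transversal ::
    "('a::topological_space, 'n::finite) chart set \<Rightarrow> 'a set \<Rightarrow> 'a set \<Rightarrow> bool" where
  "transversal A X Y \<longleftrightarrow>
     immersed_submanifold A X \<and> immersed_submanifold A Y \<and>
     (\<forall>E j F k. immersion_onto A E j X \<longrightarrow> immersion_onto A F k Y \<longrightarrow>
       (\<forall>y\<in>E. \<forall>z\<in>F. j y = k z \<longrightarrow>
         (\<forall>(U, c)\<in>A. j y \<in> U \<longrightarrow>
           {v + w |v w. v \<in> frechet_derivative (c \<circ> j) (at y) ` E \<and>
                        w \<in> frechet_derivative (c \<circ> k) (at z) ` F} = UNIV)))"

text \<open>The next two notions concern the restriction of \<open>g\<close> to the linear subspace \<open>E\<close> at the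
  point \<open>y\<close> of \<open>E\<close>.\<close>

definition critical_along ::
    "'b::euclidean_space set \<Rightarrow> ('b \<Rightarrow> real) \<Rightarrow> 'b \<Rightarrow> bool" where
  "critical_along E g y \<longleftrightarrow> (\<forall>v\<in>E. dir_derivs [v] g y = 0)"

definition nondegenerate_along ::
    "'b::euclidean_space set \<Rightarrow> ('b \<Rightarrow> real) \<Rightarrow> 'b \<Rightarrow> bool" where
  "nondegenerate_along E g y \<longleftrightarrow>
     (\<forall>v\<in>E. (\<forall>w\<in>E. dir_derivs [v, w] g y = 0) \<longrightarrow> v = 0)"

definition Morse_function ::
    "('a::topological_space, 'n::finite) chart set \<Rightarrow> ('a \<Rightarrow> real) \<Rightarrow> bool" where
  "Morse_function A \<phi> \<longleftrightarrow> smooth_fun A \<phi> \<and>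
     (\<forall>(U, c)\<in>A. \<forall>x\<in>U. critical_along UNIV (\<phi> \<circ> inv_into U c) (c x) \<longrightarrow>
        nondegenerate_along UNIV (\<phi> \<circ> inv_into U c) (c x))"

definition nondegenerate_critical_on ::
    "('a::topological_space, 'n::finite) chart set \<Rightarrow> 'a set \<Rightarrow> ('a \<Rightarrow> real) \<Rightarrow> 'a \<Rightarrow> bool" where
  "nondegenerate_critical_on A W \<phi> p \<longleftrightarrow>
     (\<exists>E j y. immersion_onto A E j W \<and> y \<in> E \<and> j y = p \<and>
        critical_along E (\<phi> \<circ> j) y \<and> nondegenerate_along E (\<phi> \<circ> j) y)"

definition nondegenerate_max_on ::
    "('a::topological_space, 'n::finite) chart set \<Rightarrow> 'a set \<Rightarrow> ('a \<Rightarrow> real) \<Rightarrow> 'a \<Rightarrow> bool" where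
  "nondegenerate_max_on A W \<phi> p \<longleftrightarrow>
     (\<forall>x\<in>W. \<phi> x \<le> \<phi> p) \<and> nondegenerate_critical_on A W \<phi> p"

definition nondegenerate_min_on ::
    "('a::topological_space, 'n::finite) chart set \<Rightarrow> 'a set \<Rightarrow> ('a \<Rightarrow> real) \<Rightarrow> 'a \<Rightarrow> bool" where
  "nondegenerate_min_on A W \<phi> p \<longleftrightarrow>
     (\<forall>x\<in>W. \<phi> p \<le> \<phi> x) \<and> nondegenerate_critical_on A W \<phi> p"

definition periodic_points :: "('a \<Rightarrow> 'a) \<Rightarrow> 'a set" where
  "periodic_points f = {p. \<exists>k>0. (f ^^ k) p = p}"

definition period :: "('a \<Rightarrow> 'a) \<Rightarrow> 'a \<Rightarrow> nat" where
  "period f p = (LEAST k. k > 0 \<and> (f ^^ k) p = p)"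

definition nonwandering :: "('a::topological_space \<Rightarrow> 'a) \<Rightarrow> 'a set" where
  "nonwandering f = {x. \<forall>U. open U \<and> x \<in> U \<longrightarrow> (\<exists>k>0. (f ^^ k) ` U \<inter> U \<noteq> {})}"

definition stable_set :: "('a::topological_space \<Rightarrow> 'a) \<Rightarrow> 'a \<Rightarrow> 'a set" where
  "stable_set f p = {x. (\<lambda>m. (f ^^ (m * period f p)) x) \<longlonglongrightarrow> p}"

definition unstable_set :: "('a::topological_space \<Rightarrow> 'a) \<Rightarrow> 'a \<Rightarrow> 'a set" where
  "unstable_set f p = {x. (\<lambda>m. (inv f ^^ (m * period f p)) x) \<longlonglongrightarrow> p}"

definition complex_eigenvalue :: "real ^ 'n ^ 'n::finite \<Rightarrow> complex \<Rightarrow> bool" where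
  "complex_eigenvalue T l \<longleftrightarrow>
     (\<exists>v. v \<noteq> 0 \<and> (\<chi> i j. complex_of_real (T $ i $ j)) *v v = l *s v)"

definition hyperbolic_periodic ::
    "('a::topological_space, 'n::finite) chart set \<Rightarrow> ('a \<Rightarrow> 'a) \<Rightarrow> 'a \<Rightarrow> bool" where
  "hyperbolic_periodic A f p \<longleftrightarrow> p \<in> periodic_points f \<and>
     (\<forall>(U, c)\<in>A. p \<in> U \<longrightarrow>
       (\<forall>l. complex_eigenvalue
              (matrix (frechet_derivative (c \<circ> (f ^^ period f p) \<circ> inv_into U c) (at (c p)))) l
            \<longrightarrow> cmod l \<noteq> 1))"

definition Morse_Smale ::
    "('a::topological_space, 'n::finite) chart set \<Rightarrow> ('a \<Rightarrow> 'a) \<Rightarrow> bool" where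
  "Morse_Smale A f \<longleftrightarrow> diffeomorphism A f \<and>
     finite (nonwandering f) \<and> nonwandering f = periodic_points f \<and>
     (\<forall>p\<in>periodic_points f. hyperbolic_periodic A f p) \<and>
     (\<forall>p\<in>periodic_points f. \<forall>q\<in>periodic_points f.
        transversal A (stable_set f p) (unstable_set f q))"

definition Lyapunov_function ::
    "('a::topological_space, 'n::finite) chart set \<Rightarrow> ('a \<Rightarrow> 'a) \<Rightarrow> ('a \<Rightarrow> real) \<Rightarrow> bool" where
  "Lyapunov_function A f \<phi> \<longleftrightarrow> Morse_function A \<phi> \<and>
     (\<forall>x. x \<notin> periodic_points f \<longrightarrow> \<phi> (f x) < \<phi> x) \<and>
     (\<forall>x. x \<in> periodic_points f \<longrightarrow> \<phi> (f x) = \<phi> x)"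

definition Morse_Lyapunov_function ::
    "('a::topological_space, 'n::finite) chart set \<Rightarrow> ('a \<Rightarrow> 'a) \<Rightarrow> ('a \<Rightarrow> real) \<Rightarrow> bool" where
  "Morse_Lyapunov_function A f \<phi> \<longleftrightarrow> Lyapunov_function A f \<phi> \<and>
     (\<forall>p\<in>periodic_points f.
        nondegenerate_max_on A (unstable_set f p) \<phi> p \<and>
        nondegenerate_min_on A (stable_set f p) \<phi> p)"

text \<open>\<open>Cr_nbhd A r C K \<epsilon> \<phi>\<close>: the smooth functions whose partial derivatives of order at most \<open>r\<close>
  in the chart \<open>C\<close> are \<open>\<epsilon>\<close>-close to those of \<open>\<phi>\<close> at all points of \<open>K\<close>.\<close>

definition Cr_nbhd ::
    "('a::topological_space, 'n::finite) chart set \<Rightarrow> nat \<Rightarrow> ('a, 'n) chart \<Rightarrow> 'a set \<Rightarrow> real \<Rightarrow>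
      ('a \<Rightarrow> real) \<Rightarrow> ('a \<Rightarrow> real) set" where
  "Cr_nbhd A r = (\<lambda>(U, c) K \<epsilon> \<phi>.
     {\<psi>. smooth_fun A \<psi> \<and>
        (\<forall>vs\<in>lists Basis. length vs \<le> r \<longrightarrow>
          (\<forall>x\<in>K. \<bar>dir_derivs vs (\<psi> \<circ> inv_into U c) (c x)
                  - dir_derivs vs (\<phi> \<circ> inv_into U c) (c x)\<bar> < \<epsilon>))})"

definition Cinf_topology ::
    "('a::topological_space, 'n::finite) chart set \<Rightarrow> ('a \<Rightarrow> real) topology" where
  "Cinf_topology A = topology_generated_by
     {Cr_nbhd A r C K \<epsilon> \<phi> |r C K \<epsilon> \<phi>.
        C \<in> A \<and> compact K \<and> K \<subseteq> fst C \<and> \<epsilon> > 0 \<and> smooth_fun A \<phi>}"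

definition residual_in :: "'x topology \<Rightarrow> 'x set \<Rightarrow> bool" where
  "residual_in T S \<longleftrightarrow>
     (\<exists>G :: nat \<Rightarrow> 'x set.
        (\<forall>i. openin T (G i) \<and> T closure_of (G i) = topspace T) \<and> S = (\<Inter>i. G i))"

end

theory Submission
  imports Defs "HOL-Computational_Algebra.Fundamental_Theorem_Algebra"
begin

text \<open>The Morse-Lyapunov functions are shown to be open and dense among the Lyapunov functions.

  Openness: a Lyapunov function automatically has its minimum over \<open>W\<^sup>s(p)\<close> and its maximum over
  \<open>W\<^sup>u(p)\<close> at \<open>p\<close>, so only the nondegeneracy is at stake, and it is an open condition on the 2-jet
  at the finitely many periodic points.

  Density: a Lyapunov function \<open>\<phi>\<close> is perturbed to \<open>\<phi> + e G\<close>, where \<open>G\<close> is built from bump functions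
  times quadratic forms at the periodic points that decrease strictly under the derivative of the
  first return map; such a form exists by hyperbolicity. For small \<open>e\<close> the sum is still a Morse
  function and a Lyapunov function. No stable manifold theorem is needed: orbits of points of
  \<open>W\<^sup>s(p)\<close> close to \<open>p\<close> stay close to \<open>p\<close> (because of \<open>\<phi>\<close>), and \<open>G\<close> decreases along them to
  its value at \<open>p\<close>; as \<open>G - R\<close>, with \<open>R\<close> of size \<open>|x - p|\<^sup>2\<close>, has the same property, \<open>G\<close> grows
  quadratically on \<open>W\<^sup>s(p)\<close>, whatever its parametrization.\<close>

section \<open>Smooth functions on Euclidean space\<close>

text \<open>A Lyapunov function can fail to be Morse-Lyapunov only because its Hessian at
  \<open>p\<close> along an invariant manifold is merely semidefinite. Adding \<open>e G\<close>
  with \<open>G \<ge> G p + R\<close> on the stable set near \<open>p\<close> cures this without any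
  knowledge of that Hessian: \<open>\<phi> \<ge> \<phi> p\<close> does no harm, and
  \<open>e R\<close> brings the quadratic growth. What shapes \<open>G\<close> is the opposite
  demand, that \<open>\<phi> + e G\<close> still decrease along \<open>f\<close>. Near a periodic
  point \<open>\<phi> (f x) - \<phi> x\<close> tends to 0 at an unknown rate, so \<open>G\<close>
  itself must decrease strictly there; elsewhere compactness leaves room for every small multiple of
  \<open>G\<close>. Both demands are met by one quadratic form that decreases under the derivative
  of the return map with a margin \<open>d\<close>, and this margin pays for \<open>R\<close>. Such
  a form is automatically positive along the stable and negative along the unstable
  directions.\<close>

lemma frechet_derivative_cong_open:
  assumes "open S" "x \<in> S" "\<And>x. x \<in> S \<Longrightarrow> g x = h x"
  shows "frechet_derivative g (at x) = frechet_derivative h (at x)"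
proof -
  \<comment> \<open>\<open>frechet_derivative\<close> is a choice among all derivatives, so equality
    of the predicates suffices, even where neither function is differentiable.\<close>
  have "(g has_derivative D) (at x) = (h has_derivative D) (at x)" for D
    using has_derivative_transform_within_open[OF _ assms(1,2)] assms(3) by metis
  then show ?thesis unfolding frechet_derivative_def by simp
qed

lemma dir_derivs_cong:
  assumes "open S" "\<And>x. x \<in> S \<Longrightarrow> g x = h x" "x \<in> S"
  shows "dir_derivs vs g x = dir_derivs vs h x"
  using assms(3)
proof (induction vs arbitrary: x)
  case (Cons v vs)
  then show ?case
    by (simp add: frechet_derivative_cong_open[OF assms(1), of x "dir_derivs vs g" "dir_derivs vs h"])
qed (use assms in auto)

lemma differentiable_cong_open:
  assumes "open S" "x \<in> S" "\<And>x. x \<in> S \<Longrightarrow> g x = h x" "g differentiable (at x)"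
  shows "h differentiable (at x)"
  using assms has_derivative_transform_within_open unfolding differentiable_def by blast

text \<open>The inductive step for all formulas of iterated derivatives: a formula for
  \<open>dir_derivs vs g\<close> may be differentiated once more because it holds on an open set
  around the point.\<close>

lemma dir_derivs_Cons_eq:
  assumes "open S" "x \<in> S" "\<And>x. x \<in> S \<Longrightarrow> dir_derivs vs g x = h x" "(h has_derivative D) (at x)"
  shows "dir_derivs (v # vs) g x = D v"
  using frechet_derivative_cong_open[OF assms(1,2), of "dir_derivs vs g" h] assms(3)
    frechet_derivative_at[OF assms(4)] by simp

lemma dir_derivs_append: "dir_derivs (vs @ ws) g = dir_derivs vs (dir_derivs ws g)"
  by (induction vs) auto

lemma has_frechet_derivative:
  "g differentiable (at x) \<Longrightarrow> (g has_derivative frechet_derivative g (at x)) (at x)"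
  by (simp add: frechet_derivative_works)

section \<open>Finite differentiability classes\<close>

text \<open>Off by one against the usual notion: on an open set, order 0 is differentiability, and
  order \<open>n\<close> means \<open>C^n\<close> with differentiable derivatives of order
  \<open>n\<close>. The grading exists for inductions on the order, which smoothness itself does not
  offer.\<close>

definition Ck_on :: "nat \<Rightarrow> 'b::euclidean_space set \<Rightarrow> ('b \<Rightarrow> 'c::real_normed_vector) \<Rightarrow> bool" where
  "Ck_on n S g \<longleftrightarrow> (\<forall>vs. length vs \<le> n \<longrightarrow> (\<forall>x\<in>S. dir_derivs vs g differentiable (at x)))"

lemma smooth_on_iff_Ck: "smooth_on S g \<longleftrightarrow> (\<forall>n. Ck_on n S g)"
  unfolding smooth_on_def Ck_on_def by auto

lemma Ck_on_0: "Ck_on 0 S g \<longleftrightarrow> (\<forall>x\<in>S. g differentiable (at x))"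
  by (simp add: Ck_on_def)

text \<open>\<open>dir_derivs\<close> adds derivatives on the outside. Here the innermost one, the
  last list entry, is split off, so that an induction on the order can replace the function by its
  first derivatives.\<close>

lemma Ck_on_Suc:
  "Ck_on (Suc n) S g \<longleftrightarrow> (\<forall>x\<in>S. g differentiable (at x)) \<and>
     (\<forall>v. Ck_on n S (\<lambda>x. frechet_derivative g (at x) v))"
proof -
  have *: "(\<lambda>x. frechet_derivative g (at x) v) = dir_derivs [v] g" for v by simp
  show ?thesis
    unfolding * Ck_on_def dir_derivs_append[symmetric]
  proof (safe, goal_cases)
    case (1 x) then show ?case by (metis dir_derivs.simps(1) le0 list.size(3))
  next
    case (2 v vs x) then show ?case by (metis length_append_singleton Suc_le_mono)
  next
    case (3 vs x) then show ?case
      by (cases vs rule: rev_cases) auto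
  qed
qed

lemma Ck_on_mono: "Ck_on n S g \<Longrightarrow> m \<le> n \<Longrightarrow> Ck_on m S g"
  unfolding Ck_on_def using order_trans by blast

lemma Ck_on_SucD: "Ck_on (Suc n) S g \<Longrightarrow> Ck_on n S g"
  by (erule Ck_on_mono) simp

lemma Ck_on_cong:
  assumes "open S" "\<And>x. x \<in> S \<Longrightarrow> g x = h x" "Ck_on n S g"
  shows "Ck_on n S h"
  unfolding Ck_on_def
proof (intro allI impI ballI)
  fix vs :: "'a list" and x assume "length vs \<le> n" "x \<in> S"
  with assms(3) have "dir_derivs vs g differentiable (at x)" by (auto simp: Ck_on_def)
  show "dir_derivs vs h differentiable (at x)"
    by (rule differentiable_cong_open[OF assms(1) \<open>x \<in> S\<close> _ \<open>dir_derivs vs g differentiable (at x)\<close>])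
      (rule dir_derivs_cong[OF assms(1,2)])
qed

lemma Ck_on_SucI:
  assumes "open S" "\<And>x. x \<in> S \<Longrightarrow> (g has_derivative g' x) (at x)" "\<And>v. Ck_on n S (\<lambda>x. g' x v)"
  shows "Ck_on (Suc n) S g"
  unfolding Ck_on_Suc
proof (intro conjI ballI allI)
  fix x assume "x \<in> S"
  then show "g differentiable (at x)" by (rule differentiableI[OF assms(2)])
next
  fix v
  have "g' x v = frechet_derivative g (at x) v" if "x \<in> S" for x
    using frechet_derivative_at[OF assms(2)[OF that]] by simp
  then show "Ck_on n S (\<lambda>x. frechet_derivative g (at x) v)"
    by (rule Ck_on_cong[OF assms(1) _ assms(3)])
qed

lemma Ck_on_deriv: "Ck_on n S g \<Longrightarrow> x \<in> S \<Longrightarrow> (g has_derivative frechet_derivative g (at x)) (at x)"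
  using Ck_on_mono[of n S g 0] by (auto simp: Ck_on_0 has_frechet_derivative)

lemma Ck_on_const: assumes "open S" shows "Ck_on n S (\<lambda>x. c)"
proof (induction n arbitrary: c)
  case (Suc n)
  show ?case by (rule Ck_on_SucI[OF assms has_derivative_const Suc])
qed (auto simp: Ck_on_0)

lemma Ck_on_add:
  assumes "open S" "Ck_on n S g" "Ck_on n S h"
  shows "Ck_on n S (\<lambda>x. g x + h x)"
  using assms(2,3)
proof (induction n arbitrary: g h)
  case (Suc n)
  show ?case
    by (rule Ck_on_SucI[OF assms(1)], rule has_derivative_add[OF Ck_on_deriv[OF Suc.prems(1)] Ck_on_deriv[OF Suc.prems(2)]])
       (use Suc in \<open>auto simp: Ck_on_Suc\<close>)
qed (auto simp: Ck_on_0)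

lemma Ck_on_sum:
  assumes "open S" "\<And>i. i \<in> I \<Longrightarrow> Ck_on n S (g i)"
  shows "Ck_on n S (\<lambda>x. \<Sum>i\<in>I. g i x)"
  using assms(2)
proof (induction I rule: infinite_finite_induct)
  case (insert i I)
  then show ?case using Ck_on_add[OF assms(1), of n "g i" "\<lambda>x. \<Sum>i\<in>I. g i x"] by simp
qed (simp_all add: Ck_on_const assms(1))

lemma Ck_on_bounded_linear:
  assumes "open S" "bounded_linear L" "Ck_on n S g"
  shows "Ck_on n S (\<lambda>x. L (g x))"
  using assms(3)
proof (induction n arbitrary: g)
  case 0
  then show ?case
    using differentiableI[OF bounded_linear.has_derivative[OF assms(2) Ck_on_deriv[OF 0]]]
    by (simp add: Ck_on_0)
next
  case (Suc n)
  show ?case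
    by (rule Ck_on_SucI[OF assms(1)], rule bounded_linear.has_derivative[OF assms(2) Ck_on_deriv[OF Suc.prems]])
       (use Suc in \<open>auto simp: Ck_on_Suc\<close>)
qed

lemma Ck_on_scaleR:
  fixes s :: "'b::euclidean_space \<Rightarrow> real"
  assumes "open S" "Ck_on n S s" "Ck_on n S g"
  shows "Ck_on n S (\<lambda>x. s x *\<^sub>R g x)"
  using assms(2,3)
proof (induction n arbitrary: s g)
  case 0
  then show ?case
    using differentiableI[OF has_derivative_scaleR[OF Ck_on_deriv[OF 0(1)] Ck_on_deriv[OF 0(2)]]]
    by (simp add: Ck_on_0)
next
  case (Suc n)
  show ?case
  proof (rule Ck_on_SucI[OF assms(1)])
    fix x assume "x \<in> S"
    show "((\<lambda>x. s x *\<^sub>R g x) has_derivative (\<lambda>v. s x *\<^sub>R frechet_derivative g (at x) v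
       + frechet_derivative s (at x) v *\<^sub>R g x)) (at x)"
      by (rule has_derivative_scaleR[OF Ck_on_deriv[OF Suc.prems(1)] Ck_on_deriv[OF Suc.prems(2)]]) fact+
  next
    fix v
    show "Ck_on n S (\<lambda>x. s x *\<^sub>R frechet_derivative g (at x) v
       + frechet_derivative s (at x) v *\<^sub>R g x)"
      using Suc.prems Suc.prems[THEN Ck_on_SucD]
      by (intro Ck_on_add assms(1) Suc.IH) (auto simp: Ck_on_Suc)
  qed
qed

lemma linear_eq_sum_Basis:
  fixes L :: "'b::euclidean_space \<Rightarrow> 'c::real_vector"
  assumes "linear L"
  shows "L v = (\<Sum>i\<in>Basis. (v \<bullet> i) *\<^sub>R L i)"
  using linear_sum[OF assms, of "\<lambda>i. (v \<bullet> i) *\<^sub>R i" Basis] linear_scale[OF assms]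
  by (simp add: euclidean_representation)

text \<open>By the chain rule the derivative of \<open>a \<circ> b\<close> contains the derivative
  of \<open>a\<close> at \<open>b x\<close>, a linear map depending on \<open>x\<close>. Expanding
  it in the basis leaves sums of products of functions of class \<open>n\<close>; the induction
  hypothesis is applied to the partial derivatives of \<open>a\<close>, with the same
  \<open>b\<close>.\<close>

lemma Ck_on_compose:
  fixes a :: "'d::euclidean_space \<Rightarrow> 'c::real_normed_vector" and b :: "'b::euclidean_space \<Rightarrow> 'd"
  assumes "open S" "open T" "b ` S \<subseteq> T" "Ck_on n T a" "Ck_on n S b"
  shows "Ck_on n S (\<lambda>x. a (b x))"
  using assms(4,5)
proof (induction n arbitrary: a)
  case 0
  then show ?case
    using assms(3) differentiable_chain_at[of b _ a] by (auto simp: Ck_on_0 o_def)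
next
  case (Suc n)
  show ?case
  proof (rule Ck_on_SucI[OF assms(1)])
    fix x assume x: "x \<in> S"
    then have bx: "b x \<in> T" using assms(3) by auto
    have "linear (frechet_derivative a (at (b x)))"
      using Ck_on_deriv[OF Suc.prems(1) bx] has_derivative_linear by blast
    then have eq: "(\<lambda>v. frechet_derivative a (at (b x)) (frechet_derivative b (at x) v)) =
       (\<lambda>v. \<Sum>i\<in>Basis. (frechet_derivative b (at x) v \<bullet> i) *\<^sub>R frechet_derivative a (at (b x)) i)"
      by (intro ext linear_eq_sum_Basis)
    show "((\<lambda>x. a (b x)) has_derivative (\<lambda>v. \<Sum>i\<in>Basis.
        (frechet_derivative b (at x) v \<bullet> i) *\<^sub>R frechet_derivative a (at (b x)) i)) (at x)"
      using diff_chain_at[OF Ck_on_deriv[OF Suc.prems(2) x] Ck_on_deriv[OF Suc.prems(1) bx]]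
      unfolding o_def eq .
  next
    fix v
    show "Ck_on n S (\<lambda>x. \<Sum>i\<in>Basis.
        (frechet_derivative b (at x) v \<bullet> i) *\<^sub>R frechet_derivative a (at (b x)) i)"
    proof (rule Ck_on_sum[OF assms(1) Ck_on_scaleR[OF assms(1)]])
      fix i :: 'd
      show "Ck_on n S (\<lambda>x. frechet_derivative b (at x) v \<bullet> i)"
        by (rule Ck_on_bounded_linear[OF assms(1) bounded_linear_inner_left])
          (use Suc.prems in \<open>auto simp: Ck_on_Suc\<close>)
      show "Ck_on n S (\<lambda>x. frechet_derivative a (at (b x)) i)"
        by (rule Suc.IH[OF _ Ck_on_SucD[OF Suc.prems(2)]])
          (use Suc.prems(1) in \<open>auto simp: Ck_on_Suc\<close>)
    qed
  qed
qed

section \<open>Calculus of smooth functions and their second derivatives\<close>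

lemma smooth_on_subset: "smooth_on T g \<Longrightarrow> S \<subseteq> T \<Longrightarrow> smooth_on S g"
  unfolding smooth_on_def by blast

lemma smooth_on_cong:
  "open S \<Longrightarrow> (\<And>x. x \<in> S \<Longrightarrow> g x = h x) \<Longrightarrow> smooth_on S g \<Longrightarrow> smooth_on S h"
  unfolding smooth_on_iff_Ck using Ck_on_cong by blast

lemma smooth_on_local:
  "(\<And>x. x \<in> S \<Longrightarrow> \<exists>T. x \<in> T \<and> smooth_on T g) \<Longrightarrow> smooth_on S g"
  unfolding smooth_on_def by blast

lemma smooth_on_const: "open S \<Longrightarrow> smooth_on S (\<lambda>x. c)"
  by (simp add: smooth_on_iff_Ck Ck_on_const)

lemma smooth_on_add:
  "open S \<Longrightarrow> smooth_on S g \<Longrightarrow> smooth_on S h \<Longrightarrow> smooth_on S (\<lambda>x. g x + h x)"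
  by (simp add: smooth_on_iff_Ck Ck_on_add)

lemma smooth_on_sum:
  "open S \<Longrightarrow> (\<And>i. i \<in> I \<Longrightarrow> smooth_on S (g i)) \<Longrightarrow> smooth_on S (\<lambda>x. \<Sum>i\<in>I. g i x)"
  by (simp add: smooth_on_iff_Ck Ck_on_sum)

lemma smooth_on_bounded_linear:
  "open S \<Longrightarrow> bounded_linear L \<Longrightarrow> smooth_on S g \<Longrightarrow> smooth_on S (\<lambda>x. L (g x))"
  by (simp add: smooth_on_iff_Ck Ck_on_bounded_linear)

lemma smooth_on_mult:
  fixes s g :: "'b::euclidean_space \<Rightarrow> real"
  shows "open S \<Longrightarrow> smooth_on S s \<Longrightarrow> smooth_on S g \<Longrightarrow> smooth_on S (\<lambda>x. s x * g x)"
  using Ck_on_scaleR[of S _ s g] by (simp add: smooth_on_iff_Ck)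

lemma smooth_on_compose:
  fixes a :: "'d::euclidean_space \<Rightarrow> 'c::real_normed_vector" and b :: "'b::euclidean_space \<Rightarrow> 'd"
  shows "open S \<Longrightarrow> open T \<Longrightarrow> b ` S \<subseteq> T \<Longrightarrow> smooth_on T a \<Longrightarrow> smooth_on S b \<Longrightarrow>
    smooth_on S (\<lambda>x. a (b x))"
  using Ck_on_compose[of S T b _ a] by (simp add: smooth_on_iff_Ck)

lemma smooth_on_ident: "open S \<Longrightarrow> smooth_on S (\<lambda>x. x)"
  unfolding smooth_on_iff_Ck
proof
  fix n assume "open S"
  then show "Ck_on n S (\<lambda>x::'a. x)"
    by (cases n) (auto simp: Ck_on_0 intro!: Ck_on_SucI[OF _ has_derivative_ident] Ck_on_const)
qed

lemma smooth_on_has_derivative: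
  "smooth_on S g \<Longrightarrow> x \<in> S \<Longrightarrow>
    (dir_derivs vs g has_derivative (\<lambda>v. dir_derivs (v # vs) g x)) (at x)"
  unfolding smooth_on_def dir_derivs.simps by (blast intro: has_frechet_derivative)

lemma smooth_on_continuous:
  assumes "smooth_on S g" shows "continuous_on S (dir_derivs vs g)"
  by (intro continuous_at_imp_continuous_on ballI)
     (rule has_derivative_continuous[OF smooth_on_has_derivative[OF assms]])

lemma smooth_on_linear_Cons:
  "smooth_on S g \<Longrightarrow> x \<in> S \<Longrightarrow> linear (\<lambda>v. dir_derivs (v # vs) g x)"
  by (rule has_derivative_linear[OF smooth_on_has_derivative])

lemma dir_derivs_add:
  assumes "open S" "smooth_on S g" "smooth_on S h" "x \<in> S"
  shows "dir_derivs vs (\<lambda>x. g x + h x) x = dir_derivs vs g x + dir_derivs vs h x"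
  using assms(4)
proof (induction vs arbitrary: x)
  case (Cons v vs)
  show ?case
    by (rule dir_derivs_Cons_eq[OF assms(1) Cons(2) Cons.IH])
       (assumption, intro has_derivative_add
           smooth_on_has_derivative[OF assms(2)] smooth_on_has_derivative[OF assms(3)] Cons)
qed auto

lemma dir_derivs_bounded_linear:
  assumes "open S" "smooth_on S g" "bounded_linear L" "x \<in> S"
  shows "dir_derivs vs (\<lambda>x. L (g x)) x = L (dir_derivs vs g x)"
  using assms(4)
proof (induction vs arbitrary: x)
  case (Cons v vs)
  show ?case
    by (rule dir_derivs_Cons_eq[OF assms(1) Cons(2) Cons.IH])
       (assumption, intro bounded_linear.has_derivative[OF assms(3)] smooth_on_has_derivative[OF assms(2)] Cons)
qed auto

text \<open>Linearity in the outer direction is that of a derivative. Linearity in the inner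
  direction has to be known in a neighbourhood before the outer derivative is taken.\<close>

lemma dir_derivs_linear_snd:
  assumes "open S" "smooth_on S g" "x \<in> S"
  shows "dir_derivs [v, w] g x = (\<Sum>i\<in>Basis. (w \<bullet> i) *\<^sub>R dir_derivs [v, i] g x)"
proof (rule dir_derivs_Cons_eq[OF assms(1,3)])
  show "dir_derivs [w] g x = (\<Sum>i\<in>Basis. (w \<bullet> i) *\<^sub>R dir_derivs [i] g x)" if "x \<in> S" for x
    by (rule linear_eq_sum_Basis[OF smooth_on_linear_Cons[OF assms(2) that]])
  show "((\<lambda>x. \<Sum>i\<in>Basis. (w \<bullet> i) *\<^sub>R dir_derivs [i] g x) has_derivative
      (\<lambda>v. \<Sum>i\<in>Basis. (w \<bullet> i) *\<^sub>R dir_derivs [v, i] g x)) (at x)"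
    by (intro has_derivative_sum has_derivative_scaleR_right smooth_on_has_derivative[OF assms(2,3)])
qed

lemma dir_derivs_compose1:
  fixes a :: "'d::euclidean_space \<Rightarrow> real" and b :: "'b::euclidean_space \<Rightarrow> 'd"
  assumes "smooth_on T a" "smooth_on S b" "x \<in> S" "b x \<in> T"
  shows "dir_derivs [v] (\<lambda>x. a (b x)) x = dir_derivs [dir_derivs [v] b x] a (b x)"
proof (rule dir_derivs_Cons_eq[OF open_UNIV])
  show "((\<lambda>x. a (b x)) has_derivative (\<lambda>v. dir_derivs [dir_derivs [v] b x] a (b x))) (at x)"
    using diff_chain_at[OF smooth_on_has_derivative[OF assms(2,3), of "[]", unfolded dir_derivs.simps(1)]
        smooth_on_has_derivative[OF assms(1,4), of "[]"]]
    unfolding dir_derivs.simps(1) o_def .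
qed auto

text \<open>The second summand is the reason why the Hessian transforms as a bilinear form only at
  critical points. Both the change of charts and the restriction to parametrized invariant manifolds
  rest on this formula.\<close>

lemma dir_derivs_compose2:
  fixes a :: "'d::euclidean_space \<Rightarrow> real" and b :: "'b::euclidean_space \<Rightarrow> 'd"
  assumes "open S" "open T" "b ` S \<subseteq> T" "smooth_on T a" "smooth_on S b" "x \<in> S"
  shows "dir_derivs [v, w] (\<lambda>x. a (b x)) x
    = dir_derivs [dir_derivs [v] b x, dir_derivs [w] b x] a (b x)
      + dir_derivs [dir_derivs [v, w] b x] a (b x)"
proof -
  have bx: "b x \<in> T" if "x \<in> S" for x using assms(3) that by auto
  have "dir_derivs [v, w] (\<lambda>x. a (b x)) x
      = (\<Sum>i\<in>Basis. (dir_derivs [w] b x \<bullet> i) * dir_derivs [dir_derivs [v] b x, i] a (b x)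
        + (dir_derivs [v, w] b x \<bullet> i) * dir_derivs [i] a (b x))"
  proof (rule dir_derivs_Cons_eq[OF assms(1,6)])
    show "dir_derivs [w] (\<lambda>x. a (b x)) x
        = (\<Sum>i\<in>Basis. (dir_derivs [w] b x \<bullet> i) * dir_derivs [i] a (b x))" if "x \<in> S" for x
      unfolding dir_derivs_compose1[OF assms(4,5) that bx[OF that]]
      using linear_eq_sum_Basis[OF smooth_on_linear_Cons[OF assms(4) bx[OF that], of "[]"],
          of "dir_derivs [w] b x"]
      unfolding real_scaleR_def .
    show "((\<lambda>x. \<Sum>i\<in>Basis. (dir_derivs [w] b x \<bullet> i) * dir_derivs [i] a (b x)) has_derivative
       (\<lambda>v. \<Sum>i\<in>Basis. (dir_derivs [w] b x \<bullet> i) * dir_derivs [dir_derivs [v] b x, i] a (b x)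
          + (dir_derivs [v, w] b x \<bullet> i) * dir_derivs [i] a (b x))) (at x)"
    proof (intro has_derivative_sum has_derivative_mult has_derivative_inner_left)
      fix i :: 'd
      show "((\<lambda>x. dir_derivs [i] a (b x)) has_derivative
          (\<lambda>v. dir_derivs [dir_derivs [v] b x, i] a (b x))) (at x)"
        using diff_chain_at[OF
            smooth_on_has_derivative[OF assms(5,6), of "[]", unfolded dir_derivs.simps(1)]
            smooth_on_has_derivative[OF assms(4) bx[OF assms(6)], of "[i]"]]
        unfolding dir_derivs.simps(1) o_def .
    qed (rule smooth_on_has_derivative[OF assms(5,6)])
  qed
  then show ?thesis
    unfolding sum.distrib
    using linear_eq_sum_Basis[OF smooth_on_linear_Cons[OF assms(4) bx[OF assms(6)], of "[]"],
        of "dir_derivs [v, w] b x"]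
      dir_derivs_linear_snd[OF assms(2,4) bx[OF assms(6)], of "dir_derivs [v] b x" "dir_derivs [w] b x"]
    by (simp only: real_scaleR_def)
qed

declare dir_derivs.simps(2) [simp del]

section \<open>Second-order conditions along subspaces\<close>

lemma has_derivative_along_line:
  assumes "smooth_on S h" "y + t *\<^sub>R v \<in> S"
  shows "((\<lambda>t. dir_derivs vs h (y + t *\<^sub>R v)) has_real_derivative dir_derivs (v # vs) h (y + t *\<^sub>R v)) (at t)"
proof -
  have "((\<lambda>t. y + t *\<^sub>R v) has_derivative (\<lambda>s. s *\<^sub>R v)) (at t)"
    by (auto intro!: derivative_eq_intros)
  from diff_chain_at[OF this smooth_on_has_derivative[OF assms, of vs]]
  have "((\<lambda>t. dir_derivs vs h (y + t *\<^sub>R v)) has_derivative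
      (\<lambda>s. dir_derivs ((s *\<^sub>R v) # vs) h (y + t *\<^sub>R v))) (at t)"
    unfolding o_def .
  moreover have "dir_derivs ((s *\<^sub>R v) # vs) h (y + t *\<^sub>R v) = dir_derivs (v # vs) h (y + t *\<^sub>R v) * s" for s
    using linear_scale[OF smooth_on_linear_Cons[OF assms, of vs]] by (simp only: real_scaleR_def mult.commute)
  ultimately show ?thesis unfolding has_field_derivative_def by (simp only:)
qed

lemma open_contains_line:
  fixes y v :: "'b::real_normed_vector"
  assumes "open S" "y \<in> S"
  shows "\<exists>d>0. \<forall>t. \<bar>t\<bar> < d \<longrightarrow> y + t *\<^sub>R v \<in> S"
proof -
  have "open ((\<lambda>t. y + t *\<^sub>R v) -` S)"
    by (intro open_vimage assms continuous_intros)
  then obtain d where "d > 0" "ball 0 d \<subseteq> (\<lambda>t. y + t *\<^sub>R v) -` S"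
    using assms(2) openE[of "(\<lambda>t. y + t *\<^sub>R v) -` S" 0] by auto
  then show ?thesis by (intro exI[of _ d]) (auto simp: subset_iff dist_norm)
qed

text \<open>One-variable Fermat on the lines \<open>y + t v\<close>, which stay in \<open>E\<close>
  because \<open>y\<close> and \<open>v\<close> lie there.\<close>

lemma critical_along_local_min:
  fixes h :: "'b::euclidean_space \<Rightarrow> real"
  assumes "smooth_on S h" "y \<in> S" "subspace E" "y \<in> E"
    and "open U" "y \<in> U" "\<And>x. x \<in> U \<inter> E \<Longrightarrow> h y \<le> h x"
  shows "critical_along E h y"
  unfolding critical_along_def
proof
  fix v assume v: "v \<in> E"
  obtain d where d: "d > 0" "\<And>t. \<bar>t\<bar> < d \<Longrightarrow> y + t *\<^sub>R v \<in> U"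
    using open_contains_line[OF assms(5,6), of v] by blast
  have "((\<lambda>t. h (y + t *\<^sub>R v)) has_real_derivative dir_derivs [v] h y) (at 0)"
    using has_derivative_along_line[OF assms(1), of y 0 v "[]"] assms(2) by simp
  moreover have "h (y + 0 *\<^sub>R v) \<le> h (y + t *\<^sub>R v)" if "\<bar>t\<bar> < d" for t
    using d(2)[OF that] v assms(3,4,7) by (simp add: subspace_add subspace_scale)
  ultimately show "dir_derivs [v] h y = 0"
    by (intro DERIV_local_min[OF _ d(1)]) auto
qed

text \<open>The growth is tested along a kernel vector \<open>v\<close> of the Hessian. The
  derivative of \<open>h\<close> on the line \<open>y + t v\<close> is then \<open>o(t)\<close>, so
  by the mean value theorem \<open>h\<close> gains less than \<open>c |v|^2 t^2\<close> for some
  small \<open>t > 0\<close>, against the hypothesis.\<close>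

lemma nondegenerate_along_quadratic_growth:
  fixes h :: "'b::euclidean_space \<Rightarrow> real"
  assumes "smooth_on S h" "open S" "y \<in> S" "subspace E" "y \<in> E"
    and "open U" "y \<in> U" "c > 0" and growth: "\<And>x. x \<in> U \<inter> E \<Longrightarrow> h y + c * (norm (x - y))\<^sup>2 \<le> h x"
  shows "nondegenerate_along E h y"
  unfolding nondegenerate_along_def
proof (intro ballI impI, rule ccontr)
  fix v assume v: "v \<in> E" "\<forall>w\<in>E. dir_derivs [v, w] h y = 0" "v \<noteq> 0"
  have "h y \<le> h x" if "x \<in> U \<inter> E" for x
    using growth[OF that] \<open>c > 0\<close> mult_nonneg_nonneg[OF less_imp_le zero_le_power2, of c "norm (x - y)"] by linarith
  then have "critical_along E h y"
    by (rule critical_along_local_min[OF assms(1,3,4,5,6,7)])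
  then have crit: "dir_derivs [v] h y = 0" using v by (simp add: critical_along_def)
  define H where "H t = h (y + t *\<^sub>R v)" for t
  define H' where "H' t = dir_derivs [v] h (y + t *\<^sub>R v)" for t
  define e where "e = c * (norm v)\<^sup>2"
  have "e > 0" using v \<open>c > 0\<close> by (simp add: e_def)
  obtain d1 where d1: "d1 > 0" "\<And>t. \<bar>t\<bar> < d1 \<Longrightarrow> y + t *\<^sub>R v \<in> U \<inter> S"
    using open_contains_line[OF open_Int[OF assms(6,2)], of y v] assms(3,7) by blast
  have H: "(H has_real_derivative H' t) (at t)" if "\<bar>t\<bar> < d1" for t
    using has_derivative_along_line[OF assms(1), of y t v "[]"] d1(2)[OF that]
    by (simp add: H_def[abs_def] H'_def)
  have "(H' has_real_derivative dir_derivs [v, v] h y) (at 0)"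
    using has_derivative_along_line[OF assms(1), of y 0 v "[v]"] assms(3)
    by (simp add: H'_def[abs_def])
  then have "(H' has_real_derivative 0) (at 0)" using v by simp
  then have "(\<lambda>t. H' t / t) \<midarrow>0\<rightarrow> 0"
    using crit by (simp add: DERIV_def H'_def)
  from LIM_D[OF this \<open>e > 0\<close>] obtain d2 where
    d2: "d2 > 0" "\<And>t. t \<noteq> 0 \<Longrightarrow> \<bar>t\<bar> < d2 \<Longrightarrow> \<bar>H' t / t\<bar> < e"
    by auto
  define t where "t = min d1 d2 / 2"
  have t: "0 < t" "t < d1" "t < d2" using d1(1) d2(1) by (auto simp: t_def)
  have "\<exists>s. 0 < s \<and> s < t \<and> H t - H 0 = (t - 0) * H' s"
    by (rule MVT2[OF t(1)]) (use H t in auto)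
  then obtain s where s: "0 < s" "s < t" "H t - H 0 = t * H' s" by auto
  have "\<bar>H' s / s\<bar> < e" using d2(2)[of s] s t by auto
  then have "H' s < e * s" using s(1) by (auto simp: abs_less_iff divide_less_eq)
  also have "\<dots> < e * t" using s \<open>e > 0\<close> by simp
  finally have "H t - H 0 < t * (e * t)" unfolding s(3) using t(1) by simp
  moreover have "h y + c * (norm (y + t *\<^sub>R v - y))\<^sup>2 \<le> h (y + t *\<^sub>R v)"
    by (rule growth) (use d1(2)[of t] t v assms in \<open>simp add: subspace_add subspace_scale\<close>)
  ultimately show False
    using t by (simp add: H_def e_def power2_eq_square algebra_simps)
qed

lemma critical_along_uminus:
  assumes "open S" "smooth_on S h" "y \<in> S"
  shows "critical_along E (\<lambda>x. - h x) y \<longleftrightarrow> critical_along E h y"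
  using dir_derivs_bounded_linear[OF assms(1,2) bounded_linear_minus[OF bounded_linear_ident] assms(3)]
  by (simp add: critical_along_def)

lemma nondegenerate_along_uminus:
  assumes "open S" "smooth_on S h" "y \<in> S"
  shows "nondegenerate_along E (\<lambda>x. - h x) y \<longleftrightarrow> nondegenerate_along E h y"
  using dir_derivs_bounded_linear[OF assms(1,2) bounded_linear_minus[OF bounded_linear_ident] assms(3)]
  by (simp add: nondegenerate_along_def)

lemma smooth_on_uminus:
  "open S \<Longrightarrow> smooth_on S h \<Longrightarrow> smooth_on S (\<lambda>x. - h x)"
  using smooth_on_bounded_linear[OF _ bounded_linear_minus[OF bounded_linear_ident]] .

text \<open>Kernel vectors are normalized and accumulate on the compact unit sphere of
  \<open>E\<close>. Pointwise convergence of the forms is enough, since the basis expansion in the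
  first argument carries it over to the moving vectors \<open>u n\<close>. In contrapositive form
  this is the openness of nondegeneracy.\<close>

lemma degenerate_bilinear_limit:
  fixes H :: "nat \<Rightarrow> 'b::euclidean_space \<Rightarrow> 'b \<Rightarrow> real"
  assumes lin: "\<And>n w. linear (\<lambda>v. H n v w)" and lim: "\<And>v w. (\<lambda>n. H n v w) \<longlonglongrightarrow> G v w"
    and E: "subspace E" and deg: "\<And>n. \<exists>v\<in>E. v \<noteq> 0 \<and> (\<forall>w\<in>E. H n v w = 0)"
  shows "\<exists>v\<in>E. v \<noteq> 0 \<and> (\<forall>w\<in>E. G v w = 0)"
proof -
  have "\<exists>u. u \<in> E \<inter> sphere 0 1 \<and> (\<forall>w\<in>E. H n u w = 0)" for n
  proof -
    obtain v where v: "v \<in> E" "v \<noteq> 0" "\<forall>w\<in>E. H n v w = 0" using deg by blast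
    have "H n ((1 / norm v) *\<^sub>R v) w = 0" if "w \<in> E" for w
      using linear_scale[OF lin[of n w], of "1 / norm v" v] v(3) that by simp
    then show ?thesis using v E by (intro exI[of _ "(1 / norm v) *\<^sub>R v"]) (auto simp: subspace_scale)
  qed
  then obtain u where u: "\<And>n. u n \<in> E \<inter> sphere 0 1" "\<And>n w. w \<in> E \<Longrightarrow> H n (u n) w = 0"
    by metis
  have "compact (E \<inter> sphere 0 1)" using closed_subspace[OF E] by (intro closed_Int_compact) auto
  then obtain l r where l: "l \<in> E \<inter> sphere 0 1" "strict_mono r" "(u \<circ> r) \<longlonglongrightarrow> l"
    using u(1) unfolding compact_def by metis
  have "G l w = 0" if "w \<in> E" for w
  proof -
    have "H n v w = (\<Sum>i\<in>Basis. (v \<bullet> i) * H n i w)" for n v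
      using linear_eq_sum_Basis[OF lin[of n w], of v] by simp
    note sum = this
    have G: "G l w = (\<Sum>i\<in>Basis. (l \<bullet> i) * G i w)"
    proof (rule LIMSEQ_unique[OF lim])
      show "(\<lambda>n. H n l w) \<longlonglongrightarrow> (\<Sum>i\<in>Basis. (l \<bullet> i) * G i w)"
        unfolding sum[of _ l] by (intro tendsto_intros lim)
    qed
    have "(\<lambda>n. H (r n) (u (r n)) w) \<longlonglongrightarrow> (\<Sum>i\<in>Basis. (l \<bullet> i) * G i w)"
      unfolding sum[of _ "u _"]
      using l(3) LIMSEQ_subseq_LIMSEQ[OF lim l(2)]
      by (intro tendsto_intros) (simp_all add: o_def)
    then show ?thesis unfolding G u(2)[OF that] by (simp add: LIMSEQ_const_iff)
  qed
  then show ?thesis using l(1) by (intro bexI[of _ l]) auto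
qed

text \<open>An injective linear map on a finite-dimensional subspace is bounded below by some
  \<open>e\<close>; an approximation error of at most \<open>e / 2\<close> leaves the other half.
  This converts distances in a chart into distances in the parameter space of an immersion.\<close>

lemma injective_derivative_lower_bound:
  fixes b :: "'b::euclidean_space \<Rightarrow> 'd::euclidean_space"
  assumes b: "(b has_derivative D) (at y)" and "inj_on D E" "subspace E" "y \<in> E"
  obtains c d where "c > 0" "d > 0"
    "\<And>x. x \<in> E \<Longrightarrow> norm (x - y) < d \<Longrightarrow> c * norm (x - y) \<le> norm (b x - b y)"
proof -
  have D: "bounded_linear D" by (rule has_derivative_bounded_linear[OF b])
  have "\<forall>x\<in>E. D x = 0 \<longrightarrow> x = 0"
    using assms(2,3) linear_0[OF bounded_linear.linear[OF D]] by (metis inj_onD subspace_0)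
  then obtain e where e: "e > 0" "\<forall>x\<in>E. e * norm x \<le> norm (D x)"
    using injective_imp_isometric[OF closed_subspace[OF assms(3)] assms(3) D] by blast
  then obtain d where d: "d > 0"
    "\<And>x. norm (x - y) < d \<Longrightarrow> norm (b x - b y - D (x - y)) \<le> e / 2 * norm (x - y)"
    using b unfolding has_derivative_at_alt by (meson half_gt_zero)
  show thesis
  proof (rule that)
    fix x assume "x \<in> E" "norm (x - y) < d"
    then have "e * norm (x - y) \<le> norm (D (x - y))" using e assms(3,4) by (simp add: subspace_diff)
    also have "\<dots> \<le> norm (b x - b y) + norm (b x - b y - D (x - y))"
      using norm_triangle_ineq4[of "b x - b y" "b x - b y - D (x - y)"] by simp
    finally show "e / 2 * norm (x - y) \<le> norm (b x - b y)"
      using d(2)[OF \<open>norm (x - y) < d\<close>] by simp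
  qed (use e d in auto)
qed

section \<open>A smooth bump function\<close>

text \<open>The polynomial parameter closes the family under differentiation: with
  \<open>s = 1 / t\<close>, the derivative of \<open>p(s) exp(-s)\<close> is
  \<open>s^2 (p(s) - p'(s)) exp(-s)\<close>. Smoothness becomes an induction over all
  \<open>p\<close> at once.\<close>

definition flat :: "real poly \<Rightarrow> real \<Rightarrow> real" where
  "flat p t = (if t > 0 then poly p (1 / t) * exp (- (1 / t)) else 0)"

text \<open>The quotient by \<open>t\<close> is the difference quotient at 0. After substituting
  \<open>s = 1 / t\<close> it only raises the power \<open>s ^ i\<close> to
  \<open>s ^ Suc i\<close>, which \<open>exp s\<close> still dominates.\<close>

lemma flat_tendsto_0: "((\<lambda>t. flat p t / t) \<longlongrightarrow> 0) (at_right 0)"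
proof -
  have "((\<lambda>s. \<Sum>i\<le>degree p. coeff p i * (s ^ Suc i / exp s)) \<longlongrightarrow> (\<Sum>i\<le>degree p. coeff p i * 0)) at_top"
    by (intro tendsto_intros tendsto_power_div_exp_0)
  moreover have "(\<Sum>i\<le>degree p. coeff p i * (s ^ Suc i / exp s)) = flat p (inverse s) / inverse s" if "s > 0" for s
    using that by (simp add: flat_def poly_altdef exp_minus sum_distrib_right sum_distrib_left
        divide_inverse ac_simps)
  then have "\<forall>\<^sub>F s in at_top. (\<Sum>i\<le>degree p. coeff p i * (s ^ Suc i / exp s)) = flat p (inverse s) / inverse s"
    by (rule eventually_mono[OF eventually_gt_at_top[of 0]])
  ultimately have "((\<lambda>s. flat p (inverse s) / inverse s) \<longlongrightarrow> (\<Sum>i\<le>degree p. coeff p i * 0)) at_top"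
    by (rule Lim_transform_eventually)
  then have "((\<lambda>s. flat p (inverse s) / inverse s) \<longlongrightarrow> 0) at_top" by simp
  then show ?thesis by (subst filterlim_at_right_to_top)
qed

lemma has_real_derivative_flat:
  "(flat p has_real_derivative flat (monom 1 2 * (p - pderiv p)) t) (at t)"
proof -
  consider "t > 0" | "t < 0" | "t = 0" by linarith
  then show ?thesis
  proof cases
    case 1
    have "((\<lambda>t. poly p (1 / t) * exp (- (1 / t))) has_real_derivative
        flat (monom 1 2 * (p - pderiv p)) t) (at t)"
      using 1 by (auto intro!: derivative_eq_intros DERIV_chain2[OF poly_DERIV]
          simp: flat_def poly_monom field_simps power2_eq_square)
    then show ?thesis
      by (rule has_field_derivative_transform_within_open[of _ _ _ "{0<..}"]) (use 1 in \<open>auto simp: flat_def\<close>)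
  next
    case 2
    have "((\<lambda>t. 0) has_real_derivative flat (monom 1 2 * (p - pderiv p)) t) (at t)"
      using 2 by (simp add: flat_def)
    then show ?thesis
      by (rule has_field_derivative_transform_within_open[of _ _ _ "{..<0}"]) (use 2 in \<open>auto simp: flat_def\<close>)
  next
    case 3
    have "((\<lambda>t. flat p t / t) \<longlongrightarrow> 0) (at_left 0)"
      by (rule tendsto_eventually) (auto simp: flat_def eventually_at_filter)
    then have "((\<lambda>t. flat p t / t) \<longlongrightarrow> 0) (at 0)"
      by (rule filterlim_split_at[OF _ flat_tendsto_0])
    moreover have "flat q 0 = 0" for q by (simp add: flat_def)
    ultimately show ?thesis using 3 by (simp add: DERIV_def)
  qed
qed

lemma smooth_on_flat: "smooth_on UNIV (flat p)"
proof -
  have "Ck_on n UNIV (flat p)" for n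
  proof (induction n arbitrary: p)
    case 0
    show ?case
      unfolding Ck_on_0
      by (intro ballI differentiableI[OF has_real_derivative_flat[unfolded has_field_derivative_def]])
  next
    case (Suc n)
    show ?case
    proof (rule Ck_on_SucI)
      show "(flat p has_derivative (\<lambda>v. v *\<^sub>R flat (monom 1 2 * (p - pderiv p)) t)) (at t)" for t
        using has_real_derivative_flat[of p t] by (simp add: has_field_derivative_def mult_commute_abs)
      show "Ck_on n UNIV (\<lambda>t. v *\<^sub>R flat (monom 1 2 * (p - pderiv p)) t)" for v
        by (rule Ck_on_bounded_linear[OF open_UNIV bounded_linear_scaleR_right Suc])
    qed simp
  qed
  then show ?thesis by (simp add: smooth_on_iff_Ck)
qed

lemma smooth_on_inner:
  fixes g h :: "'b::euclidean_space \<Rightarrow> 'd::euclidean_space"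
  assumes "open S" "smooth_on S g" "smooth_on S h"
  shows "smooth_on S (\<lambda>x. g x \<bullet> h x)"
proof -
  have eq: "(\<lambda>x. g x \<bullet> h x) = (\<lambda>x. \<Sum>i\<in>Basis. (g x \<bullet> i) * (h x \<bullet> i))"
    by (intro ext euclidean_inner)
  show ?thesis
    unfolding eq by (intro smooth_on_sum smooth_on_mult smooth_on_bounded_linear[OF _ bounded_linear_inner_left] assms)
qed

definition bump :: "real \<Rightarrow> 'b::euclidean_space \<Rightarrow> real" where
  "bump r u = flat 1 (r\<^sup>2 - u \<bullet> u)"

lemma smooth_on_bump: "smooth_on UNIV (bump r)"
  unfolding bump_def[abs_def]
proof (rule smooth_on_compose[of UNIV UNIV "\<lambda>u. r\<^sup>2 - u \<bullet> u" "flat 1"])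
  have "smooth_on UNIV (\<lambda>u::'a. r\<^sup>2 + - (u \<bullet> u))"
    by (intro smooth_on_add smooth_on_const smooth_on_uminus smooth_on_inner smooth_on_ident open_UNIV)
  then show "smooth_on UNIV (\<lambda>u::'a. r\<^sup>2 - u \<bullet> u)" by simp
qed (auto intro: smooth_on_flat)

lemma bump_nonneg: "bump r u \<ge> 0"
  by (simp add: bump_def flat_def)

lemma bump_pos: "norm u < r \<Longrightarrow> bump r u > 0"
  by (simp add: bump_def flat_def dot_square_norm power_strict_mono)

lemma bump_eq_0: "0 \<le> r \<Longrightarrow> r \<le> norm u \<Longrightarrow> bump r u = 0"
  by (simp add: bump_def flat_def dot_square_norm power_mono not_less)

section \<open>Quadratic forms decreasing under a hyperbolic matrix\<close>

text \<open>This is \<open>p(M) x\<close>, evaluated by Horner's scheme on vectors, so that no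
  powers of matrices appear.\<close>

definition poly_apply :: "'a::field ^ 'n ^ 'n \<Rightarrow> 'a ^ 'n \<Rightarrow> 'a poly \<Rightarrow> 'a ^ 'n" where
  "poly_apply M x p = fold_coeffs (\<lambda>a w. a *s x + M *v w) p 0"

lemma poly_apply_0 [simp]: "poly_apply M x 0 = 0"
  by (simp add: poly_apply_def)

lemma poly_apply_pCons [simp]: "poly_apply M x (pCons a p) = a *s x + M *v poly_apply M x p"
  by (cases "p = 0 \<and> a = 0") (auto simp: poly_apply_def)

lemma poly_apply_add: "poly_apply M x (p + q) = poly_apply M x p + poly_apply M x q"
  by (induction p q rule: poly_induct2) (simp_all add: vec.scale_left_distrib vec.add)

lemma poly_apply_smult: "poly_apply M x (smult c p) = c *s poly_apply M x p"
  by (induction p) (simp_all add: vec.scale_right_distrib vec.scale)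

lemma poly_apply_monom: "poly_apply M x (monom c i) = c *s ((\<lambda>w. M *v w) ^^ i) x"
  by (induction i) (simp_all add: monom_0 monom_Suc vec.scale)

lemma poly_apply_sum: "poly_apply M x (\<Sum>i\<in>I. p i) = (\<Sum>i\<in>I. poly_apply M x (p i))"
  by (induction I rule: infinite_finite_induct) (simp_all add: poly_apply_add)

text \<open>Among the \<open>n + 1\<close> vectors \<open>x, M x, ..., M^n x\<close> either two
  coincide, which gives a difference of two monomials, or they are distinct and hence linearly
  dependent. The cases are separate because the set of these vectors does not see
  repetitions.\<close>

lemma poly_apply_eq_0:
  fixes M :: "'a::field ^ 'n ^ 'n"
  shows "\<exists>p. p \<noteq> 0 \<and> poly_apply M x p = 0"
proof -
  let ?t = "\<lambda>i. ((\<lambda>w. M *v w) ^^ i) x" and ?I = "{..CARD('n)}"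
  show ?thesis
  proof (cases "inj_on ?t ?I")
    case False
    then obtain i j where ij: "i \<noteq> j" "?t i = ?t j" by (auto simp: inj_on_def)
    have "coeff (monom 1 i + monom (-1) j) i \<noteq> (0::'a)" using ij by simp
    then have "monom 1 i + monom (-1) j \<noteq> (0::'a poly)" by (metis coeff_0)
    moreover have "poly_apply M x (monom 1 i + monom (-1) j) = 0"
      using ij by (simp add: poly_apply_add poly_apply_monom)
    ultimately show ?thesis by blast
  next
    case True
    then have "card (?t ` ?I) = CARD('n) + 1" by (simp add: card_image)
    moreover have "vec.dim (?t ` ?I) \<le> CARD('n)"
      using vec.dim_subset_UNIV[of "?t ` ?I"] by (simp add: vec.dimension_def card_cart_basis)
    ultimately have "vec.dependent (?t ` ?I)" by (intro vec.dependent_biggerset_general) auto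
    then obtain u where u: "\<exists>v\<in>?t ` ?I. u v \<noteq> 0" "(\<Sum>v\<in>?t ` ?I. u v *s v) = 0"
      using vec.dependent_finite[of "?t ` ?I"] by auto
    then obtain k where k: "k \<in> ?I" "u (?t k) \<noteq> 0" by auto
    let ?p = "\<Sum>i\<in>?I. monom (u (?t i)) i"
    have "coeff ?p k = u (?t k)"
      using k(1) by (simp add: coeff_sum)
    then have "?p \<noteq> 0" using k(2) by (metis coeff_0)
    moreover have "poly_apply M x ?p = 0"
      using u(2) by (simp add: poly_apply_sum poly_apply_monom sum.reindex[OF True])
    ultimately show ?thesis by blast
  qed
qed

text \<open>Let \<open>p\<close> have least degree among the nonzero polynomials with
  \<open>X p(M) x = 0\<close>. It is not constant, as \<open>X x\<close> is nonzero. Splitting off a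
  root, \<open>p(t) = (t - l) r(t)\<close>, gives \<open>z = r(M) x\<close>: minimality keeps
  \<open>X z\<close> nonzero, and \<open>X (M z - l z) = X p(M) x = 0\<close>.\<close>

lemma eigenvector_modulo_kernel:
  fixes M X :: "complex ^ 'n ^ 'n"
  assumes "X *v x \<noteq> 0"
  obtains z l where "X *v z \<noteq> 0" "X *v (M *v z) = l *s (X *v z)"
proof -
  let ?P = "\<lambda>p. p \<noteq> 0 \<and> X *v poly_apply M x p = 0"
  have "\<exists>p. ?P p" using poly_apply_eq_0[of M x] by (metis vec.zero)
  then obtain p where p: "?P p" and min: "\<And>q. ?P q \<Longrightarrow> degree p \<le> degree q"
    using ex_has_least_nat[of ?P _ degree] by blast
  have "degree p \<noteq> 0"
  proof
    assume "degree p = 0"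
    then obtain c where "p = [:c:]" by (auto elim: degree_eq_zeroE)
    then show False using p assms by (auto simp: vec.scale)
  qed
  then obtain l where "poly p l = 0"
    using fundamental_theorem_of_algebra[of p] constant_degree[of p] by auto
  then obtain r where r: "p = [:-l, 1:] * r" by (auto simp: poly_eq_0_iff_dvd)
  have "r \<noteq> 0" using p r by auto
  then have "degree r < degree p" using r by (subst r, subst degree_mult_eq) auto
  then have 1: "X *v poly_apply M x r \<noteq> 0" using min[of r] \<open>r \<noteq> 0\<close> by force
  have "poly_apply M x p = (-l) *s poly_apply M x r + M *v poly_apply M x r"
  proof -
    have "p = smult (-l) r + pCons 0 r" unfolding r by simp
    then show ?thesis by (simp only: poly_apply_add poly_apply_smult poly_apply_pCons vec.scale_zero_left add_0)
  qed
  then have "X *v ((-l) *s poly_apply M x r + M *v poly_apply M x r) = 0" using p by simp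
  then have "X *v (M *v poly_apply M x r) = l *s (X *v poly_apply M x r)"
    by (simp add: vec.diff vec.scale)
  with 1 show thesis by (rule that)
qed

section \<open>Positive semidefinite matrices fixed by a congruence\<close>

definition complex_matrix :: "real ^ 'n ^ 'm \<Rightarrow> complex ^ 'n ^ 'm" where
  "complex_matrix M = (\<chi> i j. complex_of_real (M $ i $ j))"

lemma Re_complex_matrix: "(\<chi> i. Re ((complex_matrix M *v z) $ i)) = M *v (\<chi> i. Re (z $ i))"
  by (simp add: vec_eq_iff complex_matrix_def matrix_vector_mult_def)

lemma Im_complex_matrix: "(\<chi> i. Im ((complex_matrix M *v z) $ i)) = M *v (\<chi> i. Im (z $ i))"
  by (simp add: vec_eq_iff complex_matrix_def matrix_vector_mult_def)

lemma complex_matrix_mult: "complex_matrix (M ** N) = complex_matrix M ** complex_matrix N"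
  by (simp add: vec_eq_iff complex_matrix_def matrix_matrix_mult_def)

lemma inner_matrix_vector_symmetric:
  fixes X :: "real ^ 'n ^ 'n"
  assumes "transpose X = X"
  shows "x \<bullet> (X *v y) = (X *v x) \<bullet> y"
  using dot_lmul_matrix[of x X y] assms by (metis vector_transpose_matrix)

text \<open>On \<open>a + t X a\<close> the form equals \<open>2 t s + t^2 c\<close>, where
  \<open>s = |X a|^2\<close>; unless \<open>s = 0\<close> this is negative for small negative
  \<open>t\<close>. The summand 1 in the denominator of \<open>t\<close> prevents division by zero
  and gives \<open>t c \<ge> - s\<close>.\<close>

lemma psd_kernel:
  fixes X :: "real ^ 'n ^ 'n"
  assumes "transpose X = X" "\<And>v. v \<bullet> (X *v v) \<ge> 0" "a \<bullet> (X *v a) = 0"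
  shows "X *v a = 0"
proof (rule ccontr)
  define s c where "s = (X *v a) \<bullet> (X *v a)" and "c = (X *v a) \<bullet> (X *v (X *v a))"
  define t where "t = - s / (1 + c)"
  assume "X *v a \<noteq> 0"
  then have s: "s > 0" by (simp add: s_def)
  have c: "c \<ge> 0" by (simp add: c_def assms(2))
  have t: "t < 0" using s c by (simp add: t_def divide_neg_pos)
  have "0 \<le> (a + t *\<^sub>R (X *v a)) \<bullet> (X *v (a + t *\<^sub>R (X *v a)))" by (rule assms)
  also have "\<dots> = 2 * t * s + t\<^sup>2 * c"
    using assms(3) inner_matrix_vector_symmetric[OF assms(1), of a "X *v a"]
    by (simp add: matrix_vector_right_distrib matrix_vector_mult_scaleR inner_left_distrib
        inner_right_distrib s_def c_def power2_eq_square algebra_simps)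
  also have "\<dots> = t * (2 * s + t * c)" by (simp add: power2_eq_square algebra_simps)
  also have "t * c \<ge> - s" using s c by (simp add: t_def field_simps)
  then have "t * (2 * s + t * c) < 0" using t s by (intro mult_neg_pos) auto
  finally show False by simp
qed

text \<open>The form of \<open>X\<close> is invariant under \<open>B^T\<close>. An eigenvector
  \<open>z\<close> of \<open>B^T\<close> modulo the kernel of \<open>X\<close>, with eigenvalue
  \<open>l\<close>, therefore satisfies \<open>s = |l|^2 s\<close> for its Hermitian value
  \<open>s\<close>, which is nonzero because \<open>X z\<close> is. Then
  \<open>B X B^T z = X z\<close> reads \<open>l B (X z) = X z\<close>, so \<open>X z\<close> is a
  genuine eigenvector of \<open>B\<close> with the unimodular eigenvalue
  \<open>1 / l\<close>.\<close>

lemma invariant_psd_unit_eigenvalue: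
  fixes B X :: "real ^ 'n ^ 'n"
  assumes sym: "transpose X = X" and psd: "\<And>v. v \<bullet> (X *v v) \<ge> 0" and "X \<noteq> 0"
    and inv: "B ** X ** transpose B = X"
  shows "\<exists>l. complex_eigenvalue B l \<and> cmod l = 1"
proof -
  let ?Y = "transpose B" and ?c = complex_matrix
  obtain x where "X *v x \<noteq> 0" using \<open>X \<noteq> 0\<close> by (metis matrix_eq matrix_vector_mult_0)
  then have "\<exists>i. (X *v x) $ i \<noteq> 0" by (simp add: vec_eq_iff)
  then have "?c X *v (\<chi> i. of_real (x $ i)) \<noteq> 0"
    using Re_complex_matrix[of X "\<chi> i. of_real (x $ i)"]
    by (simp add: vec_eq_iff) (metis zero_complex.simps(1))
  then obtain z l where z: "?c X *v z \<noteq> 0" "?c X *v (?c ?Y *v z) = l *s (?c X *v z)"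
    by (rule eigenvector_modulo_kernel)
  define a b where "a = (\<chi> i. Re (z $ i))" and "b = (\<chi> i. Im (z $ i))"
  have 1: "X *v (?Y *v a) = X *v (Re l *\<^sub>R a - Im l *\<^sub>R b)"
    using arg_cong[OF z(2), of "\<lambda>w. \<chi> i. Re (w $ i)"]
      Re_complex_matrix[of X "?c ?Y *v z"] Re_complex_matrix[of X z] Im_complex_matrix[of X z]
      Re_complex_matrix[of ?Y z]
    by (simp add: a_def b_def vec_eq_iff matrix_vector_mult_diff_distrib matrix_vector_mult_scaleR)
  have 2: "X *v (?Y *v b) = X *v (Im l *\<^sub>R a + Re l *\<^sub>R b)"
    using arg_cong[OF z(2), of "\<lambda>w. \<chi> i. Im (w $ i)"]
      Im_complex_matrix[of X "?c ?Y *v z"] Re_complex_matrix[of X z] Im_complex_matrix[of X z]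
      Im_complex_matrix[of ?Y z]
    by (simp add: a_def b_def vec_eq_iff matrix_vector_right_distrib matrix_vector_mult_scaleR)
  note sw = inner_matrix_vector_symmetric[OF sym]
  have isom: "v \<bullet> (X *v v) = (?Y *v v) \<bullet> (X *v (?Y *v v))" for v
    using dot_lmul_matrix[of v B "X *v (?Y *v v)"]
    by (subst inv[symmetric]) (simp add: matrix_vector_mul_assoc[symmetric])
  \<comment> \<open>The form depends on a vector only modulo the kernel of \<open>X\<close>, so
    \<open>B^T v\<close> may be replaced by \<open>w\<close>. The facts \<open>1\<close> and
    \<open>2\<close> supply such \<open>w\<close> for the real and the imaginary part of
    \<open>z\<close>.\<close>
  have *: "v \<bullet> (X *v v) = w \<bullet> (X *v w)" if "X *v (?Y *v v) = X *v w" for v w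
    using isom[of v] that sw[of "?Y *v v" w] sw[of w w] by simp
  define s where "s = a \<bullet> (X *v a) + b \<bullet> (X *v b)"
  have "a \<bullet> (X *v b) = b \<bullet> (X *v a)" using sw[of a b] by (simp add: inner_commute)
  then have "(Re l *\<^sub>R a - Im l *\<^sub>R b) \<bullet> (X *v (Re l *\<^sub>R a - Im l *\<^sub>R b)) +
      (Im l *\<^sub>R a + Re l *\<^sub>R b) \<bullet> (X *v (Im l *\<^sub>R a + Re l *\<^sub>R b)) = ((Re l)\<^sup>2 + (Im l)\<^sup>2) * s"
    by (simp add: s_def matrix_vector_right_distrib matrix_vector_mult_diff_distrib matrix_vector_mult_scaleR
        inner_left_distrib inner_right_distrib inner_diff_left inner_diff_right power2_eq_square algebra_simps)
  then have "s = ((Re l)\<^sup>2 + (Im l)\<^sup>2) * s"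
    using *[OF 1] *[OF 2] by (simp add: s_def)
  moreover have "s \<noteq> 0"
  proof
    assume "s = 0"
    then have "a \<bullet> (X *v a) = 0" "b \<bullet> (X *v b) = 0"
      using psd[of a] psd[of b] by (auto simp: s_def)
    then have "X *v a = 0" "X *v b = 0" using psd_kernel[OF sym psd] by auto
    then have "?c X *v z = 0"
      using Re_complex_matrix[of X z] Im_complex_matrix[of X z]
      by (simp add: a_def b_def vec_eq_iff complex_eq_iff)
    with z show False by simp
  qed
  ultimately have l: "cmod l = 1" by (simp add: cmod_def)
  let ?w = "?c X *v z"
  have "?c B *v (l *s ?w) = ?w"
    unfolding z(2)[symmetric] using arg_cong[OF inv, of "\<lambda>M. ?c M *v z"]
    by (simp add: complex_matrix_mult matrix_vector_mul_assoc matrix_mul_assoc)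
  then have "l *s (?c B *v ?w) = ?w" by (simp add: vec.scale)
  then have "(1 / l) *s ?w = (1 / l) *s (l *s (?c B *v ?w))" by simp
  also have "\<dots> = ?c B *v ?w" using l by (auto simp: vec.scale_scale)
  finally have "?c B *v ?w = (1 / l) *s ?w" ..
  then have "complex_eigenvalue B (1 / l)"
    using z(1) unfolding complex_eigenvalue_def complex_matrix_def by blast
  moreover have "cmod (1 / l) = 1" using l by (simp add: norm_divide)
  ultimately show ?thesis by blast
qed

text \<open>Separation: \<open>L\<close> below is the adjoint of \<open>H \<mapsto> H - B\<^sup>T H B\<close>, so a hyperplane separating the
  image under \<open>L\<close> of the positive semidefinite matrices of trace 1 from 0 is the required form.
  If 0 lies in this image, then \<open>B X B\<^sup>T = X\<close> for such a matrix \<open>X\<close>, which forces an eigenvalue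
  on the unit circle.\<close>

lemma hyperbolic_quadratic_form:
  fixes B :: "real ^ 'n ^ 'n"
  assumes "\<And>l. complex_eigenvalue B l \<Longrightarrow> cmod l \<noteq> 1"
  shows "\<exists>(H :: real ^ 'n ^ 'n) d. d > 0 \<and>
    (\<forall>v. (B *v v) \<bullet> (H *v (B *v v)) \<le> v \<bullet> (H *v v) - d * (norm v)\<^sup>2)"
proof -
  define outer :: "real ^ 'n \<Rightarrow> real ^ 'n ^ 'n" where "outer v = (\<chi> i j. v $ i * v $ j)" for v
  define L where "L X = X - B ** X ** transpose B" for X :: "real ^ 'n ^ 'n"
  have lin: "linear L"
    by (rule linearI) (simp_all add: L_def vec_eq_iff matrix_matrix_mult_def transpose_def
        sum.distrib sum_distrib_left sum_distrib_right algebra_simps)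
  \<comment> \<open>The entrywise inner product with \<open>outer v\<close> evaluates the quadratic
    form at \<open>v\<close>. With \<open>L_outer\<close>, the product of \<open>H\<close> and
    \<open>L (outer v)\<close> is thus the decrease of the form from \<open>v\<close> to
    \<open>B v\<close>.\<close>
  have inner_outer: "H \<bullet> outer v = v \<bullet> (H *v v)" for H v
    by (simp add: inner_vec_def outer_def matrix_vector_mult_def sum_distrib_left ac_simps)
  have L_outer: "L (outer v) = outer v - outer (B *v v)" for v
    by (simp add: L_def outer_def vec_eq_iff matrix_matrix_mult_def transpose_def
        matrix_vector_mult_def sum_distrib_left sum_distrib_right ac_simps)
  define K where "K = convex hull (outer ` sphere 0 1)"
  have "continuous_on (sphere 0 1) outer"
    unfolding outer_def by (intro continuous_intros)
  then have K: "compact K" "convex K"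
    unfolding K_def by (auto intro!: compact_convex_hull compact_continuous_image)
  \<comment> \<open>The trace serves to exclude the zero matrix: it is linear, so its value 1
    survives convex combinations.\<close>
  have "K \<subseteq> {X. transpose X = X \<and> (\<forall>v. v \<bullet> (X *v v) \<ge> 0) \<and> (\<Sum>i\<in>UNIV. X $ i $ i) = 1}" (is "_ \<subseteq> ?S")
    unfolding K_def
  proof (rule hull_minimal)
    show "outer ` sphere 0 1 \<subseteq> ?S"
    proof clarsimp
      fix w :: "real ^ 'n" assume w: "norm w = 1"
      have "v \<bullet> (outer w *v v) = (v \<bullet> w)\<^sup>2" for v
        by (simp add: outer_def inner_vec_def matrix_vector_mult_def power2_eq_square sum_product
            sum_distrib_left ac_simps)
      moreover have "(\<Sum>i\<in>UNIV. outer w $ i $ i) = w \<bullet> w" by (simp add: outer_def inner_vec_def)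
      ultimately show "transpose (outer w) = outer w \<and> (\<forall>v. 0 \<le> v \<bullet> (outer w *v v)) \<and>
          (\<Sum>i\<in>UNIV. outer w $ i $ i) = 1"
        using w by (simp add: outer_def transpose_def vec_eq_iff mult.commute norm_eq_1)
    qed
    show "convex ?S"
    proof (rule convexI, clarsimp)
      fix X Y :: "real ^ 'n ^ 'n" and s t :: real
      assume *: "0 \<le> s" "0 \<le> t" "s + t = 1" "transpose X = X" "transpose Y = Y"
        "\<forall>v. 0 \<le> v \<bullet> (X *v v)" "\<forall>v. 0 \<le> v \<bullet> (Y *v v)"
        "(\<Sum>i\<in>UNIV. X $ i $ i) = 1" "(\<Sum>i\<in>UNIV. Y $ i $ i) = 1"
      have "v \<bullet> ((s *\<^sub>R X + t *\<^sub>R Y) *v v) = s * (v \<bullet> (X *v v)) + t * (v \<bullet> (Y *v v))" for v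
        by (simp add: inner_vec_def matrix_vector_mult_def sum.distrib sum_distrib_left algebra_simps)
      moreover have "(\<Sum>i\<in>UNIV. s * X $ i $ i + t * Y $ i $ i) = s * 1 + t * 1"
        by (subst *(8)[symmetric], subst *(9)[symmetric]) (simp add: sum.distrib sum_distrib_left)
      ultimately show "transpose (s *\<^sub>R X + t *\<^sub>R Y) = s *\<^sub>R X + t *\<^sub>R Y \<and>
         (\<forall>v. 0 \<le> v \<bullet> ((s *\<^sub>R X + t *\<^sub>R Y) *v v)) \<and>
         (\<Sum>i\<in>UNIV. s * X $ i $ i + t * Y $ i $ i) = 1"
        using * by (auto simp: transpose_def vec_eq_iff)
    qed
  qed
  moreover have "X \<noteq> 0" if "(\<Sum>i\<in>UNIV. X $ i $ i) = 1" for X :: "real ^ 'n ^ 'n"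
    using that by auto
  ultimately have "B ** X ** transpose B \<noteq> X" if "X \<in> K" for X
    using invariant_psd_unit_eigenvalue[of X B] assms that by blast
  then have "0 \<notin> L ` K" unfolding L_def by (metis (mono_tags, lifting) imageE right_minus_eq)
  moreover have "compact (L ` K)"
    using K lin by (intro compact_continuous_image linear_continuous_on) (simp_all add: linear_linear)
  ultimately obtain H d where "d > 0" "\<forall>Y\<in>L ` K. H \<bullet> Y > d"
    using separating_hyperplane_closed_0[OF convex_linear_image[OF lin K(2)]] compact_imp_closed
    by blast
  then have d: "d > 0" and H: "\<And>X. X \<in> K \<Longrightarrow> H \<bullet> L X > d" by auto
  show ?thesis
  proof (intro exI conjI allI)
    show "d > 0" by (rule d)
    fix v :: "real ^ 'n"
    show "(B *v v) \<bullet> (H *v (B *v v)) \<le> v \<bullet> (H *v v) - d * (norm v)\<^sup>2"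
    proof (cases "v = 0")
      case False
      define n u where "n = norm v" and "u = (1 / n) *\<^sub>R v"
      have v: "v = n *\<^sub>R u" and "norm u = 1" using False by (simp_all add: u_def n_def)
      then have "outer u \<in> K" unfolding K_def by (intro hull_inc imageI) simp
      then have "d < u \<bullet> (H *v u) - (B *v u) \<bullet> (H *v (B *v u))"
        using H[of "outer u"] by (simp add: L_outer inner_diff_right inner_outer)
      then have "n\<^sup>2 * d \<le> n\<^sup>2 * (u \<bullet> (H *v u) - (B *v u) \<bullet> (H *v (B *v u)))"
        by (intro mult_left_mono) auto
      also have "\<dots> = v \<bullet> (H *v v) - (B *v v) \<bullet> (H *v (B *v v))"
        unfolding v by (simp add: matrix_vector_mult_scaleR power2_eq_square algebra_simps)
      finally show ?thesis by (simp add: n_def algebra_simps)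
    qed simp
  qed
qed

section \<open>Stable sets and Lyapunov functions\<close>

lemma continuous_on_funpow:
  fixes F :: "'a::topological_space \<Rightarrow> 'a"
  assumes "continuous_on UNIV F"
  shows "continuous_on UNIV (F ^^ n)"
proof (induction n)
  case (Suc n)
  have "continuous_on UNIV (\<lambda>x. F ((F ^^ n) x))"
    by (rule continuous_on_compose2[OF assms Suc]) auto
  then show ?case by (simp add: o_def)
qed (simp add: id_def)

text \<open>Regularity by a finite subcover: \<open>p\<close> is separated from each point of the
  compact complement of \<open>V\<close>, and finitely many of the separating sets suffice.\<close>

lemma compact_Hausdorff_shrink:
  fixes p :: "'a::t2_space"
  assumes "compact (UNIV :: 'a set)" "open V" "p \<in> V"
  obtains W K where "open W" "closed K" "p \<in> W" "W \<subseteq> K" "K \<subseteq> V"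
proof -
  have "compact (- V)" using assms by (metis Compl_UNIV_eq Int_UNIV_left closed_Compl compact_Int_closed)
  have "\<forall>y\<in>- V. \<exists>AB. open (fst AB) \<and> open (snd AB) \<and> p \<in> fst AB \<and> y \<in> snd AB \<and> fst AB \<inter> snd AB = {}"
  proof
    fix y assume "y \<in> - V"
    then have "p \<noteq> y" using assms(3) by auto
    from hausdorff[OF this] show "\<exists>AB. open (fst AB) \<and> open (snd AB) \<and> p \<in> fst AB \<and> y \<in> snd AB \<and>
        fst AB \<inter> snd AB = {}"
      by simp
  qed
  then obtain AB where AB: "\<forall>y\<in>- V. open (fst (AB y)) \<and> open (snd (AB y)) \<and> p \<in> fst (AB y) \<and>
      y \<in> snd (AB y) \<and> fst (AB y) \<inter> snd (AB y) = {}"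
    by (rule bchoice[elim_format]) blast
  define A B where "A y = fst (AB y)" and "B y = snd (AB y)" for y
  have AB: "open (A y)" "open (B y)" "p \<in> A y" "y \<in> B y" "A y \<inter> B y = {}" if "y \<in> - V" for y
    using AB that by (auto simp: A_def B_def)
  then obtain C where C: "C \<subseteq> - V" "finite C" "- V \<subseteq> (\<Union>y\<in>C. B y)"
    by (rule_tac compactE_image[OF \<open>compact (- V)\<close>, of "- V" B]) auto
  show thesis
  proof (rule that)
    show "open (\<Inter>y\<in>C. A y)" using C AB by (intro open_INT) auto
    show "closed (- (\<Union>y\<in>C. B y))" using C AB by (intro closed_Compl open_UN) auto
    show "p \<in> (\<Inter>y\<in>C. A y)" using AB(3) C(1) by auto
    show "(\<Inter>y\<in>C. A y) \<subseteq> - (\<Union>y\<in>C. B y)"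
    proof (safe)
      fix x y assume "x \<in> (\<Inter>y\<in>C. A y)" "y \<in> C" "x \<in> B y"
      then have "x \<in> A y \<inter> B y" by auto
      then show False using AB(5)[of y] C(1) \<open>y \<in> C\<close> by auto
    qed
    show "- (\<Union>y\<in>C. B y) \<subseteq> V" using C(3) by auto
  qed
qed

text \<open>Decrease is demanded along the single orbit of \<open>x\<close> only. The lemma thus
  serves for Lyapunov functions, for their negatives under the inverse map, and for functions that
  decrease merely near \<open>p\<close> along orbits staying there.\<close>

lemma Lyapunov_tendsto_le:
  fixes \<phi> :: "'a::topological_space \<Rightarrow> real"
  assumes "continuous_on UNIV \<phi>" "\<And>m. \<phi> (F ((F ^^ m) x)) \<le> \<phi> ((F ^^ m) x)"
    and "(\<lambda>m. (F ^^ m) x) \<longlonglongrightarrow> p"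
  shows "\<phi> p \<le> \<phi> x"
proof -
  have "decseq (\<lambda>m. \<phi> ((F ^^ m) x))" using assms(2) by (intro decseq_SucI) simp
  moreover have "(\<lambda>m. \<phi> ((F ^^ m) x)) \<longlonglongrightarrow> \<phi> p"
    using continuous_on_tendsto_compose[OF assms(1,3)] by simp
  ultimately show ?thesis using decseq_ge[of _ _ 0] by fastforce
qed

text \<open>A point of the stable set of \<open>p\<close> that is close to \<open>p\<close> cannot leave a neighbourhood of \<open>p\<close>:
  by compactness its exit point would have a long backward orbit close to \<open>p\<close>, hence be close to
  the unstable set, where \<open>\<phi>\<close> is smaller than at \<open>p\<close>.\<close>

lemma stable_set_local_min:
  fixes F F' :: "'a::{t2_space,second_countable_topology} \<Rightarrow> 'a" and \<phi> g :: "'a \<Rightarrow> real"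
  assumes cpt: "compact (UNIV :: 'a set)"
    and F: "continuous_on UNIV F" "continuous_on UNIV F'" "\<And>x. F' (F x) = x" "\<And>x. F (F' x) = x"
    and \<phi>: "continuous_on UNIV \<phi>" "\<And>x. x \<notin> P \<Longrightarrow> \<phi> (F x) < \<phi> x" "\<And>x. x \<in> P \<Longrightarrow> \<phi> (F x) = \<phi> x"
    and p: "F p = p" "open V" "p \<in> V" "V \<inter> P \<subseteq> {p}"
    and g: "continuous_on UNIV g" "\<And>x. x \<in> V \<Longrightarrow> g (F x) \<le> g x"
  shows "\<exists>U. open U \<and> p \<in> U \<and> (\<forall>x\<in>U. (\<lambda>m. (F ^^ m) x) \<longlonglongrightarrow> p \<longrightarrow> g p \<le> g x)"
proof -
  have \<phi>F: "\<phi> (F x) \<le> \<phi> x" for x using \<phi>(2,3)[of x] by fastforce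
  obtain W K where WK: "open W" "closed K" "p \<in> W" "W \<subseteq> K" "K \<subseteq> V"
    using compact_Hausdorff_shrink[OF cpt p(2,3)] .
  have K: "compact K" using cpt WK(2) by (metis Int_UNIV_left compact_Int_closed)
  \<comment> \<open>The possible exit points: outside \<open>W\<close>, reached in one step from
    \<open>K\<close>, and of height at least \<open>\<phi> p\<close>, as holds on every orbit
    tending to \<open>p\<close>.\<close>
  define D where "D = (F ` K) \<inter> (- W \<inter> {z. \<phi> p \<le> \<phi> z})"
  have "compact D" unfolding D_def
    using K WK(1) by (intro compact_Int_closed closed_Int closed_Compl compact_continuous_image
        closed_Collect_le continuous_on_const \<phi>(1) continuous_on_subset[OF F(1)]) auto
  \<comment> \<open>If the backward orbit \<open>w\<close> stayed in \<open>K\<close>, a limit point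
    \<open>l\<close> of it would satisfy \<open>\<phi> (F l) = \<phi> l\<close> and hence be
    \<open>p\<close>. As \<open>\<phi>\<close> increases along \<open>w\<close>, this gives
    \<open>\<phi> z < \<phi> (w 0) \<le> \<phi> p\<close>, against \<open>z \<in> D\<close>.\<close>
  have esc: "\<exists>n. (F' ^^ Suc n) z \<notin> K" if z: "z \<in> D" for z
  proof (rule ccontr)
    define w where "w n = (F' ^^ Suc n) z" for n
    assume "\<not> ?thesis"
    then have wK: "\<forall>n. w n \<in> K" by (auto simp: w_def)
    have Fw: "F (w (Suc n)) = w n" for n by (simp add: w_def F)
    have "F (w 0) = z" by (simp add: w_def F)
    have "w 0 \<notin> P"
    proof
      assume "w 0 \<in> P"
      then have "w 0 = p" using wK WK(5) p(4) by blast
      then show False using z WK(3) p(1) \<open>F (w 0) = z\<close> by (simp add: D_def)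
    qed
    then have z_less: "\<phi> z < \<phi> (w 0)" using \<phi>(2) \<open>F (w 0) = z\<close> by metis
    have inc: "incseq (\<lambda>n. \<phi> (w n))" using \<phi>F Fw by (intro incseq_SucI) metis
    obtain l r where l: "l \<in> K" "strict_mono r" "(w \<circ> r) \<longlonglongrightarrow> l"
      using compact_imp_seq_compact[OF K] wK unfolding seq_compact_def by metis
    have lim: "(\<lambda>n. \<phi> (w (r n))) \<longlonglongrightarrow> \<phi> l"
      using continuous_on_tendsto_compose[OF \<phi>(1) l(3)] by simp
    have "continuous_on UNIV (\<lambda>x. \<phi> (F x))"
      by (rule continuous_on_compose2[OF \<phi>(1) F(1)]) auto
    then have "(\<lambda>n. \<phi> (F (w (r n)))) \<longlonglongrightarrow> \<phi> (F l)"
      using continuous_on_tendsto_compose[OF _ l(3)] by fastforce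
    then have lim': "(\<lambda>n. \<phi> (F (w (r (Suc n))))) \<longlonglongrightarrow> \<phi> (F l)" by (rule LIMSEQ_Suc)
    \<comment> \<open>Applying \<open>F\<close> shifts the index back by one, and \<open>r\<close>
      advances by at least one from \<open>n\<close> to \<open>Suc n\<close>, so the shifted index
      is still at least \<open>r n\<close>.\<close>
    have "\<phi> (w (r n)) \<le> \<phi> (F (w (r (Suc n))))" for n
    proof -
      have "r n < r (Suc n)" using l(2) by (simp add: strict_mono_Suc_iff)
      then obtain k where k: "r (Suc n) = Suc k" "r n \<le> k" by (metis Suc_le_D Suc_le_eq less_Suc_eq_le)
      then show ?thesis using inc Fw by (simp add: incseq_def)
    qed
    then have "\<phi> l \<le> \<phi> (F l)" using LIMSEQ_le[OF lim lim'] by blast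
    then have "l = p" using \<phi>(2)[of l] l(1) WK(5) p(4) by force
    moreover have "(\<lambda>n. \<phi> (w (r n))) \<longlonglongrightarrow> \<phi> l \<Longrightarrow> \<phi> (w 0) \<le> \<phi> l"
      by (erule LIMSEQ_le_const) (use inc in \<open>auto simp: incseq_def\<close>)
    ultimately have "\<phi> (w 0) \<le> \<phi> p" using lim by simp
    then show False using z z_less by (simp add: D_def)
  qed
  have F'n: "continuous_on UNIV (F' ^^ n)" and Fn: "continuous_on UNIV (F ^^ n)" for n
    using F by (rule_tac continuous_on_funpow; simp)+
  have "D \<subseteq> (\<Union>n\<in>UNIV. (F' ^^ Suc n) -` (- K))" using esc by auto
  moreover have "open ((F' ^^ Suc n) -` (- K))" for n
    using WK(2) by (intro open_vimage F'n) auto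
  ultimately obtain C where C: "finite C" "D \<subseteq> (\<Union>n\<in>C. (F' ^^ Suc n) -` (- K))"
    using compactE_image[OF \<open>compact D\<close>, of UNIV "\<lambda>n. (F' ^^ Suc n) -` (- K)"] by auto
  \<comment> \<open>By compactness, backward orbits from \<open>D\<close> leave \<open>K\<close>
    within \<open>N + 1\<close> steps. Points of \<open>U\<close> remain in \<open>W\<close> up to
    time \<open>N\<close>, so a first exit at time \<open>m > N\<close> would have at least
    \<open>N + 1\<close> predecessors in \<open>W\<close>. The inserted 0 keeps \<open>Max\<close>
    meaningful for empty \<open>C\<close>.\<close>
  define N where "N = Max (insert 0 C)"
  define U where "U = (\<Inter>n\<in>{..N}. (F ^^ n) -` W)"
  have "open U" unfolding U_def using WK(1) by (intro open_INT ballI open_vimage Fn) auto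
  moreover have "(F ^^ n) p = p" for n using p(1) by (induction n) auto
  then have "p \<in> U" using WK(3) by (simp add: U_def)
  moreover have "g p \<le> g x" if x: "x \<in> U" and lim: "(\<lambda>m. (F ^^ m) x) \<longlonglongrightarrow> p" for x
  proof -
    have W: "(F ^^ m) x \<in> W" for m
    proof (rule ccontr)
      assume "(F ^^ m) x \<notin> W"
      define m where "m = (LEAST m. (F ^^ m) x \<notin> W)"
      have m: "(F ^^ m) x \<notin> W" unfolding m_def by (rule LeastI) fact
      have less: "(F ^^ j) x \<in> W" if "j < m" for j using not_less_Least[of j] that m_def by blast
      have "\<not> m \<le> N" using x m by (auto simp: U_def)
      then obtain k where k: "m = Suc k" by (metis not0_implies_Suc zero_le)
      have F'F: "(F' ^^ n) ((F ^^ n) y) = y" for n y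
        by (induction n arbitrary: y) (simp_all add: F(3) funpow_swap1)
      have "(\<lambda>i. (F ^^ (i + m)) x) \<longlonglongrightarrow> p" using lim by (rule LIMSEQ_ignore_initial_segment)
      then have "(\<lambda>i. (F ^^ i) ((F ^^ m) x)) \<longlonglongrightarrow> p" by (simp add: funpow_add)
      then have "\<phi> p \<le> \<phi> ((F ^^ m) x)" by (rule Lyapunov_tendsto_le[OF \<phi>(1) \<phi>F])
      moreover have "(F ^^ m) x \<in> F ` K" using less[of k] WK(4) k by auto
      ultimately have "(F ^^ m) x \<in> D" using m by (simp add: D_def)
      then obtain n where n: "n \<in> C" "(F' ^^ Suc n) ((F ^^ m) x) \<notin> K" using C(2) by blast
      have "n \<le> N" using n(1) C(1) by (simp add: N_def)
      then have "m = Suc n + (m - Suc n)" "m - Suc n < m" using \<open>\<not> m \<le> N\<close> by auto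
      then have "(F' ^^ Suc n) ((F ^^ m) x) = (F ^^ (m - Suc n)) x"
        using F'F[of "Suc n" "(F ^^ (m - Suc n)) x"] by (metis funpow_add o_apply)
      then show False using n(2) less[OF \<open>m - Suc n < m\<close>] WK(4) by auto
    qed
    then show ?thesis
      by (intro Lyapunov_tendsto_le[OF g(1) _ lim] g(2)) (use WK in auto)
  qed
  ultimately show ?thesis by blast
qed

section \<open>Smooth functions on the manifold\<close>

locale atlas =
  fixes A :: "('a::{t2_space,second_countable_topology}, 'n::finite) chart set"
  assumes atlas: "smooth_atlas A"
begin

lemma
  assumes "(U, c) \<in> A"
  shows open_chart: "open U" and open_chart_image: "open (c ` U)"
    and continuous_on_chart: "continuous_on U c"
    and continuous_on_inv_chart: "continuous_on (c ` U) (inv_into U c)"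
    and inv_chart: "x \<in> U \<Longrightarrow> inv_into U c (c x) = x"
  using atlas assms by (auto simp: smooth_atlas_def is_chart_def homeomorphism_def)

lemma inj_on_chart: "(U, c) \<in> A \<Longrightarrow> inj_on c U"
  using inv_chart by (metis inj_on_inverseI)

lemma chart_exists: obtains U c where "(U, c) \<in> A" "x \<in> U"
proof -
  have "x \<in> (\<Union>(U, c)\<in>A. U)" using atlas by (simp add: smooth_atlas_def)
  then show thesis using that by auto
qed

lemma open_chart_image_subset:
  assumes "(U, c) \<in> A" "open V" "V \<subseteq> U"
  shows "open (c ` V)"
proof -
  have "c ` V = c ` U \<inter> inv_into U c -` V"
    using assms inv_chart[OF assms(1)] by (auto simp: image_iff)
  then show ?thesis
    using continuous_open_preimage[OF continuous_on_inv_chart[OF assms(1)] open_chart_image[OF assms(1)] assms(2)]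
    by simp
qed

lemma smooth_transition:
  "(U, c) \<in> A \<Longrightarrow> (V, d) \<in> A \<Longrightarrow> smooth_on (c ` (U \<inter> V)) (d \<circ> inv_into U c)"
  using atlas unfolding smooth_atlas_def by fastforce

lemma smooth_fun_chart: "smooth_fun A \<phi> \<Longrightarrow> (U, c) \<in> A \<Longrightarrow> smooth_on (c ` U) (\<phi> \<circ> inv_into U c)"
  unfolding smooth_fun_def by fastforce

lemma smooth_funI:
  "(\<And>U c. (U, c) \<in> A \<Longrightarrow> smooth_on (c ` U) (\<phi> \<circ> inv_into U c)) \<Longrightarrow> smooth_fun A \<phi>"
  unfolding smooth_fun_def by fastforce

lemma smooth_fun_continuous:
  assumes "smooth_fun A \<phi>" shows "continuous_on UNIV \<phi>"
proof (rule continuous_at_imp_continuous_on, rule ballI)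
  fix x
  obtain U c where U: "(U, c) \<in> A" "x \<in> U" by (rule chart_exists)
  have "continuous_on (c ` U) (\<phi> \<circ> inv_into U c)"
    using smooth_on_continuous[OF smooth_fun_chart[OF assms U(1)], of "[]"] by simp
  then have "continuous_on U (\<lambda>y. (\<phi> \<circ> inv_into U c) (c y))"
    by (rule continuous_on_compose2[OF _ continuous_on_chart[OF U(1)]]) auto
  then have "continuous_on U \<phi>"
    by (rule continuous_on_eq) (simp add: inv_chart[OF U(1)])
  then show "isCont \<phi> x" using U open_chart[OF U(1)] by (simp add: continuous_on_eq_continuous_at)
qed

lemma smooth_fun_add: "smooth_fun A \<phi> \<Longrightarrow> smooth_fun A \<psi> \<Longrightarrow> smooth_fun A (\<lambda>x. \<phi> x + \<psi> x)"
  using smooth_on_add[OF open_chart_image smooth_fun_chart smooth_fun_chart]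
  by (intro smooth_funI) (simp add: o_def)

lemma smooth_fun_cmult: "smooth_fun A \<phi> \<Longrightarrow> smooth_fun A (\<lambda>x. r * \<phi> x)"
  using smooth_on_bounded_linear[OF open_chart_image bounded_linear_mult_right smooth_fun_chart]
  by (intro smooth_funI) (simp add: o_def)

lemma smooth_fun_const: "smooth_fun A (\<lambda>x. r)"
  using smooth_on_const[OF open_chart_image] by (intro smooth_funI) (simp add: o_def)

lemma smooth_fun_sum:
  "(\<And>i. i \<in> I \<Longrightarrow> smooth_fun A (\<phi> i)) \<Longrightarrow> smooth_fun A (\<lambda>x. \<Sum>i\<in>I. \<phi> i x)"
  by (induction I rule: infinite_finite_induct) (auto intro: smooth_fun_const smooth_fun_add)

lemma smooth_map_continuous: "smooth_map A f \<Longrightarrow> continuous_on UNIV f"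
  by (simp add: smooth_map_def)

lemma smooth_map_chart:
  "smooth_map A f \<Longrightarrow> (U, c) \<in> A \<Longrightarrow> (V, d) \<in> A \<Longrightarrow>
    smooth_on (c ` (U \<inter> f -` V)) (\<lambda>u. d (f (inv_into U c u)))"
  unfolding smooth_map_def o_def by fastforce

lemma open_chart_preimage:
  assumes "continuous_on UNIV f" "(U, c) \<in> A" "open V"
  shows "open (c ` (U \<inter> f -` V))"
  using assms open_chart by (intro open_chart_image_subset[OF assms(2)] open_Int open_vimage) auto

text \<open>The codomain of \<open>g\<close> is left open: \<open>g\<close> is a real function when
  a map is followed by a function, and a chart composed with a map, defined on a preimage
  \<open>W\<close>, when two maps are composed. Locally, a chart around \<open>f x\<close> and its
  inverse are inserted in between.\<close>

lemma smooth_map_compose_chart: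
  assumes f: "smooth_map A f" and U: "(U, c) \<in> A" and "open W"
    and g: "\<And>V d. (V, d) \<in> A \<Longrightarrow> smooth_on (d ` (V \<inter> W)) (\<lambda>v. g (inv_into V d v))"
  shows "smooth_on (c ` (U \<inter> f -` W)) (\<lambda>u. g (f (inv_into U c u)))"
proof (rule smooth_on_local)
  fix u assume "u \<in> c ` (U \<inter> f -` W)"
  then obtain x where x: "x \<in> U" "f x \<in> W" "u = c x" by auto
  obtain V d where V: "(V, d) \<in> A" "f x \<in> V" by (rule chart_exists)
  let ?S = "c ` (U \<inter> f -` (V \<inter> W))"
  have S: "open ?S"
    by (intro open_chart_preimage[OF smooth_map_continuous[OF f] U] open_Int open_chart[OF V(1)] \<open>open W\<close>)
  have "smooth_on ?S (\<lambda>u. g (inv_into V d (d (f (inv_into U c u)))))"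
  proof (rule smooth_on_compose[OF S _ _ g[OF V(1)], where b = "\<lambda>u. d (f (inv_into U c u))"])
    show "open (d ` (V \<inter> W))"
      using open_chart[OF V(1)] \<open>open W\<close> by (intro open_chart_image_subset[OF V(1)]) auto
    show "(\<lambda>u. d (f (inv_into U c u))) ` ?S \<subseteq> d ` (V \<inter> W)"
      using inv_chart[OF U] by auto
    show "smooth_on ?S (\<lambda>u. d (f (inv_into U c u)))"
      by (rule smooth_on_subset[OF smooth_map_chart[OF f U V(1)]]) auto
  qed
  then have "smooth_on ?S (\<lambda>u. g (f (inv_into U c u)))"
    by (rule smooth_on_cong[OF S, rotated]) (use inv_chart[OF U] inv_chart[OF V(1)] in auto)
  then show "\<exists>T. u \<in> T \<and> smooth_on T (\<lambda>u. g (f (inv_into U c u)))"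
    using x V(2) by (intro exI[of _ ?S]) auto
qed

lemma smooth_fun_compose:
  assumes "smooth_fun A \<phi>" "smooth_map A f"
  shows "smooth_fun A (\<lambda>x. \<phi> (f x))"
proof (rule smooth_funI)
  fix U c assume U: "(U, c) \<in> A"
  have "smooth_on (c ` (U \<inter> f -` UNIV)) (\<lambda>u. \<phi> (f (inv_into U c u)))"
    by (rule smooth_map_compose_chart[OF assms(2) U open_UNIV])
       (use smooth_fun_chart[OF assms(1)] in \<open>simp add: o_def\<close>)
  then show "smooth_on (c ` U) ((\<lambda>x. \<phi> (f x)) \<circ> inv_into U c)" by (simp add: o_def)
qed

lemma smooth_map_compose:
  assumes f: "smooth_map A f" and g: "smooth_map A g"
  shows "smooth_map A (\<lambda>x. g (f x))"
proof -
  have "continuous_on UNIV (\<lambda>x. g (f x))"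
    using continuous_on_compose2[OF smooth_map_continuous[OF g] smooth_map_continuous[OF f]] by auto
  moreover have "smooth_on (c ` (U \<inter> (\<lambda>x. g (f x)) -` V)) (\<lambda>u. d (g (f (inv_into U c u))))"
    if "(U, c) \<in> A" "(V, d) \<in> A" for U c V d
  proof -
    have "smooth_on (c ` (U \<inter> f -` (g -` V))) (\<lambda>u. d (g (f (inv_into U c u))))"
      by (rule smooth_map_compose_chart[OF f that(1), where g = "\<lambda>x. d (g x)"])
         (auto intro: open_vimage open_chart[OF that(2)] smooth_map_continuous[OF g]
            smooth_map_chart[OF g _ that(2)])
    then show ?thesis by (simp add: vimage_def)
  qed
  ultimately show ?thesis unfolding smooth_map_def by (auto simp: o_def)
qed

lemma smooth_map_id: "smooth_map A (\<lambda>x. x)"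
  using smooth_transition unfolding smooth_map_def by (auto simp: o_def)

lemma smooth_map_funpow: "smooth_map A f \<Longrightarrow> smooth_map A (f ^^ n)"
  by (induction n) (auto simp: o_def id_def smooth_map_id intro: smooth_map_compose)

lemma differentiable_in_chart:
  assumes "smooth_map A f" "(U, c) \<in> A" "x \<in> U" "f x \<in> U"
  shows "((\<lambda>u. c (f (inv_into U c u))) has_derivative
     frechet_derivative (c \<circ> f \<circ> inv_into U c) (at (c x))) (at (c x))"
  using smooth_on_has_derivative[OF smooth_map_chart[OF assms(1,2,2)], of "c x" "[]"] assms(3,4)
  by (simp add: o_def dir_derivs.simps(2))

text \<open>Extension by zero is smooth: points of \<open>U\<close> see \<open>b\<close> in
  coordinates, and points outside \<open>U\<close> lie in the complement of the preimage of
  \<open>K\<close>, which is open because compact sets are closed in a Hausdorff space.\<close>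

lemma smooth_fun_lift:
  assumes U: "(U, c) \<in> A" and b: "smooth_on UNIV b" and K: "compact K" "K \<subseteq> c ` U"
    and 0: "\<And>u. u \<notin> K \<Longrightarrow> b u = 0"
  shows "smooth_fun A (\<lambda>x. if x \<in> U then b (c x) else 0)" (is "smooth_fun A ?g")
    and "closed (inv_into U c ` K)"
    and "\<And>x. x \<notin> inv_into U c ` K \<Longrightarrow> (if x \<in> U then b (c x) else 0) = 0"
proof -
  let ?K = "inv_into U c ` K"
  have "compact ?K"
    using K by (intro compact_continuous_image continuous_on_subset[OF continuous_on_inv_chart[OF U]]) auto
  then show cl: "closed ?K" by (rule compact_imp_closed)
  show g0: "?g x = 0" if "x \<notin> ?K" for x
  proof (cases "x \<in> U \<and> c x \<in> K")
    case True
    then have "inv_into U c (c x) \<in> ?K" by blast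
    then show ?thesis using that True inv_chart[OF U] by simp
  qed (use 0 in auto)
  show "smooth_fun A ?g"
  proof (rule smooth_funI)
    fix V d assume V: "(V, d) \<in> A"
    show "smooth_on (d ` V) (?g \<circ> inv_into V d)"
    proof (rule smooth_on_local)
      fix v assume "v \<in> d ` V"
      then obtain x where x: "x \<in> V" "v = d x" by auto
      show "\<exists>T. v \<in> T \<and> smooth_on T (?g \<circ> inv_into V d)"
      proof (cases "x \<in> U")
        case True
        let ?S = "d ` (V \<inter> U)"
        have S: "open ?S"
          using open_chart[OF V] open_chart[OF U] by (intro open_chart_image_subset[OF V]) auto
        have "smooth_on ?S (\<lambda>v. b ((c \<circ> inv_into V d) v))"
          by (rule smooth_on_compose[OF S open_UNIV _ b smooth_transition[OF V U]]) auto
        then have "smooth_on ?S (?g \<circ> inv_into V d)"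
          by (rule smooth_on_cong[OF S, rotated]) (use inv_chart[OF V] in auto)
        then show ?thesis using x True by (intro exI[of _ ?S]) auto
      next
        case False
        let ?S = "d ` (V - ?K)"
        have S: "open ?S"
          using open_chart[OF V] cl by (intro open_chart_image_subset[OF V] open_Diff) auto
        have "0 = (?g \<circ> inv_into V d) v" if "v \<in> ?S" for v
        proof -
          obtain y where "y \<in> V" "y \<notin> ?K" "v = d y" using \<open>v \<in> ?S\<close> by blast
          then show ?thesis using g0[of y] inv_chart[OF V, of y] by (simp split: if_split_asm)
        qed
        then have "smooth_on ?S (?g \<circ> inv_into V d)"
          by (rule smooth_on_cong[OF S _ smooth_on_const[OF S, of 0]])
        moreover have "x \<notin> ?K" using False K(2) by (auto simp: inv_into_into)
        ultimately show ?thesis using x by (intro exI[of _ ?S]) auto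
      qed
    qed
  qed
qed

text \<open>By the chain rule the derivative of the opposite transition map is a right
  inverse.\<close>

lemma transition_surj:
  assumes U: "(U, c) \<in> A" and V: "(V, d) \<in> A" and x: "x \<in> U" "x \<in> V"
  shows "surj (\<lambda>v. dir_derivs [v] (d \<circ> inv_into U c) (c x))"
proof -
  have 1: "((d \<circ> inv_into U c) has_derivative (\<lambda>v. dir_derivs [v] (d \<circ> inv_into U c) (c x))) (at (c x))"
    using smooth_on_has_derivative[OF smooth_transition[OF U V], of "c x" "[]"] x by simp
  have 2: "((c \<circ> inv_into V d) has_derivative (\<lambda>v. dir_derivs [v] (c \<circ> inv_into V d) (d x))) (at (d x))"
    using smooth_on_has_derivative[OF smooth_transition[OF V U], of "d x" "[]"] x by simp
  have "(c \<circ> inv_into V d) (d x) = c x" using inv_chart[OF V] x by simp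
  with diff_chain_at[OF 2] 1 have
    "((d \<circ> inv_into U c) \<circ> (c \<circ> inv_into V d) has_derivative
      (\<lambda>v. dir_derivs [v] (d \<circ> inv_into U c) (c x)) \<circ> (\<lambda>v. dir_derivs [v] (c \<circ> inv_into V d) (d x))) (at (d x))"
    by metis
  moreover have "open (d ` (V \<inter> U))"
    using open_chart[OF V] open_chart[OF U] by (intro open_chart_image_subset[OF V]) auto
  then have "((d \<circ> inv_into U c) \<circ> (c \<circ> inv_into V d) has_derivative (\<lambda>v. v)) (at (d x))"
    by (rule has_derivative_transform_within_open[OF has_derivative_ident])
       (use x inv_chart[OF V] inv_chart[OF U] in auto)
  ultimately have "(\<lambda>v. dir_derivs [v] (d \<circ> inv_into U c) (c x)) \<circ>
      (\<lambda>v. dir_derivs [v] (c \<circ> inv_into V d) (d x)) = (\<lambda>v. v)"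
    by (rule has_derivative_unique)
  from fun_cong[OF this] show ?thesis
    by (intro surjI[where f = "\<lambda>v. dir_derivs [v] (c \<circ> inv_into V d) (d x)"]) (simp only: o_apply)
qed

text \<open>At a critical point the term of \<open>dir_derivs_compose2\<close> with the second
  derivative of the transition map drops out, so the Hessians correspond under its first derivative,
  whose surjectivity pulls a kernel vector back. Degenerate critical points given in varying charts
  can thus be observed in a single one.\<close>

lemma degenerate_critical_change_chart:
  assumes \<phi>: "smooth_fun A \<phi>" and U: "(U, c) \<in> A" and V: "(V, d) \<in> A" and x: "x \<in> U" "x \<in> V"
    and crit: "critical_along UNIV (\<phi> \<circ> inv_into V d) (d x)"
    and deg: "\<not> nondegenerate_along UNIV (\<phi> \<circ> inv_into V d) (d x)"
  shows "critical_along UNIV (\<phi> \<circ> inv_into U c) (c x) \<and>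
    \<not> nondegenerate_along UNIV (\<phi> \<circ> inv_into U c) (c x)"
proof -
  let ?a = "\<phi> \<circ> inv_into V d" and ?b = "d \<circ> inv_into U c" and ?S = "c ` (U \<inter> V)"
  have S: "open ?S"
    using open_chart[OF V] open_chart[OF U] by (intro open_chart_image_subset[OF U]) auto
  have cx: "c x \<in> ?S" "?b (c x) = d x" using x inv_chart[OF U] by auto
  have im: "?b ` ?S \<subseteq> d ` V" using inv_chart[OF U] by auto
  have eq: "dir_derivs vs (\<phi> \<circ> inv_into U c) (c x) = dir_derivs vs (\<lambda>u. ?a (?b u)) (c x)" for vs
    by (rule dir_derivs_cong[OF S _ cx(1)]) (use inv_chart[OF U] inv_chart[OF V] in auto)
  have a0: "dir_derivs [w] ?a (d x) = 0" for w using crit by (simp add: critical_along_def)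
  have 1: "dir_derivs [v] (\<phi> \<circ> inv_into U c) (c x) = 0" for v
    unfolding eq using dir_derivs_compose1[OF smooth_fun_chart[OF \<phi> V] smooth_transition[OF U V] cx(1), of v]
      cx x a0 by simp
  have 2: "dir_derivs [v, w] (\<phi> \<circ> inv_into U c) (c x)
      = dir_derivs [dir_derivs [v] ?b (c x), dir_derivs [w] ?b (c x)] ?a (d x)" for v w
    unfolding eq dir_derivs_compose2[OF S open_chart_image[OF V] im smooth_fun_chart[OF \<phi> V]
        smooth_transition[OF U V] cx(1)] cx(2) a0 by simp
  obtain v where v: "v \<noteq> 0" "\<And>w. dir_derivs [v, w] ?a (d x) = 0"
    using deg by (auto simp: nondegenerate_along_def)
  obtain v' where v': "v = dir_derivs [v'] ?b (c x)" using surjD[OF transition_surj[OF U V x], of v] by blast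
  have "v' \<noteq> 0"
    using v(1) v' linear_0[OF smooth_on_linear_Cons[OF smooth_transition[OF U V] cx(1), of "[]"]] by auto
  moreover have "dir_derivs [v', w] (\<phi> \<circ> inv_into U c) (c x) = 0" for w
    unfolding 2 v'[symmetric] by (rule v(2))
  ultimately show ?thesis using 1 by (auto simp: critical_along_def nondegenerate_along_def)
qed

end

section \<open>Functions adapted to the periodic points\<close>

text \<open>Blow-up: at counterexamples \<open>u n\<close> tending to \<open>a\<close>, division by
  \<open>|u n - a|^2\<close> leaves unit vectors \<open>z\<close> accumulating at some
  \<open>l\<close> and rescaled images \<open>y\<close> accumulating at \<open>D l\<close>, so
  \<open>q l \<le> q (D l)\<close> by homogeneity. The weight \<open>\<rho>\<close> stands for a
  bump factor; its values at \<open>u\<close> and at \<open>F u\<close> differ, but both tend to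
  \<open>\<rho> a > 0\<close>.\<close>

lemma quadratic_form_decrease:
  fixes q :: "'b::euclidean_space \<Rightarrow> real" and \<rho> :: "'b \<Rightarrow> real"
  assumes F: "(F has_derivative D) (at a)" "F a = a"
    and q: "continuous_on UNIV q" "\<And>t v. q (t *\<^sub>R v) = t\<^sup>2 * q v" "\<And>v. v \<noteq> 0 \<Longrightarrow> q (D v) < q v"
    and \<rho>: "isCont \<rho> a" "\<rho> a > 0"
  shows "\<exists>e>0. \<forall>u. u \<noteq> a \<and> norm (u - a) < e \<longrightarrow> \<rho> (F u) * q (F u - a) < \<rho> u * q (u - a)"
proof (rule ccontr)
  assume contr: "\<not> ?thesis"
  have "\<exists>u. u \<noteq> a \<and> norm (u - a) < inverse (real (Suc n)) \<and> \<rho> u * q (u - a) \<le> \<rho> (F u) * q (F u - a)" for n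
    using contr by (auto simp: not_less dest!: spec[of _ "inverse (real (Suc n))"])
  then obtain u where u: "\<And>n. u n \<noteq> a" "\<And>n. norm (u n - a) < inverse (real (Suc n))"
    "\<And>n. \<rho> (u n) * q (u n - a) \<le> \<rho> (F (u n)) * q (F (u n) - a)"
    by metis
  define z y where "z n = (1 / norm (u n - a)) *\<^sub>R (u n - a)"
    and "y n = (1 / norm (u n - a)) *\<^sub>R (F (u n) - a)" for n
  have "\<forall>n. z n \<in> sphere 0 1" using u(1) by (simp add: z_def)
  then obtain l r where l: "l \<in> sphere 0 1" "strict_mono r" "(z \<circ> r) \<longlonglongrightarrow> l"
    using compact_sphere[of 0 1, unfolded compact_def] by meson
  have "(\<lambda>n. u n - a) \<longlonglongrightarrow> 0"
    by (rule Lim_null_comparison[OF always_eventually LIMSEQ_inverse_real_of_nat])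
       (intro allI less_imp_le[OF u(2)])
  then have u_lim: "u \<longlonglongrightarrow> a" by (rule LIM_zero_cancel)
  have ur: "(\<lambda>n. u (r n)) \<longlonglongrightarrow> a" using LIMSEQ_subseq_LIMSEQ[OF u_lim l(2)] by (simp add: o_def)
  have D: "bounded_linear D" by (rule has_derivative_bounded_linear[OF F(1)])
  have "((\<lambda>y. (F y - F a - D (y - a)) /\<^sub>R norm (y - a)) \<longlongrightarrow> 0) (at a)"
    using F(1) by (simp add: has_derivative_at_within)
  moreover have "filterlim (\<lambda>n. u (r n)) (at a) sequentially"
    using ur u(1) by (simp add: filterlim_at)
  ultimately have "(\<lambda>n. (F (u (r n)) - F a - D (u (r n) - a)) /\<^sub>R norm (u (r n) - a)) \<longlonglongrightarrow> 0"
    by (rule filterlim_compose)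
  moreover have "(F (u n) - F a - D (u n - a)) /\<^sub>R norm (u n - a) = y n - D (z n)" for n
  proof -
    have "D (z n) = (1 / norm (u n - a)) *\<^sub>R D (u n - a)"
      unfolding z_def by (rule linear_scale[OF bounded_linear.linear[OF D]])
    then show ?thesis by (simp only: y_def F(2) inverse_eq_divide scaleR_diff_right)
  qed
  ultimately have 1: "(\<lambda>n. y (r n) - D (z (r n))) \<longlonglongrightarrow> 0" by simp
  have "(\<lambda>n. D (z (r n))) \<longlonglongrightarrow> D l"
    using bounded_linear.tendsto[OF D l(3)] by (simp add: o_def)
  from tendsto_add[OF 1 this] have y: "(\<lambda>n. y (r n)) \<longlonglongrightarrow> D l" by simp
  have "(\<lambda>n. F (u (r n))) \<longlonglongrightarrow> a"
    using isCont_tendsto_compose[OF has_derivative_continuous[OF F(1)] ur] F(2) by simp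
  then have "(\<lambda>n. \<rho> (F (u (r n))) * q (y (r n))) \<longlonglongrightarrow> \<rho> a * q (D l)"
    by (intro tendsto_mult isCont_tendsto_compose[OF \<rho>(1)] continuous_on_tendsto_compose[OF q(1) y]) auto
  moreover have "(\<lambda>n. \<rho> (u (r n)) * q (z (r n))) \<longlonglongrightarrow> \<rho> a * q l"
    using l(3) by (intro tendsto_mult isCont_tendsto_compose[OF \<rho>(1) ur] continuous_on_tendsto_compose[OF q(1)])
      (auto simp: o_def)
  moreover have "\<rho> (u n) * q (z n) \<le> \<rho> (F (u n)) * q (y n)" for n
  proof -
    have "(1 / norm (u n - a))\<^sup>2 * (\<rho> (u n) * q (u n - a)) \<le>
        (1 / norm (u n - a))\<^sup>2 * (\<rho> (F (u n)) * q (F (u n) - a))"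
      by (intro mult_left_mono u(3)) simp
    then show ?thesis unfolding z_def y_def q(2) by (simp only: mult.left_commute)
  qed
  ultimately have "\<rho> a * q l \<le> \<rho> a * q (D l)" by (intro LIMSEQ_le) auto
  moreover have "l \<noteq> 0" using l(1) by auto
  ultimately show False using q(3) \<rho>(2) by (simp add: not_le[symmetric])
qed

context atlas
begin

text \<open>Both \<open>g + R\<close> and \<open>g - R\<close> decrease along \<open>F\<close> near \<open>p\<close>; the two signs provide quadratic
  growth of \<open>g\<close> on the stable set and quadratic decay on the unstable set.\<close>

definition adapted :: "('a \<Rightarrow> 'a) \<Rightarrow> 'a set \<Rightarrow> 'a \<Rightarrow> ('a \<Rightarrow> real) \<Rightarrow> ('a \<Rightarrow> real) \<Rightarrow> bool" where
  "adapted F Q p g R \<longleftrightarrow>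
    smooth_fun A g \<and> smooth_fun A R \<and> (\<forall>x. 0 \<le> R x) \<and> g p = 0 \<and> R p = 0 \<and>
    (\<exists>W. open W \<and> Q \<subseteq> W \<and> (\<forall>x\<in>W. g x = 0 \<and> R x = 0)) \<and>
    (\<exists>U c r W. (U, c) \<in> A \<and> r > 0 \<and> open W \<and> p \<in> W \<and> W \<subseteq> U \<and>
      (\<forall>x\<in>W. r * (norm (c x - c p))\<^sup>2 \<le> R x)) \<and>
    (\<exists>V. open V \<and> p \<in> V \<and>
      (\<forall>x\<in>V - {p}. \<forall>s\<in>{-1, 1}. g (F x) + s * R (F x) < g x + s * R x))"

text \<open>In a chart, \<open>g\<close> is the form that decreases under the hyperbolic derivative
  and \<open>R\<close> is \<open>e\<close> times the squared distance, both cut off by the same bump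
  factor \<open>\<rho>\<close>. So \<open>g + s R\<close> is \<open>\<rho>\<close> times a single
  quadratic form \<open>q s\<close>, and only the decrease of \<open>q s\<close> under
  \<open>D\<close> for \<open>s = -1, 1\<close> has to be checked.\<close>

lemma adapted_exists:
  assumes F: "smooth_map A F" "F p = p"
    and hyp: "\<And>U c l. (U, c) \<in> A \<Longrightarrow> p \<in> U \<Longrightarrow>
      complex_eigenvalue (matrix (frechet_derivative (c \<circ> F \<circ> inv_into U c) (at (c p)))) l \<Longrightarrow> cmod l \<noteq> 1"
    and Q: "finite Q" "p \<notin> Q"
  shows "\<exists>g R. adapted F Q p g R"
proof -
  obtain U c where U: "(U, c) \<in> A" "p \<in> U" by (rule chart_exists)
  define a where "a = c p"
  define F' where "F' u = c (F (inv_into U c u))" for u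
  define D where "D = frechet_derivative (c \<circ> F \<circ> inv_into U c) (at (c p))"
  have F': "(F' has_derivative D) (at a)"
    using differentiable_in_chart[OF F(1) U] U(2) F(2) unfolding a_def D_def F'_def by simp
  have "F' a = a" using inv_chart[OF U] F(2) by (simp add: F'_def a_def)
  have D: "bounded_linear D" by (rule has_derivative_bounded_linear[OF F'])
  have hypD: "cmod l \<noteq> 1" if "complex_eigenvalue (matrix D) l" for l
    using hyp[OF U] that by (simp add: D_def)
  obtain H d where d: "d > 0"
    and H: "\<forall>v. (matrix D *v v) \<bullet> (H *v (matrix D *v v)) \<le> v \<bullet> (H *v v) - d * (norm v)\<^sup>2"
    using hyperbolic_quadratic_form[OF hypD] by metis
  have mD: "matrix D *v v = D v" for v
    using matrix_works[of D v] bounded_linear.linear[OF D] by (simp add: linear_matrix_vector_mul_eq)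
  obtain M where M: "M > 0" "\<forall>v. norm (D v) \<le> norm v * M" using bounded_linear.pos_bounded[OF D] by blast
  \<comment> \<open>\<open>m |v|^2\<close> bounds \<open>|D v|^2 + |v|^2\<close>. With
    \<open>e m = d / 2\<close>, adding or subtracting \<open>e |v|^2\<close> uses up only half of
    the margin \<open>d\<close>.\<close>
  define m where "m = M\<^sup>2 + 1"
  have m: "m > 0" by (simp add: m_def add_nonneg_pos)
  define e where "e = d / (2 * m)"
  have e: "e > 0" using d m by (simp add: e_def)
  define q where "q s v = v \<bullet> (H *v v) + s * (e * (v \<bullet> v))" for s v
  have q_decr: "q s (D v) < q s v" if "v \<noteq> 0" "s \<in> {-1, 1}" for s v
  proof -
    have "s * (D v \<bullet> D v - v \<bullet> v) \<le> D v \<bullet> D v + v \<bullet> v"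
      using that(2) inner_ge_zero[of "D v"] inner_ge_zero[of v] by auto
    also have "D v \<bullet> D v \<le> (norm v * M)\<^sup>2"
      using power_mono[OF M(2)[rule_format, of v] norm_ge_zero, of 2] by (simp add: dot_square_norm)
    finally have "s * (D v \<bullet> D v - v \<bullet> v) \<le> m * (norm v)\<^sup>2"
      by (simp add: m_def dot_square_norm power_mult_distrib algebra_simps)
    then have "e * (s * (D v \<bullet> D v - v \<bullet> v)) \<le> e * (m * (norm v)\<^sup>2)"
      using e by (intro mult_left_mono) auto
    also have "\<dots> = d / 2 * (norm v)\<^sup>2"
      using m by (simp add: e_def)
    also have "\<dots> < d * (norm v)\<^sup>2" using d that(1) by simp
    finally show ?thesis using H[rule_format, of v] by (simp add: mD q_def algebra_simps)
  qed
  have q_cont: "continuous_on UNIV (q s)" for s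
    unfolding q_def by (intro continuous_intros)
  have q_scale: "q s (t *\<^sub>R v) = t\<^sup>2 * q s v" for s t v
    by (simp add: q_def matrix_vector_mult_scaleR power2_eq_square algebra_simps)
  \<comment> \<open>Removing \<open>Q\<close> from the domain keeps the support of the bump function
    away from the other periodic points.\<close>
  have "open (c ` (U - Q))"
    using open_chart[OF U(1)] Q(1) by (intro open_chart_image_subset[OF U(1)] open_Diff finite_imp_closed) auto
  moreover have "a \<in> c ` (U - Q)" using U(2) Q(2) by (auto simp: a_def)
  ultimately have "\<exists>r>0. cball a r \<subseteq> c ` (U - Q)" unfolding open_contains_cball by (rule bspec)
  then obtain r where r: "r > 0" "cball a r \<subseteq> c ` (U - Q)" by blast
  define \<rho> where "\<rho> u = bump r (u - a)" for u
  have shift: "smooth_on UNIV (\<lambda>u. u - a)"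
    using smooth_on_add[OF open_UNIV smooth_on_ident[OF open_UNIV] smooth_on_const[OF open_UNIV, of "-a"]] by simp
  have \<rho>: "smooth_on UNIV \<rho>"
    using smooth_on_compose[OF open_UNIV open_UNIV _ smooth_on_bump shift, of r] by (simp add: \<rho>_def[abs_def])
  have "bounded_linear (\<lambda>v. H *v v)" by simp
  note qH = smooth_on_inner[OF open_UNIV shift smooth_on_bounded_linear[OF open_UNIV this shift]]
  define bg bR where "bg u = \<rho> u * ((u - a) \<bullet> (H *v (u - a)))" and "bR u = \<rho> u * (e * ((u - a) \<bullet> (u - a)))" for u
  have bg: "smooth_on UNIV bg" unfolding bg_def by (rule smooth_on_mult[OF open_UNIV \<rho> qH])
  have bR: "smooth_on UNIV bR" unfolding bR_def
    by (intro smooth_on_mult[OF open_UNIV \<rho>] smooth_on_bounded_linear[OF open_UNIV bounded_linear_mult_right]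
        smooth_on_inner[OF open_UNIV shift shift] open_UNIV)
  have K: "compact (cball a r)" "cball a r \<subseteq> c ` U" using r(2) by auto
  have \<rho>0: "\<rho> u = 0" if "u \<notin> cball a r" for u
    using bump_eq_0[of r "u - a"] r(1) that by (simp add: \<rho>_def dist_norm norm_minus_commute)
  define g R where "g x = (if x \<in> U then bg (c x) else 0)" and "R x = (if x \<in> U then bR (c x) else 0)" for x
  have gR0: "g x = 0" "R x = 0" if "x \<notin> inv_into U c ` cball a r" for x
    using smooth_fun_lift(3)[OF U(1) bg K _ that] smooth_fun_lift(3)[OF U(1) bR K _ that] \<rho>0
    by (auto simp: g_def R_def bg_def bR_def)
  have "smooth_fun A g" "smooth_fun A R"
    unfolding g_def R_def
    by (rule smooth_fun_lift(1)[OF U(1) _ K]; simp add: bg bR; simp add: bg_def bR_def \<rho>0)+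
  moreover have "\<forall>x. 0 \<le> R x" using e by (simp add: R_def bR_def \<rho>_def bump_nonneg)
  moreover have "g p = 0" "R p = 0" by (auto simp: g_def R_def bg_def bR_def a_def)
  moreover have "\<exists>W. open W \<and> Q \<subseteq> W \<and> (\<forall>x\<in>W. g x = 0 \<and> R x = 0)"
  proof (intro exI conjI)
    show "open (- (inv_into U c ` cball a r))"
      by (intro open_Compl smooth_fun_lift(2)[OF U(1) bg K]) (simp add: bg_def \<rho>0)
    show "Q \<subseteq> - (inv_into U c ` cball a r)" using r(2) inv_chart[OF U(1)] by auto
  qed (use gR0 in auto)
  moreover have "\<exists>U c r W. (U, c) \<in> A \<and> r > 0 \<and> open W \<and> p \<in> W \<and> W \<subseteq> U \<and>
      (\<forall>x\<in>W. r * (norm (c x - c p))\<^sup>2 \<le> R x)"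
  proof -
    have \<rho>a: "\<rho> a > 0" using r(1) by (simp add: \<rho>_def bump_pos)
    have "continuous_on UNIV \<rho>" using smooth_on_continuous[OF \<rho>, of "[]"] by simp
    then have "open (\<rho> -` {\<rho> a / 2<..})" by (intro open_vimage) auto
    then have "open (U \<inter> c -` (\<rho> -` {\<rho> a / 2<..}))"
      by (rule continuous_open_preimage[OF continuous_on_chart[OF U(1)] open_chart[OF U(1)]])
    moreover have "p \<in> U \<inter> c -` (\<rho> -` {\<rho> a / 2<..})" using \<rho>a U(2) by (simp add: a_def)
    moreover have "\<rho> a / 2 * e * (norm (c x - c p))\<^sup>2 \<le> R x" if "x \<in> U \<inter> c -` (\<rho> -` {\<rho> a / 2<..})" for x
    proof -
      have "\<rho> a / 2 * (e * (norm (c x - c p))\<^sup>2) \<le> \<rho> (c x) * (e * (norm (c x - c p))\<^sup>2)"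
        using that e by (intro mult_right_mono) auto
      then show ?thesis using that by (simp add: R_def bR_def dot_square_norm a_def)
    qed
    moreover have "\<rho> a / 2 * e > 0" using \<rho>a e by simp
    ultimately show ?thesis using U(1) by blast
  qed
  moreover have "\<exists>V. open V \<and> p \<in> V \<and>
      (\<forall>x\<in>V - {p}. \<forall>s\<in>{-1, 1}. g (F x) + s * R (F x) < g x + s * R x)"
  proof -
    have "isCont \<rho> a"
      using has_derivative_continuous[OF smooth_on_has_derivative[OF \<rho>, of a "[]"]] by simp
    moreover have "\<rho> a > 0" using r(1) by (simp add: \<rho>_def bump_pos)
    ultimately have "\<exists>\<delta>>0. \<forall>u. u \<noteq> a \<and> norm (u - a) < \<delta> \<longrightarrow> \<rho> (F' u) * q s (F' u - a) < \<rho> u * q s (u - a)"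
      if "s \<in> {-1, 1}" for s
      using quadratic_form_decrease[OF F' \<open>F' a = a\<close> q_cont q_scale] q_decr that by blast
    from this[of "-1"] this[of 1] obtain d1 d2 where d12: "d1 > 0" "d2 > 0"
      "\<And>u. u \<noteq> a \<Longrightarrow> norm (u - a) < d1 \<Longrightarrow> \<rho> (F' u) * q (-1) (F' u - a) < \<rho> u * q (-1) (u - a)"
      "\<And>u. u \<noteq> a \<Longrightarrow> norm (u - a) < d2 \<Longrightarrow> \<rho> (F' u) * q 1 (F' u - a) < \<rho> u * q 1 (u - a)"
      by auto
    define V where "V = (U \<inter> c -` ball a (min d1 d2)) \<inter> F -` U"
    have gR: "g x + s * R x = \<rho> (c x) * q s (c x - a)" if "x \<in> U" for x s
      using that by (simp add: g_def R_def bg_def bR_def q_def algebra_simps)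
    have "open V" unfolding V_def
      by (intro open_Int open_vimage open_chart[OF U(1)] smooth_map_continuous[OF F(1)]
          continuous_open_preimage[OF continuous_on_chart[OF U(1)] open_chart[OF U(1)]]) auto
    moreover have "p \<in> V" using U(2) F(2) d12 by (simp add: V_def a_def)
    moreover have "g (F x) + s * R (F x) < g x + s * R x" if x: "x \<in> V - {p}" and s: "s \<in> {-1, 1}" for x s
    proof -
      have xU: "x \<in> U" "F x \<in> U" "norm (c x - a) < d1" "norm (c x - a) < d2"
        using x by (auto simp: V_def dist_norm norm_minus_commute)
      have "c x \<noteq> a" using x xU(1) U(2) inj_on_chart[OF U(1)] by (auto simp: a_def inj_on_def)
      moreover have "F' (c x) = c (F x)" using inv_chart[OF U(1) xU(1)] by (simp add: F'_def)
      ultimately have "\<rho> (c (F x)) * q s (c (F x) - a) < \<rho> (c x) * q s (c x - a)"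
        using d12(3)[of "c x"] d12(4)[of "c x"] xU(3,4) s by auto
      then show ?thesis by (simp add: gR xU)
    qed
    ultimately show ?thesis by blast
  qed
  ultimately show ?thesis unfolding adapted_def by (intro exI[of _ g] exI[of _ R] conjI)
qed

end

section \<open>Dynamics of a Morse-Smale diffeomorphism\<close>

locale morse_smale = atlas A
  for A :: "('a::{t2_space,second_countable_topology}, 'n::finite) chart set" +
  fixes f :: "'a \<Rightarrow> 'a"
  assumes compact_space: "compact (UNIV :: 'a set)" and Morse_Smale: "Morse_Smale A f"
begin

abbreviation "P \<equiv> periodic_points f"

lemma bij_f: "bij f" and smooth_map_f: "smooth_map A f" and smooth_map_inv: "smooth_map A (inv f)"
  using Morse_Smale by (auto simp: Morse_Smale_def diffeomorphism_def)

lemma finite_P: "finite P"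
  using Morse_Smale by (auto simp: Morse_Smale_def)

lemma inv_f [simp]: "inv f (f x) = x" and f_inv [simp]: "f (inv f x) = x"
  using bij_f by (simp_all add: bij_def surj_f_inv_f)

lemma inv_funpow [simp]: "(inv f ^^ n) ((f ^^ n) x) = x"
  by (induction n arbitrary: x) (simp_all add: funpow_swap1)

lemma funpow_inv [simp]: "(f ^^ n) ((inv f ^^ n) x) = x"
  by (induction n arbitrary: x) (simp_all add: funpow_swap1)

lemma f_mem_P_iff [simp]: "f x \<in> P \<longleftrightarrow> x \<in> P"
proof -
  have "(f ^^ k) (f x) = f x \<longleftrightarrow> (f ^^ k) x = x" for k
    by (metis funpow_swap1 inv_f)
  then show ?thesis by (simp add: periodic_points_def)
qed

lemma funpow_mem_P_iff [simp]: "(f ^^ n) x \<in> P \<longleftrightarrow> x \<in> P"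
  by (induction n) auto

lemma inv_funpow_mem_P_iff [simp]: "(inv f ^^ n) x \<in> P \<longleftrightarrow> x \<in> P"
  using funpow_mem_P_iff[of n "(inv f ^^ n) x"] by simp

lemma
  assumes "p \<in> P"
  shows period_pos: "period f p > 0" and funpow_period: "(f ^^ period f p) p = p"
  using assms LeastI_ex[of "\<lambda>k. k > 0 \<and> (f ^^ k) p = p"]
  by (auto simp: period_def periodic_points_def)

lemma inv_funpow_period: "p \<in> P \<Longrightarrow> (inv f ^^ period f p) p = p"
  by (metis funpow_period inv_funpow)

lemma stable_set_iff: "x \<in> stable_set f p \<longleftrightarrow> (\<lambda>m. ((f ^^ period f p) ^^ m) x) \<longlonglongrightarrow> p"
  by (simp add: stable_set_def funpow_mult mult.commute)

lemma unstable_set_iff: "x \<in> unstable_set f p \<longleftrightarrow> (\<lambda>m. ((inv f ^^ period f p) ^^ m) x) \<longlonglongrightarrow> p"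
  by (simp add: unstable_set_def funpow_mult mult.commute)

lemma mem_stable_set: "p \<in> P \<Longrightarrow> p \<in> stable_set f p"
proof -
  assume "p \<in> P"
  then have "((f ^^ period f p) ^^ m) p = p" for m by (induction m) (auto simp: funpow_period)
  then show ?thesis by (simp add: stable_set_iff)
qed

lemma mem_unstable_set: "p \<in> P \<Longrightarrow> p \<in> unstable_set f p"
proof -
  assume "p \<in> P"
  then have "((inv f ^^ period f p) ^^ m) p = p" for m by (induction m) (auto simp: inv_funpow_period)
  then show ?thesis by (simp add: unstable_set_iff)
qed

lemma continuous_funpow: "continuous_on UNIV (f ^^ n)" "continuous_on UNIV (inv f ^^ n)"
  using continuous_on_funpow smooth_map_continuous smooth_map_f smooth_map_inv by blast+

text \<open>The orbit sum makes the change of \<open>\<Sum>\<^sub>i h \<circ> f\<^sup>i\<close> along \<open>f\<close> equal to the change of \<open>h\<close> along the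
  first return map, so that it suffices to work near single periodic points.\<close>

definition orbit_sum :: "('a \<Rightarrow> 'a \<Rightarrow> real) \<Rightarrow> 'a \<Rightarrow> real" where
  "orbit_sum h x = (\<Sum>p\<in>P. \<Sum>i<period f p. h p ((f ^^ i) x))"

lemma orbit_sum_f:
  "orbit_sum h (f x) = orbit_sum h x + (\<Sum>p\<in>P. h p ((f ^^ period f p) x) - h p x)"
proof -
  have "(\<Sum>i<period f p. h p ((f ^^ i) (f x))) =
      (\<Sum>i<period f p. h p ((f ^^ i) x)) + (h p ((f ^^ period f p) x) - h p x)" for p
    using sum_lessThan_telescope[of "\<lambda>i. h p ((f ^^ i) x)" "period f p"]
    by (simp add: sum_subtractf funpow_swap1)
  then show ?thesis by (simp add: orbit_sum_def sum.distrib)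
qed

lemma smooth_fun_orbit_sum:
  "(\<And>p. p \<in> P \<Longrightarrow> smooth_fun A (h p)) \<Longrightarrow> smooth_fun A (orbit_sum h)"
  unfolding orbit_sum_def
  by (rule smooth_fun_sum, rule smooth_fun_sum,
      rule smooth_fun_compose[OF _ smooth_map_funpow[OF smooth_map_f]])

text \<open>In contrast to \<open>adapted\<close>, the decrease is along \<open>f\<close> itself,
  and one pair serves all periodic points. As \<open>f\<close> moves these points, the normalization
  of \<open>g\<close> at \<open>p\<close> gives way to constancy of \<open>G\<close> on periodic
  orbits.\<close>

definition globally_adapted :: "('a \<Rightarrow> real) \<Rightarrow> ('a \<Rightarrow> real) \<Rightarrow> bool" where
  "globally_adapted G R \<longleftrightarrow> smooth_fun A G \<and> smooth_fun A R \<and>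
    (\<forall>p\<in>P. R p = 0 \<and> G (f p) = G p \<and>
      (\<exists>U c r W. (U, c) \<in> A \<and> r > 0 \<and> open W \<and> p \<in> W \<and> W \<subseteq> U \<and>
        (\<forall>x\<in>W. r * (norm (c x - c p))\<^sup>2 \<le> R x)) \<and>
      (\<exists>V. open V \<and> p \<in> V \<and>
        (\<forall>x\<in>V - {p}. \<forall>s\<in>{-1, 1}. G (f x) + s * R (f x) < G x + s * R x)))"

text \<open>Near \<open>p\<close> only the summand of \<open>p\<close> changes along
  \<open>f\<close>: for another \<open>q\<close>, both \<open>p\<close> and its image under the
  return map of \<open>q\<close> are periodic points other than \<open>q\<close>, and
  \<open>g q\<close> and \<open>R q\<close> vanish near these. The lower bound for \<open>R\<close>
  survives the summation since all terms are nonnegative and the term \<open>i = 0\<close> of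
  \<open>p\<close> is \<open>R p x\<close>.\<close>

lemma globally_adapted_exists: "\<exists>G R. globally_adapted G R"
proof -
  have "\<exists>g R. adapted (f ^^ period f p) (P - {p}) p g R" if "p \<in> P" for p
  proof (rule adapted_exists)
    show "smooth_map A (f ^^ period f p)" by (intro smooth_map_funpow smooth_map_f)
    show "(f ^^ period f p) p = p" by (rule funpow_period[OF that])
    have "hyperbolic_periodic A f p" using Morse_Smale that by (auto simp: Morse_Smale_def)
    then show "cmod l \<noteq> 1" if "(U, c) \<in> A" "p \<in> U" "complex_eigenvalue (matrix (frechet_derivative
        (c \<circ> f ^^ period f p \<circ> inv_into U c) (at (c p)))) l" for U c l
      using that unfolding hyperbolic_periodic_def by fastforce
  qed (use finite_P in auto)
  then obtain g R where gR: "\<And>p. p \<in> P \<Longrightarrow> adapted (f ^^ period f p) (P - {p}) p (g p) (R p)"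
    by metis
  have R_nonneg: "0 \<le> R p x" if "p \<in> P" for p x using gR[OF that] by (simp add: adapted_def)
  have zero: "g p q = 0 \<and> R p q = 0" if "p \<in> P" "q \<in> P" for p q
    using gR[OF that(1)] that(2) by (cases "q = p") (auto simp: adapted_def subset_iff)
  have eq: "orbit_sum g x + s * orbit_sum R x = orbit_sum (\<lambda>p x. g p x + s * R p x) x" for x s
    by (simp add: orbit_sum_def sum_distrib_left sum.distrib)
  have "globally_adapted (orbit_sum g) (orbit_sum R)"
    unfolding globally_adapted_def
  proof (intro conjI ballI smooth_fun_orbit_sum)
    fix p assume "p \<in> P"
    then show "smooth_fun A (g p)" "smooth_fun A (R p)" using gR[of p] by (simp_all add: adapted_def)
  next
    fix p assume p: "p \<in> P"
    show "orbit_sum R p = 0" using zero p by (simp add: orbit_sum_def)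
    show "orbit_sum g (f p) = orbit_sum g p" using zero p by (simp add: orbit_sum_f)
    have le: "R p x \<le> orbit_sum R x" for x
    proof -
      have "R p ((f ^^ 0) x) \<le> (\<Sum>i<period f p. R p ((f ^^ i) x))"
        using period_pos[OF p] R_nonneg[OF p] by (intro member_le_sum) auto
      also have "\<dots> \<le> orbit_sum R x"
        unfolding orbit_sum_def using p R_nonneg finite_P by (intro member_le_sum sum_nonneg) auto
      finally show ?thesis by simp
    qed
    obtain U c r W where "(U, c) \<in> A" "r > 0" "open W" "p \<in> W" "W \<subseteq> U"
      "\<forall>x\<in>W. r * (norm (c x - c p))\<^sup>2 \<le> R p x"
      using gR[OF p] unfolding adapted_def by blast
    then show "\<exists>U c r W. (U, c) \<in> A \<and> r > 0 \<and> open W \<and> p \<in> W \<and> W \<subseteq> U \<and>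
        (\<forall>x\<in>W. r * (norm (c x - c p))\<^sup>2 \<le> orbit_sum R x)"
      using order_trans[OF _ le] by blast
    obtain V where V: "open V" "p \<in> V" "\<And>x s. x \<in> V - {p} \<Longrightarrow> s \<in> {-1, 1} \<Longrightarrow>
        g p ((f ^^ period f p) x) + s * R p ((f ^^ period f p) x) < g p x + s * R p x"
      using gR[OF p] unfolding adapted_def by blast
    have "\<exists>W. open W \<and> P - {q} \<subseteq> W \<and> (\<forall>x\<in>W. g q x = 0 \<and> R q x = 0)" if "q \<in> P" for q
      using gR[OF that] unfolding adapted_def by blast
    then obtain W where W: "\<And>q. q \<in> P \<Longrightarrow> open (W q) \<and> P - {q} \<subseteq> W q \<and> (\<forall>x\<in>W q. g q x = 0 \<and> R q x = 0)"
      by metis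
    define V' where "V' = V \<inter> (\<Inter>q\<in>P - {p}. W q \<inter> (f ^^ period f q) -` W q)"
    have "open V'"
      unfolding V'_def using V(1) W finite_P continuous_funpow(1)
      by (intro open_Int open_INT ballI open_vimage) auto
    moreover have "p \<in> V'"
    proof -
      have "p \<in> W q" "(f ^^ period f q) p \<in> W q" if "q \<in> P - {p}" for q
      proof -
        \<comment> \<open>Injectivity: the only preimage of \<open>q\<close> under its own return
          map is \<open>q\<close>.\<close>
        have "(f ^^ period f q) p \<noteq> q"
          using that funpow_period[of q] by (metis DiffE inv_funpow insertI1)
        then show "p \<in> W q" "(f ^^ period f q) p \<in> W q" using W[of q] that p by auto
      qed
      then show ?thesis using V(2) by (simp add: V'_def)
    qed
    moreover have "orbit_sum g (f x) + s * orbit_sum R (f x) < orbit_sum g x + s * orbit_sum R x"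
      if x: "x \<in> V' - {p}" and s: "s \<in> {-1, 1}" for x s
    proof -
      let ?d = "\<lambda>q. (g q ((f ^^ period f q) x) + s * R q ((f ^^ period f q) x)) - (g q x + s * R q x)"
      have "?d q = 0" if "q \<in> P - {p}" for q
        using x W[of q] that by (auto simp: V'_def)
      then have "(\<Sum>q\<in>P. ?d q) = ?d p"
        by (simp add: sum.remove[OF finite_P p])
      also have "\<dots> < 0" using V(3)[of x s] x s by (auto simp: V'_def)
      finally show ?thesis unfolding eq by (simp add: orbit_sum_f)
    qed
    ultimately show "\<exists>V. open V \<and> p \<in> V \<and> (\<forall>x\<in>V - {p}. \<forall>s\<in>{-1, 1}.
        orbit_sum g (f x) + s * orbit_sum R (f x) < orbit_sum g x + s * orbit_sum R x)"
      by blast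
  qed
  then show ?thesis by blast
qed

text \<open>The growth estimate uses the return map, which fixes \<open>p\<close>, whereas
  \<open>h\<close> is known to decrease under \<open>f\<close>. Every point of the orbit of
  \<open>p\<close> is periodic and has its own neighbourhood of decrease; these are pulled back
  along the iterates and intersected.\<close>

lemma decreasing_near_periodic:
  assumes "\<And>q. q \<in> P \<Longrightarrow> h (f q) = h q \<and> (\<exists>V. open V \<and> q \<in> V \<and> (\<forall>x\<in>V - {q}. h (f x) < h x))"
    and p: "p \<in> P"
  shows "\<exists>V. open V \<and> p \<in> V \<and> V \<inter> P \<subseteq> {p} \<and> (\<forall>x\<in>V. h ((f ^^ n) x) \<le> (h x :: real))"
proof (induction n)
  case 0
  have "open (- (P - {p}))" using finite_P by (intro open_Compl finite_imp_closed) auto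
  then show ?case by (intro exI[of _ "- (P - {p})"]) auto
next
  case (Suc n)
  then obtain V where V: "open V" "p \<in> V" "V \<inter> P \<subseteq> {p}" "\<And>x. x \<in> V \<Longrightarrow> h ((f ^^ n) x) \<le> h x"
    by blast
  have q: "(f ^^ n) p \<in> P" using p by simp
  then obtain V' where V': "open V'" "(f ^^ n) p \<in> V'"
    "\<And>x. x \<in> V' - {(f ^^ n) p} \<Longrightarrow> h (f x) < h x"
    using assms(1) by meson
  have "h (f x) \<le> h x" if "x \<in> V'" for x
    using V'(3)[of x] assms(1)[OF q] that by (cases "x = (f ^^ n) p") auto
  then have "h ((f ^^ Suc n) x) \<le> h x" if "x \<in> V \<inter> (f ^^ n) -` V'" for x
    using V(4)[of x] that by fastforce
  moreover have "open (V \<inter> (f ^^ n) -` V')"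
    using V(1) V'(1) continuous_funpow(1) by (intro open_Int open_vimage)
  ultimately show ?case using V(2,3) V'(2) by (intro exI[of _ "V \<inter> (f ^^ n) -` V'"]) auto
qed

lemma Lyapunov_smooth: "Lyapunov_function A f \<phi> \<Longrightarrow> smooth_fun A \<phi>"
  by (simp add: Lyapunov_function_def Morse_function_def)

lemma Lyapunov_continuous: "Lyapunov_function A f \<phi> \<Longrightarrow> continuous_on UNIV \<phi>"
  by (intro smooth_fun_continuous Lyapunov_smooth)

lemma
  assumes "Lyapunov_function A f \<phi>"
  shows Lyapunov_funpow_less: "x \<notin> P \<Longrightarrow> n > 0 \<Longrightarrow> \<phi> ((f ^^ n) x) < \<phi> x"
    and Lyapunov_funpow_eq: "x \<in> P \<Longrightarrow> \<phi> ((f ^^ n) x) = \<phi> x"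
proof -
  have less: "\<phi> (f x) < \<phi> x" if "x \<notin> P" for x using assms that by (auto simp: Lyapunov_function_def)
  have eq: "\<phi> (f x) = \<phi> x" if "x \<in> P" for x using assms that by (auto simp: Lyapunov_function_def)
  show "\<phi> ((f ^^ n) x) < \<phi> x" if "x \<notin> P" "n > 0"
    using that(2)
  proof (induction n)
    case (Suc n)
    have "\<phi> ((f ^^ Suc n) x) < \<phi> ((f ^^ n) x)" using less[of "(f ^^ n) x"] that(1) by simp
    then show ?case using Suc by (cases "n = 0") auto
  qed simp
  show "\<phi> ((f ^^ n) x) = \<phi> x" if "x \<in> P" using that by (induction n) (auto simp: eq)
qed

lemma
  assumes "Lyapunov_function A f \<phi>"
  shows Lyapunov_inv_funpow_less: "x \<notin> P \<Longrightarrow> n > 0 \<Longrightarrow> \<phi> x < \<phi> ((inv f ^^ n) x)"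
    and Lyapunov_inv_funpow_eq: "x \<in> P \<Longrightarrow> \<phi> ((inv f ^^ n) x) = \<phi> x"
  using Lyapunov_funpow_less[OF assms, of "(inv f ^^ n) x" n] Lyapunov_funpow_eq[OF assms, of "(inv f ^^ n) x" n]
  by auto

lemma Lyapunov_stable_set:
  assumes "Lyapunov_function A f \<phi>" "p \<in> P" "x \<in> stable_set f p"
  shows "\<phi> p \<le> \<phi> x"
  using Lyapunov_tendsto_le[OF Lyapunov_continuous[OF assms(1)], of "f ^^ period f p" x p]
    Lyapunov_funpow_less[OF assms(1) _ period_pos[OF assms(2)]] Lyapunov_funpow_eq[OF assms(1)] assms(3)
  unfolding stable_set_iff by (metis less_eq_real_def)

lemma Lyapunov_unstable_set:
  assumes "Lyapunov_function A f \<phi>" "p \<in> P" "x \<in> unstable_set f p"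
  shows "\<phi> x \<le> \<phi> p"
proof -
  have "continuous_on UNIV (\<lambda>x. - \<phi> x)" by (intro continuous_on_minus Lyapunov_continuous assms)
  then have "- \<phi> p \<le> - \<phi> x"
  proof (rule Lyapunov_tendsto_le)
    show "(\<lambda>m. ((inv f ^^ period f p) ^^ m) x) \<longlonglongrightarrow> p" using assms(3) by (simp add: unstable_set_iff)
    show "- \<phi> ((inv f ^^ period f p) y) \<le> - \<phi> y" for y
      using Lyapunov_inv_funpow_less[OF assms(1) _ period_pos[OF assms(2)], of y]
        Lyapunov_inv_funpow_eq[OF assms(1), of y] by fastforce
  qed
  then show ?thesis by simp
qed

text \<open>On the stable set, \<open>stable_set_local_min\<close> is applied to
  \<open>G - R\<close> and the return map. The unstable set is the stable set of the inverse map,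
  along which \<open>- \<phi>\<close> decreases and \<open>- (G + R)\<close> takes the place of
  \<open>G - R\<close>; hence both signs in \<open>globally_adapted\<close>.\<close>

lemma globally_adapted_growth:
  assumes \<phi>: "Lyapunov_function A f \<phi>" and GR: "globally_adapted G R" and p: "p \<in> P"
  shows "\<exists>U. open U \<and> p \<in> U \<and> (\<forall>x\<in>U \<inter> stable_set f p. G p + R x \<le> G x) \<and>
    (\<forall>x\<in>U \<inter> unstable_set f p. G x + R x \<le> G p)"
proof -
  let ?k = "period f p"
  note k = period_pos[OF p]
  have Rp: "R p = 0" using GR p by (simp add: globally_adapted_def)
  have cont: "continuous_on UNIV G" "continuous_on UNIV R"
    using GR by (auto simp: globally_adapted_def intro: smooth_fun_continuous)
  have decr: "\<exists>V. open V \<and> p \<in> V \<and> V \<inter> P \<subseteq> {p} \<and>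
      (\<forall>x\<in>V. G ((f ^^ ?k) x) + s * R ((f ^^ ?k) x) \<le> G x + s * R x)" if "s \<in> {-1, 1}" for s
  proof (rule decreasing_near_periodic[OF _ p])
    fix q assume q: "q \<in> P"
    then have "R q = 0" "R (f q) = 0" "G (f q) = G q" using GR by (auto simp: globally_adapted_def)
    moreover have "\<exists>V. open V \<and> q \<in> V \<and> (\<forall>x\<in>V - {q}. G (f x) + s * R (f x) < G x + s * R x)"
      using GR q that unfolding globally_adapted_def by meson
    ultimately show "G (f q) + s * R (f q) = G q + s * R q \<and>
        (\<exists>V. open V \<and> q \<in> V \<and> (\<forall>x\<in>V - {q}. G (f x) + s * R (f x) < G x + s * R x))"
      by simp
  qed
  obtain V where V: "open V" "p \<in> V" "V \<inter> P \<subseteq> {p}"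
    "\<And>x. x \<in> V \<Longrightarrow> G ((f ^^ ?k) x) + (-1) * R ((f ^^ ?k) x) \<le> G x + (-1) * R x"
    using decr[of "-1"] by blast
  have "\<exists>U. open U \<and> p \<in> U \<and> (\<forall>x\<in>U. (\<lambda>m. ((f ^^ ?k) ^^ m) x) \<longlonglongrightarrow> p \<longrightarrow>
      G p + (-1) * R p \<le> G x + (-1) * R x)"
  proof (rule stable_set_local_min[where F = "f ^^ ?k" and F' = "inv f ^^ ?k" and \<phi> = \<phi> and P = P
        and V = V and g = "\<lambda>x. G x + (-1) * R x"])
    show "continuous_on UNIV (\<lambda>x. G x + (-1) * R x)" by (intro continuous_intros cont)
  qed (use V k p in \<open>simp_all add: compact_space continuous_funpow Lyapunov_continuous[OF \<phi>]
        Lyapunov_funpow_less[OF \<phi>] Lyapunov_funpow_eq[OF \<phi>] funpow_period\<close>)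
  then obtain U1 where U1: "open U1" "p \<in> U1" "\<forall>x\<in>U1. x \<in> stable_set f p \<longrightarrow>
      G p + (-1) * R p \<le> G x + (-1) * R x"
    unfolding stable_set_iff by blast
  obtain V' where V': "open V'" "p \<in> V'" "V' \<inter> P \<subseteq> {p}"
    "\<And>x. x \<in> V' \<Longrightarrow> G ((f ^^ ?k) x) + 1 * R ((f ^^ ?k) x) \<le> G x + 1 * R x"
    using decr[of 1] by blast
  \<comment> \<open>\<open>V'\<close> consists of points where the return map lowers
    \<open>G + R\<close>. The inverse map raises this function at the images of such points, so the
    neighbourhood has to be moved by one return.\<close>
  let ?V = "(inv f ^^ ?k) -` V'"
  have "\<exists>U. open U \<and> p \<in> U \<and> (\<forall>x\<in>U. (\<lambda>m. ((inv f ^^ ?k) ^^ m) x) \<longlonglongrightarrow> p \<longrightarrow>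
      - (G p + R p) \<le> - (G x + R x))"
  proof (rule stable_set_local_min[where F = "inv f ^^ ?k" and F' = "f ^^ ?k" and \<phi> = "\<lambda>x. - \<phi> x"
        and P = P and V = ?V and g = "\<lambda>x. - (G x + R x)"])
    show "continuous_on UNIV (\<lambda>x. - \<phi> x)" by (intro continuous_on_minus Lyapunov_continuous \<phi>)
    show "- \<phi> ((inv f ^^ ?k) x) < - \<phi> x" if "x \<notin> P" for x
      using Lyapunov_inv_funpow_less[OF \<phi> that k] by simp
    show "- \<phi> ((inv f ^^ ?k) x) = - \<phi> x" if "x \<in> P" for x
      using Lyapunov_inv_funpow_eq[OF \<phi> that] by simp
    show "(inv f ^^ ?k) p = p" by (rule inv_funpow_period[OF p])
    then show "p \<in> ?V" using V'(2) by simp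
    show "open ?V" by (intro open_vimage V' continuous_funpow)
    show "?V \<inter> P \<subseteq> {p}"
    proof
      fix x assume "x \<in> ?V \<inter> P"
      then have "(inv f ^^ ?k) x = p" using V'(3) by auto
      then have "x = (f ^^ ?k) p" using funpow_inv[of ?k x] by simp
      then show "x \<in> {p}" by (simp add: funpow_period[OF p])
    qed
    show "continuous_on UNIV (\<lambda>x. - (G x + R x))" by (intro continuous_intros cont)
    show "- (G ((inv f ^^ ?k) x) + R ((inv f ^^ ?k) x)) \<le> - (G x + R x)" if "x \<in> ?V" for x
      using V'(4)[of "(inv f ^^ ?k) x"] that by simp
  qed (simp_all add: compact_space continuous_funpow)
  then obtain U2 where U2: "open U2" "p \<in> U2" "\<forall>x\<in>U2. x \<in> unstable_set f p \<longrightarrow>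
      - (G p + R p) \<le> - (G x + R x)"
    unfolding unstable_set_iff by blast
  show ?thesis using U1 U2 Rp by (intro exI[of _ "U1 \<inter> U2"]) (auto simp: algebra_simps)
qed

end

section \<open>Perturbations of Lyapunov functions\<close>

context atlas
begin

section \<open>Functions along a parametrized submanifold\<close>

lemma immersion_chart:
  assumes "immersion_onto A E j W" "(U, c) \<in> A"
  shows "open (j -` U)" "smooth_on (j -` U) (c \<circ> j)" "subspace E"
    and "y \<in> E \<Longrightarrow> j y \<in> U \<Longrightarrow> inj_on (frechet_derivative (c \<circ> j) (at y)) E"
  using assms open_chart[OF assms(2)] open_vimage[of U j] by (auto simp: immersion_onto_def)

lemma immersion_smooth_fun:
  assumes j: "immersion_onto A E j W" and U: "(U, c) \<in> A" and \<psi>: "smooth_fun A \<psi>"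
  shows "smooth_on (j -` U) (\<psi> \<circ> j)"
proof -
  note S = immersion_chart(1,2)[OF j U]
  have "smooth_on (j -` U) (\<lambda>z. (\<psi> \<circ> inv_into U c) ((c \<circ> j) z))"
    by (rule smooth_on_compose[OF S(1) open_chart_image[OF U] _ smooth_fun_chart[OF \<psi> U] S(2)]) auto
  then show ?thesis
    by (rule smooth_on_cong[OF S(1), rotated]) (use inv_chart[OF U] in auto)
qed

text \<open>This expresses the Hessian along \<open>j\<close> by the 2-jet in a chart, the quantity
  that \<open>Cr_nbhd\<close> controls.\<close>

lemma immersion_Hessian:
  assumes j: "immersion_onto A E j W" and U: "(U, c) \<in> A" and \<psi>: "smooth_fun A \<psi>" and y: "j y \<in> U"
  shows "dir_derivs [v, w] (\<psi> \<circ> j) y =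
    dir_derivs [dir_derivs [v] (c \<circ> j) y, dir_derivs [w] (c \<circ> j) y] (\<psi> \<circ> inv_into U c) (c (j y)) +
    dir_derivs [dir_derivs [v, w] (c \<circ> j) y] (\<psi> \<circ> inv_into U c) (c (j y))"
proof -
  note S = immersion_chart(1,2)[OF j U]
  have "dir_derivs [v, w] (\<psi> \<circ> j) y = dir_derivs [v, w] (\<lambda>z. (\<psi> \<circ> inv_into U c) ((c \<circ> j) z)) y"
    by (rule dir_derivs_cong[OF S(1)]) (use inv_chart[OF U] y in auto)
  also have "\<dots> = dir_derivs [dir_derivs [v] (c \<circ> j) y, dir_derivs [w] (c \<circ> j) y] (\<psi> \<circ> inv_into U c) ((c \<circ> j) y) +
    dir_derivs [dir_derivs [v, w] (c \<circ> j) y] (\<psi> \<circ> inv_into U c) ((c \<circ> j) y)"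
    by (rule dir_derivs_compose2[OF S(1) open_chart_image[OF U] _ smooth_fun_chart[OF \<psi> U] S(2)]) (use y in auto)
  finally show ?thesis by simp
qed

lemma immersion_critical_min:
  assumes j: "immersion_onto A E j W" and \<psi>: "smooth_fun A \<psi>" and y: "y \<in> E"
    and min: "\<And>x. x \<in> W \<Longrightarrow> \<psi> (j y) \<le> \<psi> x"
  shows "critical_along E (\<psi> \<circ> j) y"
proof -
  obtain U c where U: "(U, c) \<in> A" "j y \<in> U" by (rule chart_exists)
  have "j ` E = W" using j by (simp add: immersion_onto_def)
  then show ?thesis
    using min U(2) immersion_chart(3)[OF j U(1)] y
    by (intro critical_along_local_min[OF immersion_smooth_fun[OF j U(1) \<psi>] _ _ _ open_UNIV]) auto
qed

text \<open>Injectivity of the derivative of \<open>c \<circ> j\<close> on \<open>E\<close> bounds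
  the chart distance below by \<open>k\<close> times the parameter distance, which turns the growth
  rate \<open>r\<close> into \<open>r k^2\<close>.\<close>

lemma immersion_quadratic_growth:
  assumes j: "immersion_onto A E j W" and \<psi>: "smooth_fun A \<psi>" and y: "y \<in> E"
    and U: "(U, c) \<in> A" "j y \<in> U" and N: "open N" "j y \<in> N" and r: "r > 0"
    and growth: "\<And>x. x \<in> N \<inter> W \<Longrightarrow> \<psi> (j y) + r * (norm (c x - c (j y)))\<^sup>2 \<le> \<psi> x"
  shows "nondegenerate_along E (\<psi> \<circ> j) y"
proof -
  note S = immersion_chart[OF j U(1)]
  have "((c \<circ> j) has_derivative frechet_derivative (c \<circ> j) (at y)) (at y)"
    using smooth_on_has_derivative[OF S(2), of y "[]"] U(2) by (simp add: dir_derivs.simps(2))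
  then obtain k d where kd: "k > 0" "d > 0"
    "\<And>x. x \<in> E \<Longrightarrow> norm (x - y) < d \<Longrightarrow> k * norm (x - y) \<le> norm ((c \<circ> j) x - (c \<circ> j) y)"
    by (rule injective_derivative_lower_bound[OF _ S(4)[OF y U(2)] S(3) y]) (rule that)
  have "j ` E = W" "continuous_on UNIV j" using j by (auto simp: immersion_onto_def)
  show ?thesis
  proof (rule nondegenerate_along_quadratic_growth[OF immersion_smooth_fun[OF j U(1) \<psi>] S(1) _ S(3) y])
    show "open (j -` N \<inter> ball y d)"
      using N(1) \<open>continuous_on UNIV j\<close> by (intro open_Int open_vimage) auto
    show "r * k\<^sup>2 > 0" using r kd(1) by simp
    fix x assume x: "x \<in> j -` N \<inter> ball y d \<inter> E"
    then have "k * norm (x - y) \<le> norm (c (j x) - c (j y))"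
      using kd(3)[of x] by (simp add: dist_norm norm_minus_commute)
    then have "(k * norm (x - y))\<^sup>2 \<le> (norm (c (j x) - c (j y)))\<^sup>2"
      using kd(1) by (intro power_mono) auto
    then have "r * (k * norm (x - y))\<^sup>2 \<le> r * (norm (c (j x) - c (j y)))\<^sup>2"
      using r by (intro mult_left_mono) auto
    moreover have "\<psi> (j y) + r * (norm (c (j x) - c (j y)))\<^sup>2 \<le> \<psi> (j x)"
      using x \<open>j ` E = W\<close> by (intro growth) auto
    ultimately show "(\<psi> \<circ> j) y + r * k\<^sup>2 * (norm (x - y))\<^sup>2 \<le> (\<psi> \<circ> j) x"
      by (simp add: power_mult_distrib)
  qed (use U(2) N(2) kd(2) in auto)
qed

lemma immersion_uminus:
  assumes j: "immersion_onto A E j W" and \<psi>: "smooth_fun A \<psi>"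
  shows "critical_along E ((\<lambda>x. - 1 * \<psi> x) \<circ> j) y \<longleftrightarrow> critical_along E (\<psi> \<circ> j) y"
    and "nondegenerate_along E ((\<lambda>x. - 1 * \<psi> x) \<circ> j) y \<longleftrightarrow> nondegenerate_along E (\<psi> \<circ> j) y"
proof -
  obtain U c where U: "(U, c) \<in> A" "j y \<in> U" by (rule chart_exists)
  have eq: "(\<lambda>x. - 1 * \<psi> x) \<circ> j = (\<lambda>z. - (\<psi> \<circ> j) z)" by auto
  show "critical_along E ((\<lambda>x. - 1 * \<psi> x) \<circ> j) y \<longleftrightarrow> critical_along E (\<psi> \<circ> j) y"
    "nondegenerate_along E ((\<lambda>x. - 1 * \<psi> x) \<circ> j) y \<longleftrightarrow> nondegenerate_along E (\<psi> \<circ> j) y"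
    unfolding eq
    by (rule critical_along_uminus[OF immersion_chart(1)[OF j U(1)] immersion_smooth_fun[OF j U(1) \<psi>]]
        nondegenerate_along_uminus[OF immersion_chart(1)[OF j U(1)] immersion_smooth_fun[OF j U(1) \<psi>]];
        use U in simp)+
qed

text \<open>Suppose degenerate \<open>\<psi> n\<close> had 2-jets at \<open>j y\<close> converging
  to that of \<open>\<phi>\<close>. Their Hessians along \<open>j\<close> depend linearly on these
  2-jets, with coefficients from \<open>j\<close> alone, so they converge too, and a kernel vector
  survives in the limit.\<close>

lemma immersion_nondegenerate_open:
  assumes j: "immersion_onto A E j W" and \<phi>: "smooth_fun A \<phi>" and U: "(U, c) \<in> A" "j y \<in> U"
    and nd: "nondegenerate_along E (\<phi> \<circ> j) y"
  shows "\<exists>\<epsilon>>0. \<forall>\<psi>\<in>Cr_nbhd A 2 (U, c) {j y} \<epsilon> \<phi>. nondegenerate_along E (\<psi> \<circ> j) y"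
proof (rule ccontr)
  assume contr: "\<not> ?thesis"
  have "\<exists>\<psi>. \<psi> \<in> Cr_nbhd A 2 (U, c) {j y} (inverse (real (Suc n))) \<phi> \<and> \<not> nondegenerate_along E (\<psi> \<circ> j) y" for n
  proof (rule ccontr)
    assume "\<not> ?thesis"
    then have "\<exists>\<epsilon>>0. \<forall>\<psi>\<in>Cr_nbhd A 2 (U, c) {j y} \<epsilon> \<phi>. nondegenerate_along E (\<psi> \<circ> j) y"
      by (intro exI[of _ "inverse (real (Suc n))"] conjI) auto
    with contr show False ..
  qed
  then obtain \<psi> where \<psi>: "\<And>n. \<psi> n \<in> Cr_nbhd A 2 (U, c) {j y} (inverse (real (Suc n))) \<phi>"
    "\<And>n. \<not> nondegenerate_along E (\<psi> n \<circ> j) y"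
    by metis
  define u where "u = c (j y)"
  define a where "a n = \<psi> n \<circ> inv_into U c" for n
  let ?a = "\<phi> \<circ> inv_into U c"
  have smooth: "smooth_fun A (\<psi> n)" for n using \<psi>(1)[of n] by (simp add: Cr_nbhd_def)
  have sa: "smooth_on (c ` U) (a n)" "smooth_on (c ` U) ?a" for n
    unfolding a_def by (intro smooth_fun_chart smooth \<phi> U)+
  have u: "u \<in> c ` U" using U(2) by (simp add: u_def)
  have lim: "(\<lambda>n. dir_derivs vs (a n) u) \<longlonglongrightarrow> dir_derivs vs ?a u"
    if "vs \<in> lists Basis" "length vs \<le> 2" for vs
  proof -
    have "\<bar>dir_derivs vs (a n) u - dir_derivs vs ?a u\<bar> < inverse (real (Suc n))" for n
      using \<psi>(1)[of n] that by (simp add: Cr_nbhd_def a_def u_def)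
    then have "(\<lambda>n. dir_derivs vs (a n) u - dir_derivs vs ?a u) \<longlonglongrightarrow> 0"
      by (intro Lim_null_comparison[OF always_eventually LIMSEQ_inverse_real_of_nat])
         (simp only: real_norm_def less_imp_le, simp)
    then show ?thesis by (rule LIM_zero_cancel)
  qed
  \<comment> \<open>\<open>Cr_nbhd\<close> compares derivatives in basis directions only; the
    expansions in both arguments extend the convergence to all directions.\<close>
  have fst_exp: "dir_derivs (v # vs) g u = (\<Sum>i\<in>Basis. (v \<bullet> i) * dir_derivs (i # vs) g u)"
    if "smooth_on (c ` U) g" for v vs and g :: "real ^ 'n \<Rightarrow> real"
    using linear_eq_sum_Basis[OF smooth_on_linear_Cons[OF that u, of vs], of v] by simp
  have snd_exp: "dir_derivs [v, w] g u = (\<Sum>i\<in>Basis. (w \<bullet> i) * dir_derivs [v, i] g u)"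
    if "smooth_on (c ` U) g" for v w and g :: "real ^ 'n \<Rightarrow> real"
    using dir_derivs_linear_snd[OF open_chart_image[OF U(1)] that u, of v w] by simp
  have lim1: "(\<lambda>n. dir_derivs [v] (a n) u) \<longlonglongrightarrow> dir_derivs [v] ?a u" for v
    unfolding fst_exp[OF sa(1), of v] fst_exp[OF sa(2), of v] by (intro tendsto_intros lim) auto
  have lim2': "(\<lambda>n. dir_derivs [v, i] (a n) u) \<longlonglongrightarrow> dir_derivs [v, i] ?a u" if "i \<in> Basis" for v i
    unfolding fst_exp[OF sa(1), of v] fst_exp[OF sa(2), of v] by (intro tendsto_intros lim) (use that in auto)
  have lim2: "(\<lambda>n. dir_derivs [v, w] (a n) u) \<longlonglongrightarrow> dir_derivs [v, w] ?a u" for v w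
    unfolding snd_exp[OF sa(1), of v w] snd_exp[OF sa(2), of v w] by (intro tendsto_intros lim2')
  have "\<exists>v\<in>E. v \<noteq> 0 \<and> (\<forall>w\<in>E. dir_derivs [v, w] (\<phi> \<circ> j) y = 0)"
  proof (rule degenerate_bilinear_limit)
    show "linear (\<lambda>v. dir_derivs [v, w] (\<psi> n \<circ> j) y)" for n w
      by (rule smooth_on_linear_Cons[OF immersion_smooth_fun[OF j U(1) smooth]]) (use U in auto)
    show "(\<lambda>n. dir_derivs [v, w] (\<psi> n \<circ> j) y) \<longlonglongrightarrow> dir_derivs [v, w] (\<phi> \<circ> j) y" for v w
      unfolding immersion_Hessian[OF j U(1) smooth U(2)] immersion_Hessian[OF j U(1) \<phi> U(2)]
        a_def[symmetric] u_def[symmetric]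
      by (intro tendsto_add lim1 lim2)
    show "subspace E" by (rule immersion_chart(3)[OF j U(1)])
    show "\<exists>v\<in>E. v \<noteq> 0 \<and> (\<forall>w\<in>E. dir_derivs [v, w] (\<psi> n \<circ> j) y = 0)" for n
      using \<psi>(2)[of n] by (auto simp: nondegenerate_along_def)
  qed
  then show False using nd by (auto simp: nondegenerate_along_def)
qed

section \<open>Small perturbations in the smooth topology\<close>

lemma dir_derivs_perturbation:
  assumes "smooth_fun A \<phi>" "smooth_fun A G" "(U, c) \<in> A" "u \<in> c ` U"
  shows "dir_derivs vs ((\<lambda>x. \<phi> x + e * G x) \<circ> inv_into U c) u =
    dir_derivs vs (\<phi> \<circ> inv_into U c) u + e * dir_derivs vs (G \<circ> inv_into U c) u"
proof -
  note S = open_chart_image[OF assms(3)]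
  have eq: "(\<lambda>x. \<phi> x + e * G x) \<circ> inv_into U c =
      (\<lambda>u. (\<phi> \<circ> inv_into U c) u + e * (G \<circ> inv_into U c) u)" by auto
  show ?thesis
    unfolding eq
    using dir_derivs_add[OF S smooth_fun_chart[OF assms(1,3)]
        smooth_on_bounded_linear[OF S bounded_linear_mult_right smooth_fun_chart[OF assms(2,3)]] assms(4), of vs e]
      dir_derivs_bounded_linear[OF S smooth_fun_chart[OF assms(2,3)] bounded_linear_mult_right assms(4), of vs e]
    by simp
qed

lemma smooth_fun_perturbation: "smooth_fun A \<phi> \<Longrightarrow> smooth_fun A G \<Longrightarrow> smooth_fun A (\<lambda>x. \<phi> x + e * G x)"
  by (intro smooth_fun_add smooth_fun_cmult)

text \<open>\<open>\<phi>\<close> may be off the centre \<open>\<phi>'\<close> of the neighbourhood.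
  Compactness of \<open>K\<close> makes the largest deviation \<open>m\<close> strictly smaller than
  \<open>\<eta>\<close>, and \<open>e B < \<eta> - m\<close> fits into the gap. Finitely many
  derivatives are involved, so the thresholds for \<open>e\<close> combine.\<close>

lemma eventually_Cr_nbhd:
  assumes \<phi>: "smooth_fun A \<phi>" "smooth_fun A G" and U: "(U, c) \<in> A" and K: "compact K" "K \<subseteq> U"
    and mem: "\<phi> \<in> Cr_nbhd A r (U, c) K \<eta> \<phi>'" and \<phi>': "smooth_fun A \<phi>'" and "\<eta> > 0"
  shows "\<forall>\<^sub>F e in at_right 0. (\<lambda>x. \<phi> x + e * G x) \<in> Cr_nbhd A r (U, c) K \<eta> \<phi>'"
proof (cases "K = {}")
  case True
  then show ?thesis by (simp add: Cr_nbhd_def smooth_fun_perturbation \<phi>)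
next
  case False
  let ?L = "{vs. set vs \<subseteq> (Basis :: (real ^ 'n) set) \<and> length vs \<le> r}"
  let ?d = "\<lambda>vs g x. dir_derivs vs (g \<circ> inv_into U c) (c x)"
  have cont: "continuous_on K (?d vs g)" if "smooth_fun A g" for vs g
    by (rule continuous_on_compose2[OF smooth_on_continuous[OF smooth_fun_chart[OF that U]]
        continuous_on_subset[OF continuous_on_chart[OF U] K(2)]]) (use K(2) in auto)
  have ev: "\<forall>\<^sub>F e in at_right 0. \<forall>x\<in>K. \<bar>?d vs (\<lambda>x. \<phi> x + e * G x) x - ?d vs \<phi>' x\<bar> < \<eta>" if vs: "vs \<in> ?L" for vs
  proof -
    have 1: "continuous_on K (\<lambda>x. \<bar>?d vs \<phi> x - ?d vs \<phi>' x\<bar>)"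
      by (intro continuous_on_rabs continuous_on_diff cont \<phi> \<phi>')
    have 2: "continuous_on K (\<lambda>x. \<bar>?d vs G x\<bar>)"
      by (intro continuous_on_rabs cont \<phi>)
    obtain x1 where x1: "x1 \<in> K" "\<forall>x\<in>K. \<bar>?d vs \<phi> x - ?d vs \<phi>' x\<bar> \<le> \<bar>?d vs \<phi> x1 - ?d vs \<phi>' x1\<bar>"
      using continuous_attains_sup[OF K(1) False 1] by (elim bexE)
    obtain x2 where x2: "\<forall>x\<in>K. \<bar>?d vs G x\<bar> \<le> \<bar>?d vs G x2\<bar>"
      using continuous_attains_sup[OF K(1) False 2] by (elim bexE)
    define m B where "m = \<bar>?d vs \<phi> x1 - ?d vs \<phi>' x1\<bar>" and "B = \<bar>?d vs G x2\<bar> + 1"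
    have "m < \<eta>" using mem x1(1) vs by (auto simp: Cr_nbhd_def m_def in_lists_conv_set subset_iff)
    have "B > 0" by (simp add: B_def)
    have "\<bar>?d vs (\<lambda>x. \<phi> x + e * G x) x - ?d vs \<phi>' x\<bar> < \<eta>" if "e > 0" "e < (\<eta> - m) / B" "x \<in> K" for e x
    proof -
      have "e * \<bar>?d vs G x\<bar> \<le> e * B" using that x2 by (intro mult_left_mono) (auto simp: B_def intro: add_increasing2)
      also have "\<dots> < \<eta> - m" using that(2) \<open>B > 0\<close> by (simp add: pos_less_divide_eq)
      finally have "\<bar>e * ?d vs G x\<bar> < \<eta> - m" using that(1) by (simp add: abs_mult)
      moreover have "\<bar>?d vs \<phi> x - ?d vs \<phi>' x\<bar> \<le> m" using x1(2) that(3) by (simp add: m_def)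
      moreover have "?d vs (\<lambda>x. \<phi> x + e * G x) x = ?d vs \<phi> x + e * ?d vs G x"
        by (rule dir_derivs_perturbation[OF \<phi> U]) (use that K in auto)
      ultimately show ?thesis by linarith
    qed
    moreover have "(\<eta> - m) / B > 0" using \<open>m < \<eta>\<close> \<open>B > 0\<close> by simp
    ultimately show ?thesis unfolding eventually_at_right_field by blast
  qed
  have "finite ?L" by (rule finite_lists_length_le) simp
  with ev have "\<forall>\<^sub>F e in at_right 0. \<forall>vs\<in>?L. \<forall>x\<in>K. \<bar>?d vs (\<lambda>x. \<phi> x + e * G x) x - ?d vs \<phi>' x\<bar> < \<eta>"
    by (intro eventually_ball_finite) auto
  then show ?thesis
    by (rule eventually_mono)
       (auto simp: Cr_nbhd_def smooth_fun_perturbation \<phi> in_lists_conv_set subset_iff)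
qed

text \<open>That the segment \<open>\<phi> + e G\<close> lies in \<open>T\<close> for small
  \<open>e > 0\<close> passes to finite intersections and to unions, so an induction over the
  generated topology reduces it to the basic neighbourhoods.\<close>

lemma eventually_openin:
  assumes \<phi>: "smooth_fun A \<phi>" "smooth_fun A G" and "openin (Cinf_topology A) T" "\<phi> \<in> T"
  shows "\<forall>\<^sub>F e in at_right 0. (\<lambda>x. \<phi> x + e * G x) \<in> T"
  using assms(3,4) unfolding Cinf_topology_def openin_topology_generated_by_iff
proof (induction T rule: generate_topology_on.induct)
  case (Int S T)
  then show ?case by (simp add: eventually_conj)
next
  case (UN \<T>)
  then obtain T where "T \<in> \<T>" "\<forall>\<^sub>F e in at_right 0. (\<lambda>x. \<phi> x + e * G x) \<in> T" by auto
  then show ?case by (auto elim: eventually_mono)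
next
  case (Basis T)
  then obtain r U c K \<eta> \<phi>' where "T = Cr_nbhd A r (U, c) K \<eta> \<phi>'" "(U, c) \<in> A" "compact K" "K \<subseteq> U"
    "\<eta> > 0" "smooth_fun A \<phi>'"
    by auto
  then show ?case using eventually_Cr_nbhd[OF \<phi>] Basis by simp
qed auto

lemma openin_Cr_nbhd:
  "C \<in> A \<Longrightarrow> compact K \<Longrightarrow> K \<subseteq> fst C \<Longrightarrow> \<epsilon> > 0 \<Longrightarrow> smooth_fun A \<phi> \<Longrightarrow>
    openin (Cinf_topology A) (Cr_nbhd A r C K \<epsilon> \<phi>)"
  unfolding Cinf_topology_def by (rule topology_generated_by_Basis) blast

lemma mem_Cr_nbhd: "smooth_fun A \<phi> \<Longrightarrow> \<epsilon> > 0 \<Longrightarrow> \<phi> \<in> Cr_nbhd A r C K \<epsilon> \<phi>"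
  by (cases C) (simp add: Cr_nbhd_def)

lemma topspace_Cinf: "smooth_fun A \<phi> \<Longrightarrow> \<phi> \<in> topspace (Cinf_topology A)"
proof -
  assume \<phi>: "smooth_fun A \<phi>"
  obtain U c where "(U, c) \<in> A" by (rule chart_exists)
  \<comment> \<open>Over the empty compact set the neighbourhood contains every smooth
    function.\<close>
  then have "openin (Cinf_topology A) (Cr_nbhd A 0 (U, c) {} 1 \<phi>)" by (intro openin_Cr_nbhd \<phi>) auto
  then show ?thesis using openin_subset mem_Cr_nbhd[OF \<phi>, of 1] by fastforce
qed

text \<open>Otherwise there are degenerate critical points \<open>x n\<close> of
  \<open>\<phi> + e n G\<close> with \<open>e n\<close> tending to 0. A subsequence converges to
  some \<open>l\<close>; in one chart around \<open>l\<close> the derivatives of first and second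
  order converge to those of \<open>\<phi>\<close>, so \<open>l\<close> would be a degenerate
  critical point of \<open>\<phi>\<close>.\<close>

lemma eventually_Morse:
  assumes "compact (UNIV :: 'a set)" and \<phi>: "Morse_function A \<phi>" and G: "smooth_fun A G"
  shows "\<forall>\<^sub>F e in at_right 0. Morse_function A (\<lambda>x. \<phi> x + e * G x)"
proof (rule ccontr)
  assume contr: "\<not> ?thesis"
  have s\<phi>: "smooth_fun A \<phi>" using \<phi> by (simp add: Morse_function_def)
  let ?\<psi> = "\<lambda>e x. \<phi> x + e * G x"
  define bad where "bad e C x \<longleftrightarrow> C \<in> A \<and> x \<in> fst C \<and>
      critical_along UNIV (?\<psi> e \<circ> inv_into (fst C) (snd C)) (snd C x) \<and>
      \<not> nondegenerate_along UNIV (?\<psi> e \<circ> inv_into (fst C) (snd C)) (snd C x)" for e C x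
  have "\<exists>e C x. 0 < e \<and> e < inverse (real (Suc n)) \<and> bad e C x" for n
  proof -
    have "\<exists>e>0. e < inverse (real (Suc n)) \<and> \<not> Morse_function A (?\<psi> e)"
    proof (rule ccontr)
      assume "\<not> ?thesis"
      then have "\<forall>\<^sub>F e in at_right 0. Morse_function A (?\<psi> e)"
        unfolding eventually_at_right_field by (intro exI[of _ "inverse (real (Suc n))"]) auto
      with contr show False ..
    qed
    then obtain e where e: "e > 0" "e < inverse (real (Suc n))" "\<not> Morse_function A (?\<psi> e)" by blast
    then obtain C x where "bad e C x"
      unfolding Morse_function_def bad_def using smooth_fun_perturbation[OF s\<phi> G, of e]
      by (auto simp: case_prod_unfold)
    then show ?thesis using e(1,2) by blast
  qed
  then obtain e C x where e: "\<And>n. 0 < e n" "\<And>n. e n < inverse (real (Suc n))"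
    and bad: "\<And>n. bad (e n) (C n) (x n)"
    by metis
  then have C: "\<And>n. C n \<in> A" "\<And>n. x n \<in> fst (C n)"
      "\<And>n. critical_along UNIV (?\<psi> (e n) \<circ> inv_into (fst (C n)) (snd (C n))) (snd (C n) (x n))"
      "\<And>n. \<not> nondegenerate_along UNIV (?\<psi> (e n) \<circ> inv_into (fst (C n)) (snd (C n))) (snd (C n) (x n))"
    by (auto simp: bad_def)
  obtain l r where l: "strict_mono r" "(x \<circ> r) \<longlonglongrightarrow> l"
    using compact_imp_seq_compact[OF assms(1)] unfolding seq_compact_def by (metis UNIV_I)
  obtain U c where U: "(U, c) \<in> A" "l \<in> U" by (rule chart_exists)
  have "\<forall>\<^sub>F n in sequentially. (x \<circ> r) n \<in> U"
    using l(2) open_chart[OF U(1)] U(2) by (rule topological_tendstoD)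
  then obtain N where N: "\<And>n. n \<ge> N \<Longrightarrow> x (r n) \<in> U" by (auto simp: eventually_sequentially)
  define s where "s n = r (n + N)" for n
  have xU: "x (s n) \<in> U" for n by (simp add: s_def N)
  have "(\<lambda>n. x (s n)) \<longlonglongrightarrow> l" using LIMSEQ_ignore_initial_segment[OF l(2), of N] by (simp add: s_def)
  then have u: "(\<lambda>n. c (x (s n))) \<longlonglongrightarrow> c l"
    by (rule continuous_on_tendsto_compose[OF continuous_on_chart[OF U(1)]]) (use U(2) xU in auto)
  have "e \<longlonglongrightarrow> 0"
    by (rule Lim_null_comparison[OF always_eventually LIMSEQ_inverse_real_of_nat])
       (use less_imp_le[OF e(1)] less_imp_le[OF e(2)] in \<open>auto simp del: of_nat_Suc\<close>)
  moreover have "strict_mono s" using l(1) by (simp add: s_def strict_mono_def)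
  ultimately have "(e \<circ> s) \<longlonglongrightarrow> 0" by (rule LIMSEQ_subseq_LIMSEQ)
  then have es: "(\<lambda>n. e (s n)) \<longlonglongrightarrow> 0" by (simp add: o_def)
  let ?a = "\<phi> \<circ> inv_into U c" and ?b = "G \<circ> inv_into U c"
  define H where "H n vs = dir_derivs vs (?\<psi> (e (s n)) \<circ> inv_into U c) (c (x (s n)))" for n vs
  have lim: "(\<lambda>n. H n vs) \<longlonglongrightarrow> dir_derivs vs ?a (c l)" for vs
  proof -
    have "(\<lambda>n. dir_derivs vs g (c (x (s n)))) \<longlonglongrightarrow> dir_derivs vs g (c l)"
      if "smooth_on (c ` U) g" for g :: "real ^ 'n \<Rightarrow> real"
      using continuous_on_tendsto_compose[OF smooth_on_continuous[OF that] u] U(2) xU by auto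
    note this[OF smooth_fun_chart[OF s\<phi> U(1)]] this[OF smooth_fun_chart[OF G U(1)]]
    then have "(\<lambda>n. dir_derivs vs ?a (c (x (s n))) + e (s n) * dir_derivs vs ?b (c (x (s n))))
        \<longlonglongrightarrow> dir_derivs vs ?a (c l) + 0 * dir_derivs vs ?b (c l)"
      by (intro tendsto_intros es)
    then show ?thesis
      unfolding H_def using dir_derivs_perturbation[OF s\<phi> G U(1)] xU by simp
  qed
  have deg: "critical_along UNIV (?\<psi> (e (s n)) \<circ> inv_into U c) (c (x (s n))) \<and>
      \<not> nondegenerate_along UNIV (?\<psi> (e (s n)) \<circ> inv_into U c) (c (x (s n)))" for n
    by (rule degenerate_critical_change_chart[OF smooth_fun_perturbation[OF s\<phi> G] U(1) _ xU C(2) C(3) C(4)])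
       (simp add: C(1))
  have "H n [v] = 0" for n v using deg[of n] by (simp add: critical_along_def H_def)
  then have "dir_derivs [v] ?a (c l) = 0" for v using LIMSEQ_unique[OF lim[of "[v]"]] by simp
  then have "critical_along UNIV ?a (c l)" by (simp add: critical_along_def)
  moreover have "\<exists>v\<in>UNIV. v \<noteq> 0 \<and> (\<forall>w\<in>UNIV. dir_derivs [v, w] ?a (c l) = 0)"
  proof (rule degenerate_bilinear_limit)
    show "linear (\<lambda>v. H n [v, w])" for n w
      unfolding H_def
      by (rule smooth_on_linear_Cons[OF smooth_fun_chart[OF smooth_fun_perturbation[OF s\<phi> G] U(1)]]) (use xU in auto)
    show "(\<lambda>n. H n [v, w]) \<longlonglongrightarrow> dir_derivs [v, w] ?a (c l)" for v w by (rule lim)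
    show "\<exists>v\<in>UNIV. v \<noteq> 0 \<and> (\<forall>w\<in>UNIV. H n [v, w] = 0)" for n
      using deg[of n] by (auto simp: nondegenerate_along_def H_def)
  qed simp
  ultimately show False using \<phi> U unfolding Morse_function_def nondegenerate_along_def by fastforce
qed

end

context morse_smale
begin

section \<open>Density and openness of the Morse-Lyapunov functions\<close>

text \<open>The parametrizations are part of what transversality of the invariant manifolds
  asserts.\<close>

lemma immersion_exists:
  assumes "p \<in> P"
  shows "\<exists>E j. immersion_onto A E j (stable_set f p)" "\<exists>E j. immersion_onto A E j (unstable_set f p)"
proof -
  have "transversal A (stable_set f p) (unstable_set f p)"
    using Morse_Smale assms by (auto simp: Morse_Smale_def)
  then show "\<exists>E j. immersion_onto A E j (stable_set f p)" "\<exists>E j. immersion_onto A E j (unstable_set f p)"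
    by (simp_all add: transversal_def immersed_submanifold_def)
qed

text \<open>On the neighbourhoods \<open>V p\<close> both \<open>\<phi>\<close> and \<open>G\<close>
  decrease, so every \<open>e > 0\<close> is admissible. Their complement \<open>K\<close> is
  compact without periodic points, so \<open>\<phi>\<close> drops there by at least some
  \<open>m > 0\<close>, which exceeds \<open>e B\<close> for small \<open>e\<close>.\<close>

lemma eventually_Lyapunov:
  assumes \<phi>: "Lyapunov_function A f \<phi>" and GR: "globally_adapted G R"
  shows "\<forall>\<^sub>F e in at_right 0. Lyapunov_function A f (\<lambda>x. \<phi> x + e * G x)"
proof -
  have G_P: "G (f p) = G p" if "p \<in> P" for p
    using GR that by (auto simp: globally_adapted_def)
  have sG: "smooth_fun A G" using GR by (simp add: globally_adapted_def)
  have "\<exists>V. open V \<and> p \<in> V \<and> (\<forall>x\<in>V - {p}. G (f x) < G x)" if "p \<in> P" for p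
  proof -
    obtain V where V: "open V" "p \<in> V"
      "\<forall>x\<in>V - {p}. \<forall>s\<in>{-1, 1}. G (f x) + s * R (f x) < G x + s * R x"
      using GR \<open>p \<in> P\<close> unfolding globally_adapted_def by blast
    \<comment> \<open>\<open>G\<close> is the mean of \<open>G + R\<close> and
      \<open>G - R\<close>.\<close>
    have "G (f x) < G x" if "x \<in> V - {p}" for x
    proof -
      have "G (f x) + (-1) * R (f x) < G x + (-1) * R x" "G (f x) + 1 * R (f x) < G x + 1 * R x"
        using V(3) that by blast+
      then show ?thesis by linarith
    qed
    with V(1,2) show ?thesis by blast
  qed
  then obtain V where V: "\<And>p. p \<in> P \<Longrightarrow> open (V p) \<and> p \<in> V p \<and> (\<forall>x\<in>V p - {p}. G (f x) < G x)"
    by metis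
  define K where "K = - (\<Union>p\<in>P. V p)"
  have near: "G (f x) < G x" if "x \<notin> K" "x \<notin> P" for x using that V by (auto simp: K_def)
  have "closed K" unfolding K_def using V by (intro closed_Compl open_UN) auto
  then have K: "compact K" using compact_space by (metis Int_UNIV_left compact_Int_closed)
  have cf: "continuous_on UNIV f" by (rule smooth_map_continuous[OF smooth_map_f])
  have cont: "continuous_on K (\<lambda>x. h (f x) - h x)" if "smooth_fun A h" for h
  proof -
    note h = smooth_fun_continuous[OF that]
    have "continuous_on UNIV (\<lambda>x. h (f x))" by (rule continuous_on_compose2[OF h cf]) simp
    from continuous_on_diff[OF this h] show ?thesis by (rule continuous_on_subset) simp
  qed
  have "\<forall>\<^sub>F e in at_right 0. \<forall>x\<in>K. (\<phi> (f x) - \<phi> x) + e * (G (f x) - G x) < 0"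
  proof (cases "K = {}")
    case False
    obtain x1 where x1: "x1 \<in> K" "\<forall>x\<in>K. \<phi> (f x) - \<phi> x \<le> \<phi> (f x1) - \<phi> x1"
      using continuous_attains_sup[OF K False cont[OF Lyapunov_smooth[OF \<phi>]]] by (elim bexE)
    obtain x2 where x2: "\<forall>x\<in>K. \<bar>G (f x) - G x\<bar> \<le> \<bar>G (f x2) - G x2\<bar>"
      using continuous_attains_sup[OF K False continuous_on_rabs[OF cont[OF sG]]] by (elim bexE)
    define m B where "m = \<phi> x1 - \<phi> (f x1)" and "B = \<bar>G (f x2) - G x2\<bar> + 1"
    have "x1 \<notin> P" using x1(1) V by (auto simp: K_def)
    then have "m > 0" using \<phi> by (auto simp: m_def Lyapunov_function_def)
    have "B > 0" by (simp add: B_def)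
    have "(\<phi> (f x) - \<phi> x) + e * (G (f x) - G x) < 0" if "e > 0" "e < m / B" "x \<in> K" for e x
    proof -
      have "G (f x) - G x \<le> B" using x2 that(3) by (force simp: B_def)
      then have "e * (G (f x) - G x) \<le> e * B" using that(1) by (intro mult_left_mono) auto
      also have "\<dots> < m" using that(2) \<open>B > 0\<close> by (simp add: pos_less_divide_eq)
      also have "m \<le> \<phi> x - \<phi> (f x)" using x1(2) that(3) by (auto simp: m_def)
      finally show ?thesis by linarith
    qed
    moreover have "m / B > 0" using \<open>m > 0\<close> \<open>B > 0\<close> by simp
    ultimately show ?thesis unfolding eventually_at_right_field by blast
  qed simp
  moreover have "\<forall>\<^sub>F e in at_right 0. Morse_function A (\<lambda>x. \<phi> x + e * G x)"
    by (rule eventually_Morse[OF compact_space _ sG]) (use \<phi> in \<open>simp add: Lyapunov_function_def\<close>)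
  moreover have "\<forall>\<^sub>F e :: real in at_right 0. 0 < e" by (rule eventually_at_right_less)
  ultimately show ?thesis
  proof eventually_elim
    case (elim e)
    have "\<phi> (f x) + e * G (f x) < \<phi> x + e * G x" if "x \<notin> P" for x
    proof (cases "x \<in> K")
      case True
      with elim(1) have "(\<phi> (f x) - \<phi> x) + e * (G (f x) - G x) < 0" by blast
      then show ?thesis by (simp add: algebra_simps)
    next
      case False
      then have "e * G (f x) < e * G x" using near that elim(3) by simp
      moreover have "\<phi> (f x) < \<phi> x" using \<phi> that by (auto simp: Lyapunov_function_def)
      ultimately show ?thesis by linarith
    qed
    moreover have "\<phi> (f x) + e * G (f x) = \<phi> x + e * G x" if "x \<in> P" for x
      using \<phi> that G_P by (simp add: Lyapunov_function_def)
    ultimately show ?case using elim(2) by (simp add: Lyapunov_function_def)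
  qed
qed

text \<open>Nondegeneracy comes from growth at the rate \<open>e r\<close> near \<open>p\<close>.
  Extremality, and with it criticality, holds on the whole invariant set because the perturbed
  function is itself a Lyapunov function. The unstable case is treated as a minimum of the
  negative.\<close>

lemma Morse_Lyapunov_perturbation:
  assumes \<phi>: "Lyapunov_function A f \<phi>" and GR: "globally_adapted G R" and "e > 0"
    and \<psi>: "Lyapunov_function A f (\<lambda>x. \<phi> x + e * G x)"
  shows "Morse_Lyapunov_function A f (\<lambda>x. \<phi> x + e * G x)" (is "Morse_Lyapunov_function A f ?\<psi>")
  unfolding Morse_Lyapunov_function_def
proof (intro conjI ballI \<psi>)
  fix p assume p: "p \<in> P"
  note s\<psi> = Lyapunov_smooth[OF \<psi>]
  obtain U c r W where U: "(U, c) \<in> A" "r > 0" "open W" "p \<in> W" "W \<subseteq> U"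
    and R: "\<forall>x\<in>W. r * (norm (c x - c p))\<^sup>2 \<le> R x"
    using GR p unfolding globally_adapted_def by blast
  obtain N where N: "open N" "p \<in> N" "\<forall>x\<in>N \<inter> stable_set f p. G p + R x \<le> G x"
    "\<forall>x\<in>N \<inter> unstable_set f p. G x + R x \<le> G p"
    using globally_adapted_growth[OF \<phi> GR p] by blast
  have er: "e * r > 0" using U(2) \<open>e > 0\<close> by simp
  have NW: "open (N \<inter> W)" using N(1) U(3) by (rule open_Int)
  obtain E j E' j' where j: "immersion_onto A E j (stable_set f p)"
    and j': "immersion_onto A E' j' (unstable_set f p)"
    using immersion_exists[OF p] by blast
  have "p \<in> j ` E" "p \<in> j' ` E'"
    using j j' mem_stable_set[OF p] mem_unstable_set[OF p] by (simp_all add: immersion_onto_def)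
  then obtain y y' where y: "y \<in> E" "j y = p" and y': "y' \<in> E'" "j' y' = p" by (metis imageE)
  have s\<psi>': "smooth_fun A (\<lambda>x. - 1 * ?\<psi> x)" by (rule smooth_fun_cmult[OF s\<psi>])
  have "?\<psi> p + e * r * (norm (c x - c p))\<^sup>2 \<le> ?\<psi> x" if x: "x \<in> (N \<inter> W) \<inter> stable_set f p" for x
  proof -
    have "\<phi> p \<le> \<phi> x" using Lyapunov_stable_set[OF \<phi> p] x by blast
    moreover have "G p + r * (norm (c x - c p))\<^sup>2 \<le> G x" using N(3) R x by force
    then have "e * (G p + r * (norm (c x - c p))\<^sup>2) \<le> e * G x" using \<open>e > 0\<close> by simp
    ultimately show ?thesis by (simp add: algebra_simps)
  qed
  then have "nondegenerate_along E (?\<psi> \<circ> j) y"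
    using immersion_quadratic_growth[OF j s\<psi> y(1) U(1) _ NW _ er] y(2) N(2) U(4,5) by blast
  moreover have "critical_along E (?\<psi> \<circ> j) y"
    by (rule immersion_critical_min[OF j s\<psi> y(1)]) (use Lyapunov_stable_set[OF \<psi> p] y(2) in blast)
  ultimately show "nondegenerate_min_on A (stable_set f p) ?\<psi> p"
    unfolding nondegenerate_min_on_def nondegenerate_critical_on_def
    using j y Lyapunov_stable_set[OF \<psi> p] by blast
  have "- 1 * ?\<psi> p + e * r * (norm (c x - c p))\<^sup>2 \<le> - 1 * ?\<psi> x" if x: "x \<in> (N \<inter> W) \<inter> unstable_set f p" for x
  proof -
    have "\<phi> x \<le> \<phi> p" using Lyapunov_unstable_set[OF \<phi> p] x by blast
    moreover have "G x + r * (norm (c x - c p))\<^sup>2 \<le> G p" using N(4) R x by force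
    then have "e * (G x + r * (norm (c x - c p))\<^sup>2) \<le> e * G p" using \<open>e > 0\<close> by simp
    ultimately show ?thesis by (simp add: algebra_simps)
  qed
  then have "nondegenerate_along E' ((\<lambda>x. - 1 * ?\<psi> x) \<circ> j') y'"
    using immersion_quadratic_growth[OF j' s\<psi>' y'(1) U(1) _ NW _ er] y'(2) N(2) U(4,5) by blast
  moreover have "critical_along E' ((\<lambda>x. - 1 * ?\<psi> x) \<circ> j') y'"
    by (rule immersion_critical_min[OF j' s\<psi>' y'(1)])
       (use Lyapunov_unstable_set[OF \<psi> p] y'(2) in force)
  ultimately have "nondegenerate_along E' (?\<psi> \<circ> j') y'" "critical_along E' (?\<psi> \<circ> j') y'"
    using immersion_uminus[OF j' s\<psi>] by blast+
  then show "nondegenerate_max_on A (unstable_set f p) ?\<psi> p"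
    unfolding nondegenerate_max_on_def nondegenerate_critical_on_def
    using j' y' Lyapunov_unstable_set[OF \<psi> p] by blast
qed

lemma Morse_Lyapunov_dense:
  assumes \<phi>: "Lyapunov_function A f \<phi>" and T: "openin (Cinf_topology A) T" "\<phi> \<in> T"
  shows "\<exists>\<psi>\<in>T. Morse_Lyapunov_function A f \<psi>"
proof -
  obtain G R where GR: "globally_adapted G R" using globally_adapted_exists by blast
  then have sG: "smooth_fun A G" by (simp add: globally_adapted_def)
  have "\<forall>\<^sub>F e in at_right 0. 0 < e \<and> Lyapunov_function A f (\<lambda>x. \<phi> x + e * G x) \<and> (\<lambda>x. \<phi> x + e * G x) \<in> T"
    by (intro eventually_conj eventually_at_right_less eventually_Lyapunov[OF \<phi> GR]
        eventually_openin[OF Lyapunov_smooth[OF \<phi>] sG T])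
  then obtain e where "0 < e" "Lyapunov_function A f (\<lambda>x. \<phi> x + e * G x)" "(\<lambda>x. \<phi> x + e * G x) \<in> T"
    using eventually_happens'[OF trivial_limit_at_right_real] by blast
  then show ?thesis using Morse_Lyapunov_perturbation[OF \<phi> GR] by blast
qed

text \<open>The parametrization found for \<open>\<phi>\<close> is kept for \<open>\<psi>\<close>.
  Nondegeneracy persists on a neighbourhood, but criticality is not an open condition; it is drawn
  from extremality at \<open>p\<close>, which Lyapunov functions have on both invariant
  sets.\<close>

lemma nondegenerate_critical_on_open:
  assumes \<phi>: "smooth_fun A \<phi>" and nd: "nondegenerate_critical_on A W \<phi> p"
  shows "\<exists>T. openin (Cinf_topology A) T \<and> \<phi> \<in> T \<and>
    (\<forall>\<psi>\<in>T. smooth_fun A \<psi> \<longrightarrow> (\<forall>x\<in>W. \<psi> p \<le> \<psi> x) \<or> (\<forall>x\<in>W. \<psi> x \<le> \<psi> p) \<longrightarrow>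
      nondegenerate_critical_on A W \<psi> p)"
proof -
  obtain E j y where j: "immersion_onto A E j W" and y: "y \<in> E" "j y = p"
    and nd: "nondegenerate_along E (\<phi> \<circ> j) y"
    using nd unfolding nondegenerate_critical_on_def by blast
  obtain U c where U: "(U, c) \<in> A" "j y \<in> U" by (rule chart_exists)
  obtain \<epsilon> where \<epsilon>: "\<epsilon> > 0" "\<forall>\<psi>\<in>Cr_nbhd A 2 (U, c) {j y} \<epsilon> \<phi>. nondegenerate_along E (\<psi> \<circ> j) y"
    using immersion_nondegenerate_open[OF j \<phi> U nd] by blast
  have crit: "critical_along E (\<psi> \<circ> j) y"
    if \<psi>: "smooth_fun A \<psi>" and ext: "(\<forall>x\<in>W. \<psi> p \<le> \<psi> x) \<or> (\<forall>x\<in>W. \<psi> x \<le> \<psi> p)" for \<psi>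
    using ext
  proof
    assume "\<forall>x\<in>W. \<psi> p \<le> \<psi> x"
    then show ?thesis using immersion_critical_min[OF j \<psi> y(1)] y(2) by blast
  next
    assume *: "\<forall>x\<in>W. \<psi> x \<le> \<psi> p"
    have "critical_along E ((\<lambda>x. - 1 * \<psi> x) \<circ> j) y"
      by (rule immersion_critical_min[OF j smooth_fun_cmult[OF \<psi>] y(1)]) (use * y(2) in simp)
    then show ?thesis using immersion_uminus[OF j \<psi>] by blast
  qed
  let ?T = "Cr_nbhd A 2 (U, c) {j y} \<epsilon> \<phi>"
  have "openin (Cinf_topology A) ?T" using U \<epsilon>(1) by (intro openin_Cr_nbhd \<phi>) auto
  moreover have "\<phi> \<in> ?T" by (intro mem_Cr_nbhd \<phi> \<epsilon>)
  moreover have "\<forall>\<psi>\<in>?T. smooth_fun A \<psi> \<longrightarrow> (\<forall>x\<in>W. \<psi> p \<le> \<psi> x) \<or> (\<forall>x\<in>W. \<psi> x \<le> \<psi> p) \<longrightarrow>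
      nondegenerate_critical_on A W \<psi> p"
  proof (intro ballI impI)
    fix \<psi> assume "\<psi> \<in> ?T" "smooth_fun A \<psi>" "(\<forall>x\<in>W. \<psi> p \<le> \<psi> x) \<or> (\<forall>x\<in>W. \<psi> x \<le> \<psi> p)"
    then show "nondegenerate_critical_on A W \<psi> p"
      unfolding nondegenerate_critical_on_def
      by (intro exI[of _ E] exI[of _ j] exI[of _ y] conjI j y crit \<epsilon>(2)[rule_format])
  qed
  ultimately show ?thesis by (intro exI[of _ ?T] conjI)
qed

lemma Morse_Lyapunov_open:
  assumes \<phi>: "Morse_Lyapunov_function A f \<phi>"
  shows "\<exists>T. openin (Cinf_topology A) T \<and> \<phi> \<in> T \<and>
    (\<forall>\<psi>\<in>T. Lyapunov_function A f \<psi> \<longrightarrow> Morse_Lyapunov_function A f \<psi>)"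
proof -
  have s\<phi>: "smooth_fun A \<phi>" using \<phi> by (simp add: Morse_Lyapunov_function_def Lyapunov_smooth)
  have "\<exists>T. openin (Cinf_topology A) T \<and> \<phi> \<in> T \<and> (\<forall>\<psi>\<in>T. Lyapunov_function A f \<psi> \<longrightarrow>
      nondegenerate_max_on A (unstable_set f p) \<psi> p \<and> nondegenerate_min_on A (stable_set f p) \<psi> p)"
    if p: "p \<in> P" for p
  proof -
    have "nondegenerate_critical_on A (unstable_set f p) \<phi> p" "nondegenerate_critical_on A (stable_set f p) \<phi> p"
      using \<phi> p by (auto simp: Morse_Lyapunov_function_def nondegenerate_max_on_def nondegenerate_min_on_def)
    note open_nd = this[THEN nondegenerate_critical_on_open[OF s\<phi>]]
    obtain T where T: "openin (Cinf_topology A) T" "\<phi> \<in> T" "\<forall>\<psi>\<in>T. smooth_fun A \<psi> \<longrightarrow>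
        (\<forall>x\<in>unstable_set f p. \<psi> p \<le> \<psi> x) \<or> (\<forall>x\<in>unstable_set f p. \<psi> x \<le> \<psi> p) \<longrightarrow>
        nondegenerate_critical_on A (unstable_set f p) \<psi> p"
      using open_nd(1) by (elim exE conjE)
    obtain T' where T': "openin (Cinf_topology A) T'" "\<phi> \<in> T'" "\<forall>\<psi>\<in>T'. smooth_fun A \<psi> \<longrightarrow>
        (\<forall>x\<in>stable_set f p. \<psi> p \<le> \<psi> x) \<or> (\<forall>x\<in>stable_set f p. \<psi> x \<le> \<psi> p) \<longrightarrow>
        nondegenerate_critical_on A (stable_set f p) \<psi> p"
      using open_nd(2) by (elim exE conjE)
    show ?thesis
      using T T' Lyapunov_smooth Lyapunov_stable_set[OF _ p] Lyapunov_unstable_set[OF _ p]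
      unfolding nondegenerate_max_on_def nondegenerate_min_on_def
      by (intro exI[of _ "T \<inter> T'"]) auto
  qed
  then obtain T where T: "\<And>p. p \<in> P \<Longrightarrow> openin (Cinf_topology A) (T p) \<and> \<phi> \<in> T p \<and>
      (\<forall>\<psi>\<in>T p. Lyapunov_function A f \<psi> \<longrightarrow>
        nondegenerate_max_on A (unstable_set f p) \<psi> p \<and> nondegenerate_min_on A (stable_set f p) \<psi> p)"
    by metis
  \<comment> \<open>An intersection over an empty index set would contain all functions; the factor
    \<open>topspace\<close> keeps the set open in that case too.\<close>
  let ?S = "(\<Inter>p\<in>P. T p) \<inter> topspace (Cinf_topology A)"
  have "openin (Cinf_topology A) ?S" using finite_P T by (intro openin_INT) auto
  moreover have "\<phi> \<in> ?S" using T topspace_Cinf[OF s\<phi>] by simp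
  moreover have "\<forall>\<psi>\<in>?S. Lyapunov_function A f \<psi> \<longrightarrow> Morse_Lyapunov_function A f \<psi>"
    using T by (simp add: Morse_Lyapunov_function_def)
  ultimately show ?thesis by (intro exI[of _ ?S] conjI)
qed

end

theorem theorem1:
  fixes A :: "('a::{t2_space,second_countable_topology}, 'n::finite) chart set"
    and f :: "'a \<Rightarrow> 'a"
  assumes "closed_manifold A" and "orientable A" and "Morse_Smale A f"
  shows "residual_in
           (subtopology (Cinf_topology A) {\<phi>. Lyapunov_function A f \<phi>})
           {\<phi>. Morse_Lyapunov_function A f \<phi>}"
proof -
  interpret morse_smale A f
    by unfold_locales (use assms in \<open>auto simp: closed_manifold_def\<close>)
  let ?L = "{\<phi>. Lyapunov_function A f \<phi>}" and ?M = "{\<phi>. Morse_Lyapunov_function A f \<phi>}"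
  let ?T = "subtopology (Cinf_topology A) ?L"
  have sub: "?M \<subseteq> ?L" by (auto simp: Morse_Lyapunov_function_def)
  have top: "topspace ?T = ?L"
    using topspace_Cinf Lyapunov_smooth by auto
  have "openin ?T ?M"
  proof (subst openin_subopen, rule ballI)
    fix \<phi> assume "\<phi> \<in> ?M"
    then obtain T where "openin (Cinf_topology A) T" "\<phi> \<in> T"
      "\<forall>\<psi>\<in>T. Lyapunov_function A f \<psi> \<longrightarrow> Morse_Lyapunov_function A f \<psi>"
      using Morse_Lyapunov_open by blast
    then show "\<exists>T. openin ?T T \<and> \<phi> \<in> T \<and> T \<subseteq> ?M"
      using sub \<open>\<phi> \<in> ?M\<close> by (intro exI[of _ "T \<inter> ?L"]) (auto simp: openin_subtopology)
  qed
  moreover have "?T closure_of ?M = topspace ?T"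
  proof (rule antisym[OF closure_of_subset_topspace subsetI])
    fix \<phi> assume \<phi>: "\<phi> \<in> topspace ?T"
    show "\<phi> \<in> ?T closure_of ?M"
      unfolding in_closure_of
    proof (intro conjI allI impI \<phi>)
      fix S assume "\<phi> \<in> S \<and> openin ?T S"
      then obtain T where "openin (Cinf_topology A) T" "S = T \<inter> ?L" "\<phi> \<in> T"
        by (auto simp: openin_subtopology)
      then show "\<exists>\<psi>. \<psi> \<in> ?M \<and> \<psi> \<in> S"
        using Morse_Lyapunov_dense[of \<phi> T] \<phi> top sub by blast
    qed
  qed
  \<comment> \<open>An open dense set is residual by the constant sequence.\<close>
  ultimately show ?thesis
    unfolding residual_in_def by (intro exI[of _ "\<lambda>_. ?M"]) auto
qed

end
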